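(* Let $k$ be a field, let $g$ and $d$ be natural numbers, and suppose that $M\in\mathrm{Rep}_k(\mathcal{G}_g^{\mathrm{op}})$ is $d$-smallish. Let $G$ be a graph of genus $g$, let $r$ be a natural number, and let $\underline e=(e_1,\dots,e_r)$ be an ordered $r$-tuple of distinct directed non-loop edges of $G$. Then there exists a multivariate polynomial $f_{M,G,\underline e}(t_1,\dots,t_r)$ of total degree at most $d$ such that, if $\underline m=(m_1,\dots,m_r)$ is sufficiently large in every coordinate, $$\dim_k M(G(\underline e,\underline m))=f_{M,G,\underline e}(m_1,\dots,m_r).$$
   Context: A graph is a finite CW complex of dimension at most 1; 0-cells are vertices, 1-cells are edges (loops and multiple edges allowed). The genus of a non-empty connected graph is the rank of its first homology; a "graph of genus $g$" is always non-empty and connected. A map of CW complexes between graphs is very cellular if it takes every vertex to a vertex and every edge to either a vertex or an edge. A graph morphism is an equivalence class of very cellular maps under homotopy through very cellular maps. A contraction is a surjective graph morphism with contractible fibers (it amounts to collapsing a set of edges forming a forest, followed by a graph isomorphism). $\mathcal{G}_g$ is the category of graphs of genus $g$ with contractions as morphisms, and $\mathrm{Rep}_k(\mathcal{G}_g^{\mathrm{op}})$ is the category of functors from $\mathcal{G}_g^{\mathrm{op}}$ to $k$-modules. $M$ is finitely generated in degrees $\le d$ if there are finitely many graphs $G_1,\dots,G_s$ of genus $g$, each with at most $d$ edges, and elements $v_i\in M(G_i)$ such that for every $G$, $M(G)$ is spanned by the images of the $v_i$ under the maps $M(G_i)\to M(G)$ induced by all contractions $G\to G_i$. $M$ is $d$-small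 if it is a subquotient of a module that is finitely generated in degrees $\le d$, and $d$-smallish if it admits a (finite) filtration by submodules, $0=M_0\subset\dots\subset M_m=M$, whose associated graded module is $d$-small. For an $r$-tuple $\underline m=(m_1,\dots,m_r)$ of positive integers, $G(\underline e,\underline m)$ is the graph obtained from $G$ by subdividing each edge $e_i$ into a path of $m_i$ edges. "Sufficiently large in every coordinate" means that there is a constant $N$ such that the equality holds whenever $m_i\ge N$ for all $i$. The polynomial has rational coefficients. *)

theory Defs
  imports
    Complex_Main
    "HOL-Library.Countable"
    "HOL-Library.FuncSet"
    "HOL-Library.Function_Algebras"
    "HOL-Library.Poly_Mapping"
    "HOL-Algebra.AbelCoset"
    "Jordan_Normal_Form.Missing_VectorSpace"
begin

section \<open>Graphs\<close>

text \<open>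
  A finite CW complex of dimension at most 1 is recorded by its incidence data: the set of
  vertices, the set of directed edges (darts), the initial vertex of every dart, and the
  fixed-point-free involution that reverses darts. An edge is a pair of mutually opposite
  darts, so loops and multiple edges are allowed, and the flip of a loop is visible.
\<close>

record ('v, 'd) graph =
  verts :: "'v set"
  darts :: "'d set"
  tail :: "'d \<Rightarrow> 'v"
  opp :: "'d \<Rightarrow> 'd"

definition wf_graph :: "('v, 'd) graph \<Rightarrow> bool" where
  "wf_graph G \<longleftrightarrow> finite (verts G) \<and> finite (darts G) \<and>
     (\<forall>d\<in>darts G. tail G d \<in> verts G \<and> opp G d \<in> darts G \<and>
        opp G d \<noteq> d \<and> opp G (opp G d) = d)"

definition head :: "('v, 'd) graph \<Rightarrow> 'd \<Rightarrow> 'v" where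
  "head G d = tail G (opp G d)"

definition edge_of :: "('v, 'd) graph \<Rightarrow> 'd \<Rightarrow> 'd set" where
  "edge_of G d = {d, opp G d}"

definition edges :: "('v, 'd) graph \<Rightarrow> 'd set set" where
  "edges G = edge_of G ` darts G"

definition connected_graph :: "('v, 'd) graph \<Rightarrow> bool" where
  "connected_graph G \<longleftrightarrow>
     (\<forall>u\<in>verts G. \<forall>v\<in>verts G. (u, v) \<in> {(tail G d, head G d) |d. d \<in> darts G}\<^sup>*)"

text \<open>
  Cellular 1-chains with rational coefficients are the functions on darts that change sign
  under reversal; the coefficient of the boundary at a vertex is, up to sign, the sum
  over the darts leaving it. There are no 2-cells, so the 1-cycles are the first homology
  with rational coefficients, whose dimension is the rank of the first homology.
\<close>

definition H1 :: "('v, 'd) graph \<Rightarrow> ('d \<Rightarrow> rat) set" where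
  "H1 G = {c. (\<forall>d. d \<notin> darts G \<longrightarrow> c d = 0) \<and> (\<forall>d\<in>darts G. c (opp G d) = - c d) \<and>
      (\<forall>v\<in>verts G. (\<Sum>d | d \<in> darts G \<and> tail G d = v. c d) = 0)}"

definition genus :: "('v, 'd) graph \<Rightarrow> nat" where
  "genus G = vector_space.dim (\<lambda>(q::rat) c d. q * c d) (H1 G)"

definition graph_of_genus :: "nat \<Rightarrow> ('v, 'd) graph \<Rightarrow> bool" where
  "graph_of_genus g G \<longleftrightarrow> wf_graph G \<and> verts G \<noteq> {} \<and> connected_graph G \<and> genus G = g"


section \<open>Contractions\<close>

text \<open>
  Up to homotopy, a very cellular map is recorded by the images of the vertices and of the
  darts, a dart going either to a dart or to a vertex. (The classes that wrap an edge several
  times around a loop are not recorded; they have disconnected fibers.)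
  Morphisms are extensional, so equal morphisms are equal functions.
\<close>

definition cells :: "('v, 'd) graph \<Rightarrow> ('v + 'd) set" where
  "cells G = verts G <+> darts G"

definition cell_tail :: "('v, 'd) graph \<Rightarrow> 'v + 'd \<Rightarrow> 'v + 'd" where
  "cell_tail G x = (case x of Inl v \<Rightarrow> Inl v | Inr d \<Rightarrow> Inl (tail G d))"

definition cell_opp :: "('v, 'd) graph \<Rightarrow> 'v + 'd \<Rightarrow> 'v + 'd" where
  "cell_opp G x = (case x of Inl v \<Rightarrow> Inl v | Inr d \<Rightarrow> Inr (opp G d))"

definition graph_morphism ::
  "('v, 'd) graph \<Rightarrow> ('w, 'e) graph \<Rightarrow> ('v + 'd \<Rightarrow> 'w + 'e) \<Rightarrow> bool" where
  "graph_morphism G G' \<phi> \<longleftrightarrow> \<phi> \<in> cells G \<rightarrow>\<^sub>E cells G' \<and>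
     (\<forall>x\<in>cells G. \<phi> (cell_tail G x) = cell_tail G' (\<phi> x) \<and>
        \<phi> (cell_opp G x) = cell_opp G' (\<phi> x))"

definition vertex_fiber ::
  "('v, 'd) graph \<Rightarrow> ('v + 'd \<Rightarrow> 'w + 'e) \<Rightarrow> 'w \<Rightarrow> ('v, 'd) graph" where
  "vertex_fiber G \<phi> w = G\<lparr>verts := {v \<in> verts G. \<phi> (Inl v) = Inl w},
                         darts := {d \<in> darts G. \<phi> (Inr d) = Inl w}\<rparr>"

text \<open>
  The fiber over a vertex is a graph, contractible iff it is a tree, that is, non-empty and
  connected with vanishing first homology. The fiber over an interior point of an edge is a
  discrete set with one point for each edge lying over it, contractible iff it is a singleton.
\<close>

definition contraction ::
  "('v, 'd) graph \<Rightarrow> ('w, 'e) graph \<Rightarrow> ('v + 'd \<Rightarrow> 'w + 'e) \<Rightarrow> bool" where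
  "contraction G G' \<phi> \<longleftrightarrow> graph_morphism G G' \<phi> \<and> \<phi> ` cells G = cells G' \<and>
     (\<forall>w\<in>verts G'. graph_of_genus 0 (vertex_fiber G \<phi> w)) \<and>
     (\<forall>d'\<in>darts G'. \<exists>!d. d \<in> darts G \<and> \<phi> (Inr d) = Inr d')"


section \<open>Representations of the opposite contraction category\<close>

text \<open>
  Every finite graph is isomorphic to one whose vertices and darts are natural numbers, so
  these graphs form a category equivalent to the category of all graphs.
\<close>

type_synonym ngraph = "(nat, nat) graph"
type_synonym ncellmap = "nat + nat \<Rightarrow> nat + nat"

text \<open>For a contraction \<open>\<phi>\<close> from \<open>G\<close> to \<open>G'\<close>, \<open>act M G G' \<phi>\<close> is the induced map from
  \<open>obj M G'\<close> to \<open>obj M G\<close>.\<close>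

record ('a, 'b) rep =
  obj :: "ngraph \<Rightarrow> ('a, 'b) module"
  act :: "ngraph \<Rightarrow> ngraph \<Rightarrow> ncellmap \<Rightarrow> 'b \<Rightarrow> 'b"

definition contraction_in :: "nat \<Rightarrow> ngraph \<Rightarrow> ngraph \<Rightarrow> ncellmap \<Rightarrow> bool" where
  "contraction_in g G G' \<phi> \<longleftrightarrow>
     graph_of_genus g G \<and> graph_of_genus g G' \<and> contraction G G' \<phi>"

definition is_rep :: "('a, 'r) ring_scheme \<Rightarrow> nat \<Rightarrow> ('a, 'b) rep \<Rightarrow> bool" where
  "is_rep K g M \<longleftrightarrow>
     (\<forall>G. graph_of_genus g G \<longrightarrow> vectorspace K (obj M G)) \<and>
     (\<forall>G G' \<phi>. contraction_in g G G' \<phi> \<longrightarrow>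
        act M G G' \<phi> \<in> module_hom K (obj M G') (obj M G)) \<and>
     (\<forall>G. graph_of_genus g G \<longrightarrow>
        (\<forall>x\<in>carrier (obj M G). act M G G (restrict id (cells G)) x = x)) \<and>
     (\<forall>G G' G'' \<phi> \<psi>. contraction_in g G G' \<phi> \<and> contraction_in g G' G'' \<psi> \<longrightarrow>
        (\<forall>x\<in>carrier (obj M G''). act M G G'' (compose (cells G) \<psi> \<phi>) x =
                                  act M G G' \<phi> (act M G' G'' \<psi> x)))"

definition rep_iso ::
  "('a, 'r) ring_scheme \<Rightarrow> nat \<Rightarrow> ('a, 'b) rep \<Rightarrow> ('a, 'c) rep \<Rightarrow> bool" where
  "rep_iso K g M M' \<longleftrightarrow> (\<exists>\<eta>.
     (\<forall>G. graph_of_genus g G \<longrightarrow> \<eta> G \<in> module_hom K (obj M G) (obj M' G) \<and>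
        bij_betw (\<eta> G) (carrier (obj M G)) (carrier (obj M' G))) \<and>
     (\<forall>G G' \<phi>. contraction_in g G G' \<phi> \<longrightarrow>
        (\<forall>x\<in>carrier (obj M G'). \<eta> G (act M G G' \<phi> x) = act M' G G' \<phi> (\<eta> G' x))))"

definition is_subrep ::
  "('a, 'r) ring_scheme \<Rightarrow> nat \<Rightarrow> ('a, 'b) rep \<Rightarrow> (ngraph \<Rightarrow> 'b set) \<Rightarrow> bool" where
  "is_subrep K g M N \<longleftrightarrow>
     (\<forall>G. graph_of_genus g G \<longrightarrow> LinearCombinations.submodule K (N G) (obj M G)) \<and>
     (\<forall>G G' \<phi>. contraction_in g G G' \<phi> \<longrightarrow> act M G G' \<phi> ` N G' \<subseteq> N G)"

definition sub_rep :: "('a, 'b) rep \<Rightarrow> (ngraph \<Rightarrow> 'b set) \<Rightarrow> ('a, 'b) rep" where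
  "sub_rep M N = M\<lparr>obj := \<lambda>G. (obj M G)\<lparr>carrier := N G\<rparr>\<rparr>"

text \<open>The ring multiplication and unit of a \<open>module\<close> record play no role.\<close>

definition quot_module :: "('a, 'b) module \<Rightarrow> 'b set \<Rightarrow> ('a, 'b set) module" where
  "quot_module V W =
     \<lparr>carrier = a_rcosets\<^bsub>V\<^esub> W, mult = (\<lambda>X Y. W), one = W, zero = W, add = set_add V,
      smult = (\<lambda>a X. \<Union>x\<in>X. W +>\<^bsub>V\<^esub> (a \<odot>\<^bsub>V\<^esub> x))\<rparr>"

definition quot_rep :: "('a, 'b) rep \<Rightarrow> (ngraph \<Rightarrow> 'b set) \<Rightarrow> ('a, 'b set) rep" where
  "quot_rep M N =
     \<lparr>obj = (\<lambda>G. quot_module (obj M G) (N G)),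
      act = (\<lambda>G G' \<phi> X. \<Union>x\<in>X. N G +>\<^bsub>obj M G\<^esub> act M G G' \<phi> x)\<rparr>"

definition dsum_module :: "'i set \<Rightarrow> ('i \<Rightarrow> ('a, 'b) module) \<Rightarrow> ('a, 'i \<Rightarrow> 'b) module" where
  "dsum_module I V =
     \<lparr>carrier = (\<Pi>\<^sub>E i\<in>I. carrier (V i)), mult = (\<lambda>x y. \<lambda>i\<in>I. \<zero>\<^bsub>V i\<^esub>),
      one = (\<lambda>i\<in>I. \<zero>\<^bsub>V i\<^esub>), zero = (\<lambda>i\<in>I. \<zero>\<^bsub>V i\<^esub>),
      add = (\<lambda>x y. \<lambda>i\<in>I. x i \<oplus>\<^bsub>V i\<^esub> y i), smult = (\<lambda>a x. \<lambda>i\<in>I. a \<odot>\<^bsub>V i\<^esub> x i)\<rparr>"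

text \<open>Only used for finite \<open>I\<close>, where the product is the direct sum.\<close>

definition dsum_rep :: "'i set \<Rightarrow> ('i \<Rightarrow> ('a, 'b) rep) \<Rightarrow> ('a, 'i \<Rightarrow> 'b) rep" where
  "dsum_rep I Q =
     \<lparr>obj = (\<lambda>G. dsum_module I (\<lambda>i. obj (Q i) G)),
      act = (\<lambda>G G' \<phi> x. \<lambda>i\<in>I. act (Q i) G G' \<phi> (x i))\<rparr>"

definition gr_rep :: "('a, 'b) rep \<Rightarrow> nat \<Rightarrow> (nat \<Rightarrow> ngraph \<Rightarrow> 'b set) \<Rightarrow> ('a, nat \<Rightarrow> 'b set) rep"
  where "gr_rep M n F = dsum_rep {..<n} (\<lambda>i. quot_rep (sub_rep M (F (Suc i))) (F i))"


section \<open>Small and smallish representations\<close>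

definition fin_gen_in_degrees_le ::
  "('a, 'r) ring_scheme \<Rightarrow> nat \<Rightarrow> nat \<Rightarrow> ('a, 'b) rep \<Rightarrow> bool" where
  "fin_gen_in_degrees_le K g d M \<longleftrightarrow> (\<exists>S :: (ngraph \<times> 'b) set. finite S \<and>
     (\<forall>(H, v)\<in>S. graph_of_genus g H \<and> card (edges H) \<le> d \<and> v \<in> carrier (obj M H)) \<and>
     (\<forall>G. graph_of_genus g G \<longrightarrow> carrier (obj M G) =
        LinearCombinations.module.span K (obj M G)
          {act M G H \<phi> v |H v \<phi>. (H, v) \<in> S \<and> contraction_in g G H \<phi>}))"

text \<open>
  The type argument is the type in which the values of the finitely generated module live.
  HOL cannot quantify over it existentially, but a theorem that assumes smallness for an
  arbitrary type variable covers every such module.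
\<close>

definition d_small ::
  "'c itself \<Rightarrow> ('a, 'r) ring_scheme \<Rightarrow> nat \<Rightarrow> nat \<Rightarrow> ('a, 'b) rep \<Rightarrow> bool" where
  "d_small T K g d M \<longleftrightarrow> (\<exists>(P :: ('a, 'c) rep) N N'.
     is_rep K g P \<and> fin_gen_in_degrees_le K g d P \<and>
     is_subrep K g P N \<and> is_subrep K g (sub_rep P N) N' \<and>
     rep_iso K g M (quot_rep (sub_rep P N) N'))"

definition is_filtration ::
  "('a, 'r) ring_scheme \<Rightarrow> nat \<Rightarrow> ('a, 'b) rep \<Rightarrow> nat \<Rightarrow> (nat \<Rightarrow> ngraph \<Rightarrow> 'b set) \<Rightarrow> bool" where
  "is_filtration K g M n F \<longleftrightarrow>
     (\<forall>i\<le>n. is_subrep K g M (F i)) \<and>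
     (\<forall>G. graph_of_genus g G \<longrightarrow> F 0 G = {\<zero>\<^bsub>obj M G\<^esub>} \<and> F n G = carrier (obj M G) \<and>
        (\<forall>i<n. F i G \<subseteq> F (Suc i) G))"

definition d_smallish ::
  "'c itself \<Rightarrow> ('a, 'r) ring_scheme \<Rightarrow> nat \<Rightarrow> nat \<Rightarrow> ('a, 'b) rep \<Rightarrow> bool" where
  "d_smallish T K g d M \<longleftrightarrow>
     (\<exists>n F. is_filtration K g M n F \<and> d_small T K g d (gr_rep M n F))"


section \<open>Subdivision\<close>

text \<open>
  The dart \<open>es ! i\<close> becomes a path with vertices \<open>path_vertex G es m i j\<close> for
  \<open>j = 0, \<dots>, m i\<close> and edges numbered \<open>j = 0, \<dots>, m i - 1\<close>; the dart \<open>Inr (i, j, True)\<close> runs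
  from vertex \<open>j\<close> to vertex \<open>j + 1\<close> of the path, and \<open>Inr (i, j, False)\<close> is its opposite.
\<close>

definition path_vertex ::
  "('v, 'd) graph \<Rightarrow> 'd list \<Rightarrow> (nat \<Rightarrow> nat) \<Rightarrow> nat \<Rightarrow> nat \<Rightarrow> 'v + nat \<times> nat" where
  "path_vertex G es m i j =
     (if j = 0 then Inl (tail G (es ! i))
      else if j = m i then Inl (head G (es ! i))
      else Inr (i, j))"

definition subdivide ::
  "('v, 'd) graph \<Rightarrow> 'd list \<Rightarrow> (nat \<Rightarrow> nat) \<Rightarrow>
     ('v + nat \<times> nat, 'd + nat \<times> nat \<times> bool) graph" where
  "subdivide G es m =
     \<lparr>verts = verts G <+> {(i, j). i < length es \<and> 0 < j \<and> j < m i},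
      darts = {d \<in> darts G. edge_of G d \<notin> edge_of G ` set es} <+>
              {(i, j, b). i < length es \<and> j < m i},
      tail = (\<lambda>x. case x of Inl d \<Rightarrow> Inl (tail G d)
                | Inr (i, j, b) \<Rightarrow> path_vertex G es m i (if b then j else Suc j)),
      opp = (\<lambda>x. case x of Inl d \<Rightarrow> Inl (opp G d) | Inr (i, j, b) \<Rightarrow> Inr (i, j, \<not> b))\<rparr>"

definition to_ngraph :: "('v::countable, 'd::countable) graph \<Rightarrow> ngraph" where
  "to_ngraph G =
     \<lparr>verts = to_nat ` verts G, darts = to_nat ` darts G,
      tail = (\<lambda>d. to_nat (tail G (from_nat d))),
      opp = (\<lambda>d. to_nat (opp G (from_nat d)))\<rparr>"


section \<open>Multivariate polynomials\<close>

definition poly_vars_deg_le :: "nat \<Rightarrow> nat \<Rightarrow> ((nat \<Rightarrow>\<^sub>0 nat) \<Rightarrow>\<^sub>0 rat) \<Rightarrow> bool" where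
  "poly_vars_deg_le r d f \<longleftrightarrow>
     (\<forall>\<alpha>\<in>Poly_Mapping.keys f. Poly_Mapping.keys \<alpha> \<subseteq> {..<r} \<and>
        (\<Sum>i\<in>Poly_Mapping.keys \<alpha>. Poly_Mapping.lookup \<alpha> i) \<le> d)"

definition poly_eval :: "((nat \<Rightarrow>\<^sub>0 nat) \<Rightarrow>\<^sub>0 rat) \<Rightarrow> (nat \<Rightarrow> rat) \<Rightarrow> rat" where
  "poly_eval f x =
     (\<Sum>\<alpha>\<in>Poly_Mapping.keys f. Poly_Mapping.lookup f \<alpha> *
        (\<Prod>i\<in>Poly_Mapping.keys \<alpha>. x i ^ Poly_Mapping.lookup \<alpha> i))"

end

theory Submission
  imports Defs "HOL-Library.List_Lexorder" "HOL-Library.Product_Lexorder"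
begin

text \<open>
  Write \<open>\<Gamma> m\<close> for the subdivision and let \<open>gr M\<close> be isomorphic to \<open>N / N'\<close>, where \<open>N' \<subseteq> N \<subseteq> P\<close>
  and \<open>P\<close> is generated by finitely many \<open>v \<in> P(H)\<close>, where \<open>H\<close> has at most \<open>d\<close> edges. Then
  \<open>P(\<Gamma> m)\<close> is spanned by the vectors induced by contractions \<open>\<Gamma> m \<rightarrow> H\<close>. Such a contraction is
  determined by one of finitely many combinatorial types together with the set of path edges
  that it keeps, and there are at most \<open>d\<close> of those. Order the contractions by type and then
  lexicographically by the kept edges. The dimension of \<open>M(\<Gamma> m)\<close> is the number of leading terms
  of \<open>N(\<Gamma> m)\<close> minus the number of leading terms of \<open>N'(\<Gamma> m)\<close>, as for Groebner bases.

  Collapsing one edge of a path is a contraction from a longer subdivision to a shorter one, so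
  leading terms remain leading terms when a collapsed edge is inserted anywhere in a path.
  Recording a set of kept edges by the lengths of the gaps between them, the leading terms of
  a given type form an upward closed subset of some \<open>\<nat>\<^sup>X\<close>, which is a finite union of
  translated orthants by Dickson's lemma. Inclusion-exclusion and counting compositions give
  a polynomial whose total degree is at most the number of kept edges.
\<close>

section \<open>Polynomial functions\<close>

text \<open>The vectors induced by the contractions may be linearly dependent, so leading terms are
  taken in the free space on the contractions. A relation makes its largest contraction leading for
  \<open>N\<close> and for \<open>N'\<close> alike; relations thus cancel in the difference of the
  two counts, and no basis of \<open>P\<close> has to be chosen. The filtration of \<open>M\<close>
  pulls back to a chain between \<open>N'\<close> and \<open>N\<close>, along which the dimension of
  \<open>M\<close> is counted step by step.

  Inserting a collapsed edge must keep the order of the contractions. The type forgets positions,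
  hence does not change, and positions move by a strictly increasing map, which keeps lexicographic
  comparison.

  The degree comes from the gaps: \<open>k\<close> kept edges in a path of \<open>m\<close> edges
  leave \<open>k + 1\<close> gaps with sum \<open>m - k\<close>. An insertion raises one gap by one.
  Prescribing the length of the path removes one degree of freedom, so an orthant contributes a
  binomial coefficient of degree \<open>k\<close> in \<open>m\<close>. Kept edges have distinct
  images in \<open>H\<close>, whence the bound \<open>d\<close>.\<close>

definition polyfun :: "nat \<Rightarrow> nat \<Rightarrow> ((nat \<Rightarrow> rat) \<Rightarrow> rat) \<Rightarrow> bool" where
  "polyfun r d F \<longleftrightarrow> (\<exists>f. poly_vars_deg_le r d f \<and> (\<forall>x. poly_eval f x = F x))"

lemma poly_eval_superset:
  assumes "finite A" "Poly_Mapping.keys f \<subseteq> A"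
  shows "poly_eval f x = (\<Sum>\<alpha>\<in>A. Poly_Mapping.lookup f \<alpha> *
           (\<Prod>i\<in>Poly_Mapping.keys \<alpha>. x i ^ Poly_Mapping.lookup \<alpha> i))"
  unfolding poly_eval_def
  by (rule sum.mono_neutral_left) (use assms in \<open>auto simp: in_keys_iff\<close>)

lemma poly_eval_add: "poly_eval (f + g) x = poly_eval f x + poly_eval g x"
proof -
  let ?A = "Poly_Mapping.keys f \<union> Poly_Mapping.keys g"
  have "Poly_Mapping.keys (f + g) \<subseteq> ?A" by (rule keys_add)
  then show ?thesis
    by (simp add: poly_eval_superset[of ?A] lookup_add distrib_right sum.distrib)
qed

lemma polyfun_mono: "polyfun r d F \<Longrightarrow> d \<le> d' \<Longrightarrow> polyfun r d' F"
  unfolding polyfun_def poly_vars_deg_le_def by (meson le_trans)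

lemma polyfun_add:
  assumes "polyfun r d F" "polyfun r d F'"
  shows "polyfun r d (\<lambda>x. F x + F' x)"
proof -
  obtain f f' where "poly_vars_deg_le r d f" "\<forall>x. poly_eval f x = F x"
    "poly_vars_deg_le r d f'" "\<forall>x. poly_eval f' x = F' x"
    using assms unfolding polyfun_def by blast
  moreover from this have "poly_vars_deg_le r d (f + f')"
    unfolding poly_vars_deg_le_def using keys_add[of f f'] by blast
  ultimately show ?thesis
    unfolding polyfun_def using poly_eval_add by metis
qed

lemma polyfun_monomial:
  assumes "Poly_Mapping.keys \<alpha> \<subseteq> {..<r}"
    and "(\<Sum>i\<in>Poly_Mapping.keys \<alpha>. Poly_Mapping.lookup \<alpha> i) \<le> d"
  shows "polyfun r d (\<lambda>x. c * (\<Prod>i\<in>Poly_Mapping.keys \<alpha>. x i ^ Poly_Mapping.lookup \<alpha> i))"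
  unfolding polyfun_def
  by (rule exI[of _ "Poly_Mapping.single \<alpha> c"])
    (use assms in \<open>auto simp: poly_vars_deg_le_def poly_eval_def split: if_splits\<close>)

lemma polyfun_const: "polyfun r d (\<lambda>x. c)"
  using polyfun_monomial[of 0 r d c] by simp

lemma polyfun_var: "i < r \<Longrightarrow> polyfun r 1 (\<lambda>x. x i)"
  using polyfun_monomial[of "Poly_Mapping.single i 1" r 1 1] by simp

lemma polyfun_sum:
  "(\<And>a. a \<in> A \<Longrightarrow> polyfun r d (F a)) \<Longrightarrow> polyfun r d (\<lambda>x. \<Sum>a\<in>A. F a x)"
  by (induction A rule: infinite_finite_induct) (auto intro: polyfun_const polyfun_add)

lemma monomial_add:
  "(\<Prod>i\<in>Poly_Mapping.keys (\<alpha> + \<beta>). x i ^ Poly_Mapping.lookup (\<alpha> + \<beta>) i) =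
   (\<Prod>i\<in>Poly_Mapping.keys \<alpha>. (x i :: rat) ^ Poly_Mapping.lookup \<alpha> i) *
   (\<Prod>i\<in>Poly_Mapping.keys \<beta>. x i ^ Poly_Mapping.lookup \<beta> i)"
proof -
  let ?A = "Poly_Mapping.keys \<alpha> \<union> Poly_Mapping.keys \<beta>"
  have ext: "(\<Prod>i\<in>Poly_Mapping.keys \<gamma>. x i ^ Poly_Mapping.lookup \<gamma> i) =
      (\<Prod>i\<in>?A. x i ^ Poly_Mapping.lookup \<gamma> i)" if "Poly_Mapping.keys \<gamma> \<subseteq> ?A" for \<gamma>
    by (rule prod.mono_neutral_left) (use that in \<open>auto simp: in_keys_iff\<close>)
  show ?thesis
    using ext[of \<alpha>] ext[of \<beta>] ext[of "\<alpha> + \<beta>"] keys_add[of \<alpha> \<beta>]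
    by (simp add: lookup_add power_add prod.distrib)
qed

lemma degree_add:
  "(\<Sum>i\<in>Poly_Mapping.keys (\<alpha> + \<beta>). Poly_Mapping.lookup (\<alpha> + \<beta>) i) =
   (\<Sum>i\<in>Poly_Mapping.keys \<alpha>. Poly_Mapping.lookup \<alpha> i) +
   (\<Sum>i\<in>Poly_Mapping.keys \<beta>. (Poly_Mapping.lookup \<beta> i :: nat))"
proof -
  let ?A = "Poly_Mapping.keys \<alpha> \<union> Poly_Mapping.keys \<beta>"
  have ext: "(\<Sum>i\<in>Poly_Mapping.keys \<gamma>. Poly_Mapping.lookup \<gamma> i) =
      (\<Sum>i\<in>?A. Poly_Mapping.lookup \<gamma> i)" if "Poly_Mapping.keys \<gamma> \<subseteq> ?A" for \<gamma>
    by (rule sum.mono_neutral_left) (use that in \<open>auto simp: in_keys_iff\<close>)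
  show ?thesis
    using ext[of \<alpha>] ext[of \<beta>] ext[of "\<alpha> + \<beta>"] keys_add[of \<alpha> \<beta>]
    by (simp add: lookup_add sum.distrib)
qed

text \<open>Expanding into a double sum of monomials replaces the product of
  \<open>poly_mapping\<close>s by the addition of exponents.\<close>

lemma polyfun_mult:
  assumes "polyfun r d F" "polyfun r d' F'"
  shows "polyfun r (d + d') (\<lambda>x. F x * F' x)"
proof -
  obtain f f' where f: "poly_vars_deg_le r d f" "\<forall>x. poly_eval f x = F x"
    and f': "poly_vars_deg_le r d' f'" "\<forall>x. poly_eval f' x = F' x"
    using assms unfolding polyfun_def by blast
  have "F x * F' x = (\<Sum>\<alpha>\<in>Poly_Mapping.keys f. \<Sum>\<beta>\<in>Poly_Mapping.keys f'.
      (Poly_Mapping.lookup f \<alpha> * Poly_Mapping.lookup f' \<beta>) *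
      (\<Prod>i\<in>Poly_Mapping.keys (\<alpha> + \<beta>). x i ^ Poly_Mapping.lookup (\<alpha> + \<beta>) i))" for x
    unfolding f(2)[rule_format, symmetric] f'(2)[rule_format, symmetric] poly_eval_def
      monomial_add sum_product
    by (intro sum.cong refl) (simp only: mult_ac)
  moreover have "polyfun r (d + d') (\<lambda>x. \<Sum>\<alpha>\<in>Poly_Mapping.keys f. \<Sum>\<beta>\<in>Poly_Mapping.keys f'.
      (Poly_Mapping.lookup f \<alpha> * Poly_Mapping.lookup f' \<beta>) *
      (\<Prod>i\<in>Poly_Mapping.keys (\<alpha> + \<beta>). x i ^ Poly_Mapping.lookup (\<alpha> + \<beta>) i))"
  proof (intro polyfun_sum polyfun_monomial)
    fix \<alpha> \<beta> assume "\<alpha> \<in> Poly_Mapping.keys f" "\<beta> \<in> Poly_Mapping.keys f'"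
    then show "Poly_Mapping.keys (\<alpha> + \<beta>) \<subseteq> {..<r}"
      "(\<Sum>i\<in>Poly_Mapping.keys (\<alpha> + \<beta>). Poly_Mapping.lookup (\<alpha> + \<beta>) i) \<le> d + d'"
      using f(1) f'(1) keys_add[of \<alpha> \<beta>] unfolding poly_vars_deg_le_def degree_add
      by (blast, meson add_mono)
  qed
  ultimately show ?thesis by simp
qed

lemma polyfun_cmult: "polyfun r d F \<Longrightarrow> polyfun r d (\<lambda>x. c * F x)"
  using polyfun_mult[OF polyfun_const[of r 0]] by simp

lemma polyfun_prod:
  "(\<And>a. a \<in> A \<Longrightarrow> polyfun r (e a) (F a)) \<Longrightarrow> polyfun r (\<Sum>a\<in>A. e a) (\<lambda>x. \<Prod>a\<in>A. F a x)"
  by (induction A rule: infinite_finite_induct) (auto intro: polyfun_const polyfun_mult)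

text \<open>Up to the constant \<open>1 / k!\<close> this is a product of \<open>k\<close> linear
  polynomials in \<open>x i\<close>.\<close>

lemma polyfun_gbinomial:
  assumes "i < r"
  shows "polyfun r k (\<lambda>x. (x i - c) gchoose k)"
proof -
  have "polyfun r 1 (\<lambda>x. x i + (- c - of_nat l))" for l
    by (intro polyfun_add polyfun_var polyfun_const assms)
  from polyfun_cmult[OF polyfun_prod[of "{0..<k}" r "\<lambda>_. 1", OF this], of "inverse (fact k)"]
  show ?thesis
    by (simp add: gbinomial_prod_rev field_simps)
qed

text \<open>Positivity is demanded apart from \<open>N\<close>, so that counts which agree for
  genuine subdivisions can be exchanged by \<open>eventually_poly_cong\<close>. Coordinates from
  \<open>r\<close> on are unrestricted.\<close>

definition eventually_poly :: "nat \<Rightarrow> nat \<Rightarrow> ((nat \<Rightarrow> nat) \<Rightarrow> rat) \<Rightarrow> bool" where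
  "eventually_poly r d c \<longleftrightarrow> (\<exists>F. polyfun r d F \<and>
     (\<exists>N. \<forall>m. (\<forall>i<r. 0 < m i \<and> N \<le> m i) \<longrightarrow> c m = F (\<lambda>i. of_nat (m i))))"

lemma eventually_polyI:
  assumes "polyfun r d F"
    and "\<And>m. (\<And>i. i < r \<Longrightarrow> 0 < m i) \<Longrightarrow> (\<And>i. i < r \<Longrightarrow> N \<le> m i) \<Longrightarrow> c m = F (\<lambda>i. of_nat (m i))"
  shows "eventually_poly r d c"
  using assms unfolding eventually_poly_def by blast

lemma eventually_poly_cong:
  assumes "eventually_poly r d c" "\<And>m. (\<And>i. i < r \<Longrightarrow> 0 < m i) \<Longrightarrow> c m = c' m"
  shows "eventually_poly r d c'"
  using assms unfolding eventually_poly_def by metis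

lemma eventually_poly_mono: "eventually_poly r d c \<Longrightarrow> d \<le> d' \<Longrightarrow> eventually_poly r d' c"
  unfolding eventually_poly_def using polyfun_mono by blast

lemma eventually_poly_const: "eventually_poly r d (\<lambda>m. c)"
  by (rule eventually_polyI[OF polyfun_const]) simp

lemma eventually_poly_add:
  assumes "eventually_poly r d c" "eventually_poly r d c'"
  shows "eventually_poly r d (\<lambda>m. c m + c' m)"
proof -
  obtain F N where F: "polyfun r d F"
    "\<And>m. (\<forall>i<r. 0 < m i \<and> N \<le> m i) \<Longrightarrow> c m = F (\<lambda>i. of_nat (m i))"
    using assms(1) unfolding eventually_poly_def by blast
  obtain F' N' where F': "polyfun r d F'"
    "\<And>m. (\<forall>i<r. 0 < m i \<and> N' \<le> m i) \<Longrightarrow> c' m = F' (\<lambda>i. of_nat (m i))"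
    using assms(2) unfolding eventually_poly_def by blast
  show ?thesis
    by (rule eventually_polyI[OF polyfun_add[OF F(1) F'(1)], of "max N N'"])
      (simp add: F(2) F'(2))
qed

lemma eventually_poly_cmult:
  assumes "eventually_poly r d c"
  shows "eventually_poly r d (\<lambda>m. q * c m)"
proof -
  obtain F N where F: "polyfun r d F"
    "\<And>m. (\<forall>i<r. 0 < m i \<and> N \<le> m i) \<Longrightarrow> c m = F (\<lambda>i. of_nat (m i))"
    using assms(1) unfolding eventually_poly_def by blast
  show ?thesis
    by (rule eventually_polyI[OF polyfun_cmult[OF F(1), of q], of N]) (simp add: F(2))
qed

lemma eventually_poly_diff:
  "eventually_poly r d c \<Longrightarrow> eventually_poly r d c' \<Longrightarrow> eventually_poly r d (\<lambda>m. c m - c' m)"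
  using eventually_poly_add[OF _ eventually_poly_cmult[of r d c' "-1"], of c] by simp

lemma eventually_poly_sum:
  "(\<And>a. a \<in> A \<Longrightarrow> eventually_poly r d (c a)) \<Longrightarrow> eventually_poly r d (\<lambda>m. \<Sum>a\<in>A. c a m)"
  by (induction A rule: infinite_finite_induct) (auto intro: eventually_poly_const eventually_poly_add)

section \<open>Dickson's lemma\<close>

text \<open>Every sequence has a monotone subsequence, and a decreasing one in \<open>nat\<close> is
  constant from the place where it attains its minimum.\<close>

lemma nat_seq_incseq_subseq:
  fixes s :: "nat \<Rightarrow> nat"
  obtains f where "strict_mono f" "incseq (s \<circ> f)"
proof -
  obtain f where f: "strict_mono f" "monoseq (\<lambda>n. s (f n))"
    using seq_monosub by blast
  then consider "incseq (s \<circ> f)" | "decseq (\<lambda>n. s (f n))"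
    unfolding monoseq_iff by (auto simp: comp_def)
  then show thesis
  proof cases
    case 1
    with f that show ?thesis by blast
  next
    case 2
    define v where "v = (LEAST v. v \<in> range (\<lambda>n. s (f n)))"
    have "v \<in> range (\<lambda>n. s (f n))" unfolding v_def by (rule LeastI) blast
    then obtain N where N: "v = s (f N)" by blast
    have "s (f (n + N)) = v" for n
    proof (rule antisym)
      show "s (f (n + N)) \<le> v" using 2 N unfolding decseq_def by simp
      show "v \<le> s (f (n + N))" unfolding v_def by (rule Least_le) blast
    qed
    then show ?thesis
      using that[of "\<lambda>n. f (n + N)"] f(1) by (auto simp: comp_def strict_mono_def incseq_def)
  qed
qed

lemma incseq_subseq_on_finite:
  fixes a :: "nat \<Rightarrow> 'x \<Rightarrow> nat"
  assumes "finite X"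
  shows "\<exists>f. strict_mono f \<and> (\<forall>x\<in>X. incseq (\<lambda>n. a (f n) x))"
  using assms
proof (induction X)
  case empty
  show ?case by (auto intro: exI[of _ id] simp: strict_mono_def)
next
  case (insert x X)
  then obtain f where f: "strict_mono f" "\<And>y. y \<in> X \<Longrightarrow> incseq (\<lambda>n. a (f n) y)" by blast
  obtain h where h: "strict_mono h" "incseq ((\<lambda>n. a (f n) x) \<circ> h)"
    using nat_seq_incseq_subseq by blast
  have "strict_mono (f \<circ> h)" using f(1) h(1) by (simp add: strict_mono_o)
  moreover have "incseq (\<lambda>n. a ((f \<circ> h) n) y)" if "y \<in> insert x X" for y
    using that f(2)[of y] h strict_mono_mono[OF h(1)] unfolding incseq_def mono_def by auto
  ultimately show ?case by blast
qed

text \<open>Infinitely many minimal elements would form an injective sequence; a subsequence that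
  increases in every coordinate of \<open>X\<close> then contains two distinct comparable minimal
  elements.\<close>

lemma finite_minimal_elements:
  fixes U :: "('x \<Rightarrow> nat) set"
  assumes "finite X" and supp: "U \<subseteq> {u. \<forall>x. x \<notin> X \<longrightarrow> u x = 0}"
  shows "finite {u \<in> U. \<forall>v\<in>U. v \<le> u \<longrightarrow> v = u}" (is "finite ?Min")
proof (rule ccontr)
  assume "infinite ?Min"
  then obtain a :: "nat \<Rightarrow> 'x \<Rightarrow> nat" where a: "inj a" "range a \<subseteq> ?Min"
    using infinite_countable_subset by blast
  obtain f where f: "strict_mono f" "\<forall>x\<in>X. incseq (\<lambda>n. a (f n) x)"
    using incseq_subseq_on_finite[OF assms(1)] by blast
  have "a (f 0) \<le> a (f 1)"
  proof (rule le_funI)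
    fix x show "a (f 0) x \<le> a (f 1) x"
    proof (cases "x \<in> X")
      case True
      then show ?thesis using f(2) by (simp add: incseq_def)
    next
      case False
      moreover have "a (f 0) \<in> U" using a(2) by blast
      ultimately have "a (f 0) x = 0" using supp by blast
      then show ?thesis by simp
    qed
  qed
  moreover have "a (f 0) \<in> U" "a (f 1) \<in> ?Min" using a(2) by blast+
  ultimately have "a (f 0) = a (f 1)" by blast
  with a(1) have "f 0 = f 1" by (simp add: inj_eq)
  with f(1) show False by (simp add: strict_mono_eq)
qed

text \<open>Every strict descent lowers the sum of the coordinates in \<open>X\<close>.\<close>

lemma minimal_element_below:
  fixes U :: "('x \<Rightarrow> nat) set"
  assumes "finite X" and "U \<subseteq> {u. \<forall>x. x \<notin> X \<longrightarrow> u x = 0}" and "u \<in> U"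
  obtains v where "v \<in> U" "v \<le> u" "\<forall>w\<in>U. w \<le> v \<longrightarrow> w = v"
  using \<open>u \<in> U\<close>
proof (induction "\<Sum>x\<in>X. u x" arbitrary: u thesis rule: less_induct)
  case less
  show ?case
  proof (cases "\<forall>w\<in>U. w \<le> u \<longrightarrow> w = u")
    case True
    with less.prems show ?thesis by blast
  next
    case False
    then obtain w where w: "w \<in> U" "w \<le> u" "w \<noteq> u" by blast
    then obtain x where x: "w x \<noteq> u x" by blast
    then have "w x < u x" using w(2) by (metis le_fun_def order_le_imp_less_or_eq)
    moreover have "x \<in> X"
    proof (rule ccontr)
      assume "x \<notin> X"
      then have "w x = 0" "u x = 0" using w(1) less.prems(2) assms(2) by blast+
      with x show False by simp
    qed
    ultimately have "sum w X < sum u X"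
      using w(2) assms(1) by (intro sum_strict_mono_ex1) (auto simp: le_fun_def)
    then show ?thesis
      using less.hyps[OF _ _ w(1)] less.prems(1) w(2) order_trans by metis
  qed
qed

section \<open>Subsets of intervals as gap vectors\<close>

text \<open>For a subset of \<open>{..<m i}\<close> with \<open>k i\<close> elements, \<open>a (i, l)\<close> is the number of non-elements
  between the elements with indices \<open>l - 1\<close> and \<open>l\<close>, where \<open>l = 0, \<dots>, k i\<close>; \<open>gap_pos a i l\<close> is the
  position of the element with index \<open>l\<close>.\<close>

definition gap_len :: "(nat \<Rightarrow> nat) \<Rightarrow> (nat \<times> nat \<Rightarrow> nat) \<Rightarrow> nat \<Rightarrow> nat" where
  "gap_len k a i = (\<Sum>l\<le>k i. a (i, l)) + k i"

definition gap_pos :: "(nat \<times> nat \<Rightarrow> nat) \<Rightarrow> nat \<Rightarrow> nat \<Rightarrow> nat" where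
  "gap_pos a i l = (\<Sum>l'\<le>l. a (i, l')) + l"

definition gap_set :: "nat \<Rightarrow> (nat \<Rightarrow> nat) \<Rightarrow> (nat \<times> nat \<Rightarrow> nat) \<Rightarrow> (nat \<times> nat) set" where
  "gap_set r k a = {(i, gap_pos a i l) |i l. i < r \<and> l < k i}"

definition gap_vectors :: "nat \<Rightarrow> (nat \<Rightarrow> nat) \<Rightarrow> (nat \<times> nat \<Rightarrow> nat) set" where
  "gap_vectors r k = {a. \<forall>x. x \<notin> (SIGMA i:{..<r}. {..k i}) \<longrightarrow> a x = 0}"

text \<open>The effect on edge positions of inserting a new edge at position \<open>p\<close> of
  path \<open>i\<close>: the image leaves out exactly \<open>(i, p)\<close>.\<close>

definition shift :: "nat \<Rightarrow> nat \<Rightarrow> nat \<times> nat \<Rightarrow> nat \<times> nat" where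
  "shift i p = (\<lambda>(i', j). (i', if i' = i \<and> p \<le> j then Suc j else j))"

text \<open>The end of the interval behaves like one more element, with index
  \<open>k i\<close>.\<close>

lemma gap_len_eq_gap_pos: "gap_len k a i = gap_pos a i (k i)"
  by (simp add: gap_len_def gap_pos_def)

lemma gap_pos_Suc: "gap_pos a i (Suc l) = Suc (gap_pos a i l + a (i, Suc l))"
  by (simp add: gap_pos_def)

lemma gap_pos_strict_mono: "l < l' \<Longrightarrow> gap_pos a i l < gap_pos a i l'"
  by (induction l') (auto simp: gap_pos_Suc less_Suc_eq)

lemma gap_pos_mono: "l \<le> l' \<Longrightarrow> gap_pos a i l \<le> gap_pos a i l'"
  using gap_pos_strict_mono by (metis le_less)

lemma gap_pos_less_iff: "gap_pos a i l < gap_pos a i l' \<longleftrightarrow> l < l'"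
  using gap_pos_strict_mono gap_pos_mono by (meson linorder_not_le)

text \<open>The set determines the positions of its elements and so all gaps except the last one,
  which is read off from the length.\<close>

lemma gap_vector_eqI:
  assumes a: "a \<in> gap_vectors r k" "a' \<in> gap_vectors r k"
    and "gap_set r k a = gap_set r k a'" "\<And>i. i < r \<Longrightarrow> gap_len k a i = gap_len k a' i"
  shows "a = a'"
proof
  fix x :: "nat \<times> nat"
  obtain i l where x: "x = (i, l)" by (cases x)
  show "a x = a' x"
  proof (cases "i < r \<and> l \<le> k i")
    case False
    then show ?thesis using a x by (auto simp: gap_vectors_def)
  next
    case True
    then have i: "i < r" by simp
    let ?S = "{j. (i, j) \<in> gap_set r k a}"
    \<comment> \<open>Counting the smaller elements recovers the index of a position, so the same
      position has the same index for \<open>a\<close> and \<open>a'\<close>.\<close>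
    have rank: "card {j \<in> {j. (i, j) \<in> gap_set r k b}. j < gap_pos b i l} = l" if "l < k i" for b l
    proof -
      have "{j \<in> {j. (i, j) \<in> gap_set r k b}. j < gap_pos b i l} = gap_pos b i ` {..<l}"
        using that i by (auto simp: gap_set_def gap_pos_less_iff)
      moreover have "inj_on (gap_pos b i) {..<l}"
        by (rule inj_onI, rule ccontr) (auto simp: neq_iff dest: gap_pos_strict_mono[of _ _ b i])
      ultimately show ?thesis by (simp add: card_image)
    qed
    have pos: "gap_pos a i l = gap_pos a' i l" if "l \<le> k i" for l
    proof (cases "l = k i")
      case True
      then show ?thesis using assms(4)[OF i] by (simp add: gap_len_eq_gap_pos)
    next
      case False
      with that have l: "l < k i" by simp
      then have "(i, gap_pos a i l) \<in> gap_set r k a" using i by (auto simp: gap_set_def)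
      then have "(i, gap_pos a i l) \<in> gap_set r k a'" using assms(3) by simp
      then obtain l' where l': "l' < k i" "gap_pos a i l = gap_pos a' i l'"
        by (auto simp: gap_set_def)
      have "l = l'" using rank[OF l, of a] rank[OF l'(1), of a'] l'(2) assms(3) by simp
      with l' show ?thesis by simp
    qed
    show ?thesis
    proof (cases l)
      case 0
      then show ?thesis using pos[of 0] x by (simp add: gap_pos_def)
    next
      case (Suc n)
      then show ?thesis using pos[of n] pos[of l] x True by (simp add: gap_pos_Suc)
    qed
  qed
qed

lemma gap_vector_exists:
  assumes J: "J \<subseteq> {(i, j). i < r \<and> j < m i}" and card: "\<And>i. i < r \<Longrightarrow> card {j. (i, j) \<in> J} = k i"
  obtains a where "a \<in> gap_vectors r k" "gap_set r k a = J" "\<And>i. i < r \<Longrightarrow> gap_len k a i = m i"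
proof -
  define L where "L i = sorted_list_of_set {j. (i, j) \<in> J}" for i
  \<comment> \<open>The value \<open>m i\<close> is a sentinel behind the last element, so the last
    gap needs no formula of its own; only the first gap has no preceding element to
    subtract.\<close>
  define s where "s i l = (if l < k i then L i ! l else m i)" for i l
  define a where "a = (\<lambda>(i, l). if i < r \<and> l \<le> k i
      then s i l - (if l = 0 then 0 else Suc (s i (l - 1))) else 0)"
  have fin: "finite {j. (i, j) \<in> J}" for i
    by (rule finite_subset[of _ "{..<m i}"]) (use J in auto)
  have L: "length (L i) = k i" "set (L i) = {j. (i, j) \<in> J}" "sorted_wrt (<) (L i)" if "i < r" for i
    using that card[OF that] fin[of i] unfolding L_def by auto
  have s_Suc: "s i l < s i (Suc l)" if "i < r" "Suc l \<le> k i" for i l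
  proof (cases "Suc l < k i")
    case True
    then show ?thesis using sorted_wrt_nth_less[OF L(3)[OF that(1)], of l "Suc l"] L(1)[OF that(1)]
      by (simp add: s_def)
  next
    case False
    have "L i ! l \<in> {j. (i, j) \<in> J}"
      using L(1,2)[OF that(1)] that by (metis Suc_le_eq nth_mem)
    then show ?thesis using J that False by (auto simp: s_def)
  qed
  have pos: "gap_pos a i l = s i l" if "i < r" "l \<le> k i" for i l
    using that(2)
  proof (induction l)
    case 0
    then show ?case using that by (simp add: gap_pos_def a_def)
  next
    case (Suc l)
    then have "a (i, Suc l) = s i (Suc l) - Suc (s i l)" using that by (simp add: a_def)
    then show ?case using Suc s_Suc[OF that(1) Suc.prems] by (simp add: gap_pos_Suc)
  qed
  have "gap_set r k a = J"
  proof (intro equalityI subsetI)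
    fix x assume "x \<in> gap_set r k a"
    then obtain i l where il: "i < r" "l < k i" "x = (i, gap_pos a i l)"
      unfolding gap_set_def by blast
    then have "x = (i, L i ! l)" by (simp add: pos s_def)
    moreover have "L i ! l \<in> set (L i)" using il L(1) by (metis nth_mem)
    ultimately show "x \<in> J" using L(2)[OF il(1)] by simp
  next
    fix x assume "x \<in> J"
    then obtain i j where x: "x = (i, j)" "i < r" "(i, j) \<in> J" using J by auto
    then obtain l where "l < k i" "L i ! l = j"
      using L(1,2)[OF x(2)] by (metis in_set_conv_nth mem_Collect_eq)
    then show "x \<in> gap_set r k a"
      using x pos[of i l] unfolding gap_set_def s_def by force
  qed
  moreover have "a \<in> gap_vectors r k" by (auto simp: gap_vectors_def a_def)
  moreover have "gap_len k a i = m i" if "i < r" for i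
    using pos[OF that, of "k i"] by (simp add: gap_len_eq_gap_pos s_def)
  ultimately show thesis using that by blast
qed

lemma gap_pos_increment:
  "gap_pos (a((i, l) := Suc (a (i, l)))) i' l' = gap_pos a i' l' + (if i' = i \<and> l \<le> l' then 1 else 0)"
proof (induction l')
  case 0
  show ?case unfolding gap_pos_def atMost_0 by simp
next
  case (Suc l')
  then show ?case by (auto simp: gap_pos_Suc)
qed

lemma gap_len_increment:
  assumes "l \<le> k i"
  shows "gap_len k (a((i, l) := Suc (a (i, l)))) = (gap_len k a)(i := Suc (gap_len k a i))"
  using assms by (auto simp: fun_eq_iff gap_len_eq_gap_pos gap_pos_increment)

text \<open>The additional non-element is put directly before the element with index
  \<open>l\<close> and takes over its position; for \<open>l = k i\<close> it is appended at the
  end.\<close>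

lemma gap_set_increment:
  assumes "i < r" "l \<le> k i"
  shows "gap_set r k (a((i, l) := Suc (a (i, l)))) = shift i (gap_pos a i l) ` gap_set r k a"
proof -
  have "gap_pos a i l \<le> gap_pos a i l' \<longleftrightarrow> l \<le> l'" for l'
    using gap_pos_less_iff by (meson linorder_not_le)
  then have "(i', gap_pos (a((i, l) := Suc (a (i, l)))) i' l') =
      shift i (gap_pos a i l) (i', gap_pos a i' l')" for i' l'
    by (auto simp: gap_pos_increment shift_def)
  then show ?thesis unfolding gap_set_def by force
qed

section \<open>Counting upward closed sets of gap vectors\<close>

text \<open>The orthant translated to \<open>h\<close>, cut down to the gap vectors with prescribed
  lengths.\<close>

definition gap_cone ::
  "nat \<Rightarrow> (nat \<Rightarrow> nat) \<Rightarrow> (nat \<times> nat \<Rightarrow> nat) \<Rightarrow> (nat \<Rightarrow> nat) \<Rightarrow> (nat \<times> nat \<Rightarrow> nat) set" where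
  "gap_cone r k h m = {a \<in> gap_vectors r k. h \<le> a \<and> (\<forall>i<r. gap_len k a i = m i)}"

text \<open>After subtraction of \<open>h\<close>, what remains for each \<open>i\<close> is an
  arbitrary way to write the excess length as an ordered sum of \<open>k i + 1\<close> natural
  numbers.\<close>

lemma gap_cone_bij:
  assumes h: "h \<in> gap_vectors r k" and m: "\<And>i. i < r \<Longrightarrow> gap_len k h i \<le> m i"
  shows "bij_betw (\<lambda>a. \<lambda>i\<in>{..<r}. map (\<lambda>l. a (i, l) - h (i, l)) [0..<Suc (k i)])
    (gap_cone r k h m)
    (\<Pi>\<^sub>E i\<in>{..<r}. {xs. length xs = Suc (k i) \<and> sum_list xs = m i - gap_len k h i})"
    (is "bij_betw ?f ?A ?B")
proof (rule bij_betw_byWitness[where f' = "\<lambda>xs (i, l). if i < r \<and> l \<le> k i then h (i, l) + xs i ! l else 0"])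
  have nth: "map f [0..<Suc n] ! l = f l" if "l \<le> n" for f :: "nat \<Rightarrow> nat" and n l
    using that by (simp del: upt_Suc)
  show "\<forall>a\<in>?A. (\<lambda>(i, l). if i < r \<and> l \<le> k i then h (i, l) + ?f a i ! l else 0) = a"
  proof
    fix a assume a: "a \<in> ?A"
    then have le: "h (i, l) \<le> a (i, l)" for i l by (simp add: gap_cone_def le_fun_def)
    show "(\<lambda>(i, l). if i < r \<and> l \<le> k i then h (i, l) + ?f a i ! l else 0) = a"
      using a le by (auto simp: fun_eq_iff nth gap_cone_def gap_vectors_def simp del: upt_Suc)
  qed
  show "\<forall>xs\<in>?B. ?f (\<lambda>(i, l). if i < r \<and> l \<le> k i then h (i, l) + xs i ! l else 0) = xs"
  proof
    fix xs assume xs: "xs \<in> ?B"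
    show "?f (\<lambda>(i, l). if i < r \<and> l \<le> k i then h (i, l) + xs i ! l else 0) = xs"
    proof
      fix i
      show "?f (\<lambda>(i, l). if i < r \<and> l \<le> k i then h (i, l) + xs i ! l else 0) i = xs i"
      proof (cases "i < r")
        case True
        then have "length (xs i) = Suc (k i)" using xs by (auto simp: PiE_def Pi_def)
        with True show ?thesis by (auto intro!: nth_equalityI simp del: upt_Suc)
      next
        case False
        then show ?thesis using xs by (auto simp: PiE_def extensional_def)
      qed
    qed
  qed
  show "?f ` ?A \<subseteq> ?B"
  proof
    fix y assume "y \<in> ?f ` ?A"
    then obtain a where a: "a \<in> ?A" "y = ?f a" by blast
    have "sum_list (map (\<lambda>l. a (i, l) - h (i, l)) [0..<Suc (k i)]) = m i - gap_len k h i" if "i < r" for i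
    proof -
      have le: "h (i, l) \<le> a (i, l)" for l using a by (simp add: gap_cone_def le_fun_def)
      have "sum_list (map (\<lambda>l. a (i, l) - h (i, l)) [0..<Suc (k i)]) = (\<Sum>l\<le>k i. a (i, l) - h (i, l))"
        by (subst interv_sum_list_conv_sum_set_nat) (simp add: atLeastLessThanSuc_atLeastAtMost atLeast0AtMost del: upt_Suc sum.op_ivl_Suc)
      also have "\<dots> = (\<Sum>l\<le>k i. a (i, l)) - (\<Sum>l\<le>k i. h (i, l))"
        by (rule sum_subtractf_nat) (use le in auto)
      also have "\<dots> = gap_len k a i - gap_len k h i" by (simp add: gap_len_def)
      finally show ?thesis using a that by (simp add: gap_cone_def)
    qed
    then show "y \<in> ?B" using a(2) by (auto simp del: upt_Suc)
  qed
  show "(\<lambda>xs (i, l). if i < r \<and> l \<le> k i then h (i, l) + xs i ! l else 0) ` ?B \<subseteq> ?A"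
  proof
    fix a assume "a \<in> (\<lambda>xs (i, l). if i < r \<and> l \<le> k i then h (i, l) + xs i ! l else 0) ` ?B"
    then obtain xs where xs: "xs \<in> ?B"
      and a: "a = (\<lambda>(i, l). if i < r \<and> l \<le> k i then h (i, l) + xs i ! l else 0)" by blast
    have "gap_len k a i = m i" if i: "i < r" for i
    proof -
      have l: "length (xs i) = Suc (k i)" "sum_list (xs i) = m i - gap_len k h i"
        using xs i by (auto simp: PiE_def Pi_def)
      have "gap_len k a i = (\<Sum>l\<le>k i. h (i, l)) + (\<Sum>l\<le>k i. xs i ! l) + k i"
        using i by (simp add: gap_len_def a sum.distrib)
      also have "(\<Sum>l\<le>k i. xs i ! l) = sum_list (xs i)"
        by (simp add: sum_list_sum_nth l(1) atLeast0LessThan lessThan_Suc_atMost)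
      finally show ?thesis using l(2) m[OF i] by (simp add: gap_len_def)
    qed
    moreover have "h \<le> a"
      using h by (auto simp: le_fun_def a gap_vectors_def)
    moreover have "a \<in> gap_vectors r k" by (auto simp: a gap_vectors_def)
    ultimately show "a \<in> ?A" by (simp add: gap_cone_def)
  qed
qed

text \<open>Stars and bars. The subtracted number is the sum of the gaps of \<open>h\<close>,
  independent of \<open>m\<close>, so each factor is visibly polynomial of degree \<open>k i\<close>
  in \<open>m i\<close>.\<close>

lemma card_gap_cone:
  assumes "h \<in> gap_vectors r k" "\<And>i. i < r \<Longrightarrow> gap_len k h i \<le> m i"
  shows "card (gap_cone r k h m) = (\<Prod>i<r. (m i - (gap_len k h i - k i)) choose k i)"
proof -
  have "(m i - gap_len k h i) + Suc (k i) - 1 choose (m i - gap_len k h i) =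
      (m i - (gap_len k h i - k i)) choose k i" if "i < r" for i
  proof -
    have "m i - (gap_len k h i - k i) = (m i - gap_len k h i) + k i"
      using assms(2)[OF that] by (simp add: gap_len_def)
    then show ?thesis
      using binomial_symmetric[of "k i" "(m i - gap_len k h i) + k i"] by simp
  qed
  then show ?thesis
    using bij_betw_same_card[OF gap_cone_bij[OF assms]]
    by (simp add: card_PiE card_length_sum_list)
qed

lemma finite_gap_cone: "finite (gap_cone r k h m)"
proof (rule finite_subset)
  let ?X = "SIGMA i:{..<r}. {..k i}"
  let ?b = "\<Sum>i<r. m i"
  show "gap_cone r k h m \<subseteq> {a. \<forall>x. (x \<in> ?X \<longrightarrow> a x \<in> {..?b}) \<and> (x \<notin> ?X \<longrightarrow> a x = 0)}"
  proof (intro subsetI CollectI allI conjI impI)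
    fix a x assume a: "a \<in> gap_cone r k h m" and x: "x \<in> ?X"
    obtain i l where il: "x = (i, l)" "i < r" "l \<le> k i" using x by auto
    have "a (i, l) \<le> (\<Sum>l\<le>k i. a (i, l))" using il by (intro member_le_sum) auto
    also have "\<dots> \<le> m i" using a il by (auto simp: gap_cone_def gap_len_def)
    also have "\<dots> \<le> ?b" using il by (intro member_le_sum) auto
    finally show "a x \<in> {..?b}" using il by simp
  next
    fix a x assume "a \<in> gap_cone r k h m" "x \<notin> ?X"
    then show "a x = 0" unfolding gap_cone_def gap_vectors_def by blast
  qed
  show "finite {a. \<forall>x. (x \<in> ?X \<longrightarrow> a x \<in> {..?b}) \<and> (x \<notin> ?X \<longrightarrow> a x = (0 :: nat))}"
    by (rule finite_set_of_finite_funs) auto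
qed

lemma eventually_poly_gap_cone:
  assumes "h \<in> gap_vectors r k"
  shows "eventually_poly r (\<Sum>i<r. k i) (\<lambda>m. of_nat (card (gap_cone r k h m)))"
\<comment> \<open>The sum dominates every \<open>gap_len k h i\<close> at once; above it
  \<open>card_gap_cone\<close> applies and no subtraction is truncated.\<close>
proof (rule eventually_polyI[where N = "\<Sum>i<r. gap_len k h i"])
  show "polyfun r (\<Sum>i<r. k i) (\<lambda>x. \<Prod>i<r. (x i - of_nat (gap_len k h i - k i)) gchoose k i)"
    by (rule polyfun_prod) (auto intro: polyfun_gbinomial)
  fix m assume m: "\<And>i. i < r \<Longrightarrow> (\<Sum>i<r. gap_len k h i) \<le> m i"
  have le: "gap_len k h i \<le> m i" if "i < r" for i
    using m[OF that] member_le_sum[of i "{..<r}" "gap_len k h"] that by simp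
  have "of_nat ((m i - (gap_len k h i - k i)) choose k i) =
      (of_nat (m i) - of_nat (gap_len k h i - k i) :: rat) gchoose k i" if "i < r" for i
    using le[OF that] by (simp add: binomial_gbinomial of_nat_diff)
  then show "of_nat (card (gap_cone r k h m)) =
      (\<Prod>i<r. (of_nat (m i) - of_nat (gap_len k h i - k i) :: rat) gchoose k i)"
    by (simp add: card_gap_cone[OF assms le])
qed

text \<open>Inclusion-exclusion with one cone split off. Two cones meet in the cone of the supremum
  of their vertices, so the correction term is a union of as many cones as are left; hence the
  induction on the length of an arbitrary list.\<close>

lemma eventually_poly_union_gap_cones:
  assumes "set hs \<subseteq> gap_vectors r k"
  shows "eventually_poly r (\<Sum>i<r. k i) (\<lambda>m. of_nat (card (\<Union>h\<in>set hs. gap_cone r k h m)))"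
  using assms
proof (induction "length hs" arbitrary: hs)
  case 0
  then show ?case by (simp add: eventually_poly_const)
next
  case (Suc n)
  then obtain h hs' where hs: "hs = h # hs'" "length hs' = n" by (metis length_Suc_conv)
  let ?d = "\<Sum>i<r. k i"
  have h: "h \<in> gap_vectors r k" "set hs' \<subseteq> gap_vectors r k" using Suc.prems hs by auto
  have cap: "gap_cone r k h m \<inter> (\<Union>u\<in>set hs'. gap_cone r k u m) =
      (\<Union>u\<in>set (map (sup h) hs'). gap_cone r k u m)" for m
    by (auto simp: gap_cone_def)
  have int_eq: "int (card (gap_cone r k h m \<union> (\<Union>u\<in>set hs'. gap_cone r k u m))) =
      int (card (gap_cone r k h m)) + int (card (\<Union>u\<in>set hs'. gap_cone r k u m)) -
      int (card (\<Union>u\<in>set (map (sup h) hs'). gap_cone r k u m))" for m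
    using card_Un_Int[OF finite_gap_cone[of r k h m], of "\<Union>u\<in>set hs'. gap_cone r k u m"]
    unfolding cap by (simp add: finite_gap_cone)
  have eq: "of_nat (card (\<Union>u\<in>set hs. gap_cone r k u m)) =
      (of_nat (card (gap_cone r k h m)) + of_nat (card (\<Union>u\<in>set hs'. gap_cone r k u m)) -
      of_nat (card (\<Union>u\<in>set (map (sup h) hs'). gap_cone r k u m)) :: rat)" for m
  proof -
    have "rat_of_int (int (card (gap_cone r k h m \<union> (\<Union>u\<in>set hs'. gap_cone r k u m)))) =
      rat_of_int (int (card (gap_cone r k h m)) + int (card (\<Union>u\<in>set hs'. gap_cone r k u m)) -
        int (card (\<Union>u\<in>set (map (sup h) hs'). gap_cone r k u m)))"
      by (simp only: int_eq)
    then show ?thesis unfolding hs(1) by simp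
  qed
  have "set (map (sup h) hs') \<subseteq> gap_vectors r k"
    using h by (auto simp: gap_vectors_def)
  then have "eventually_poly r ?d (\<lambda>m. of_nat (card (\<Union>u\<in>set (map (sup h) hs'). gap_cone r k u m)))"
    using Suc.hyps(1)[of "map (sup h) hs'"] hs(2) by (simp only: length_map)
  moreover have "eventually_poly r ?d (\<lambda>m. of_nat (card (\<Union>u\<in>set hs'. gap_cone r k u m)))"
    using Suc.hyps(1) hs(2) h(2) by simp
  ultimately show ?case
    unfolding eq
    by (intro eventually_poly_diff eventually_poly_add eventually_poly_gap_cone h(1))
qed

text \<open>A gap vector determines the lengths below \<open>r\<close>, so the whole family
  \<open>A\<close> becomes one set of gap vectors, and closure under \<open>shift\<close> says that
  it is upward closed. \<open>cong\<close> enters because the lengths read off from a gap vector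
  agree with \<open>m\<close> only below \<open>r\<close>.\<close>

theorem eventually_poly_shift_closed:
  fixes A :: "(nat \<Rightarrow> nat) \<Rightarrow> (nat \<times> nat) set set"
  assumes sub: "\<And>m J. J \<in> A m \<Longrightarrow> J \<subseteq> {(i, j). i < r \<and> j < m i}"
    and card: "\<And>m J i. J \<in> A m \<Longrightarrow> i < r \<Longrightarrow> card {j. (i, j) \<in> J} = k i"
    and shift: "\<And>m J i p. J \<in> A m \<Longrightarrow> (\<And>i. i < r \<Longrightarrow> 0 < m i) \<Longrightarrow> i < r \<Longrightarrow> p \<le> m i \<Longrightarrow>
      shift i p ` J \<in> A (m(i := Suc (m i)))"
    and cong: "\<And>m m'. (\<And>i. i < r \<Longrightarrow> 0 < m i) \<Longrightarrow> (\<And>i. i < r \<Longrightarrow> m i = m' i) \<Longrightarrow> A m \<subseteq> A m'"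
  shows "eventually_poly r (\<Sum>i<r. k i) (\<lambda>m. of_nat (card (A m)))"
proof -
  let ?X = "SIGMA i:{..<r}. {..k i}"
  \<comment> \<open>All lengths are collected in one set. Positivity is included because closure
    under \<open>shift\<close> is available only for positive lengths.\<close>
  define U where "U = {a \<in> gap_vectors r k. (\<forall>i<r. 0 < gap_len k a i) \<and> gap_set r k a \<in> A (gap_len k a)}"
  have supp: "U \<subseteq> {u. \<forall>x. x \<notin> ?X \<longrightarrow> u x = 0}"
    unfolding U_def gap_vectors_def by blast
  have fin_X: "finite ?X" by simp
  have step: "a((i, l) := Suc (a (i, l))) \<in> U" if "a \<in> U" "i < r" "l \<le> k i" for a i l
  proof -
    have "shift i (gap_pos a i l) ` gap_set r k a \<in> A ((gap_len k a)(i := Suc (gap_len k a i)))"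
      by (rule shift) (use that gap_pos_mono in \<open>auto simp: U_def gap_len_eq_gap_pos\<close>)
    then show ?thesis
      using that by (auto simp: U_def gap_set_increment gap_len_increment gap_vectors_def)
  qed
  \<comment> \<open>Induction on the number of unit increments that lead from \<open>a\<close> to
    \<open>b\<close>.\<close>
  have up: "b \<in> U" if "a \<in> U" "a \<le> b" "b \<in> gap_vectors r k" for a b
    using that
  proof (induction "\<Sum>x\<in>?X. b x - a x" arbitrary: a)
    case 0
    have "a x = b x" for x
    proof (cases "x \<in> ?X")
      case True
      have "b x - a x = 0" by (rule bspec[OF iffD1[OF sum_eq_0_iff[OF fin_X] 0(1)[symmetric]] True])
      then show ?thesis using le_funD[OF \<open>a \<le> b\<close>, of x] by simp
    next
      case False
      then have "b x = 0" using \<open>b \<in> gap_vectors r k\<close> unfolding gap_vectors_def by blast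
      moreover have "a x = 0" using supp \<open>a \<in> U\<close> False by blast
      ultimately show ?thesis by simp
    qed
    then show ?case using 0(2) by (metis ext)
  next
    case (Suc n)
    then have "\<exists>x\<in>?X. b x - a x \<noteq> 0" by (metis (no_types, lifting) nat.distinct(1) sum.neutral)
    then obtain i l where il: "i < r" "l \<le> k i" "a (i, l) < b (i, l)" by auto
    let ?a = "a((i, l) := Suc (a (i, l)))"
    have "(\<Sum>x\<in>?X. b x - a x) = (b (i, l) - a (i, l)) + (\<Sum>x\<in>?X - {(i, l)}. b x - a x)"
      by (rule sum.remove) (use il in auto)
    moreover have "(\<Sum>x\<in>?X. b x - ?a x) = (b (i, l) - ?a (i, l)) + (\<Sum>x\<in>?X - {(i, l)}. b x - ?a x)"
      by (rule sum.remove) (use il in auto)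
    moreover have "(\<Sum>x\<in>?X - {(i, l)}. b x - ?a x) = (\<Sum>x\<in>?X - {(i, l)}. b x - a x)"
      by (rule sum.cong) auto
    ultimately have "n = (\<Sum>x\<in>?X. b x - ?a x)" using Suc.hyps(2) il(3) by simp
    moreover have "?a \<le> b" using Suc.prems(2) il(3) by (auto simp: le_fun_def)
    ultimately show ?case using Suc.hyps(1) step[OF Suc.prems(1) il(1,2)] Suc.prems(3) by blast
  qed
  define Min where "Min = {u \<in> U. \<forall>v\<in>U. v \<le> u \<longrightarrow> v = u}"
  have "finite Min"
    unfolding Min_def by (rule finite_minimal_elements[OF fin_X supp])
  then obtain hs where hs: "set hs = Min" using finite_list by blast
  \<comment> \<open>Every element of \<open>U\<close> lies above one of the finitely many minimal
    elements, and everything above a minimal element is in \<open>U\<close>.\<close>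
  have slice: "{a \<in> U. \<forall>i<r. gap_len k a i = m i} = (\<Union>h\<in>set hs. gap_cone r k h m)" for m
  proof (intro equalityI subsetI)
    fix a assume a: "a \<in> {a \<in> U. \<forall>i<r. gap_len k a i = m i}"
    then have "a \<in> U" by blast
    obtain v where "v \<in> U" "v \<le> a" "\<forall>w\<in>U. w \<le> v \<longrightarrow> w = v"
      by (rule minimal_element_below[OF fin_X supp \<open>a \<in> U\<close>])
    then have "v \<in> Min" "v \<le> a" unfolding Min_def by blast+
    then show "a \<in> (\<Union>h\<in>set hs. gap_cone r k h m)"
      using a unfolding hs by (auto simp: gap_cone_def U_def)
  next
    fix a assume "a \<in> (\<Union>h\<in>set hs. gap_cone r k h m)"
    then show "a \<in> {a \<in> U. \<forall>i<r. gap_len k a i = m i}"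
      unfolding hs by (auto simp: gap_cone_def Min_def intro: up)
  qed
  have bij: "bij_betw (gap_set r k) {a \<in> U. \<forall>i<r. gap_len k a i = m i} (A m)"
    if m: "\<And>i. i < r \<Longrightarrow> 0 < m i" for m
  proof (rule bij_betw_imageI)
    show "inj_on (gap_set r k) {a \<in> U. \<forall>i<r. gap_len k a i = m i}"
      by (rule inj_onI, rule gap_vector_eqI) (auto simp: U_def)
    show "gap_set r k ` {a \<in> U. \<forall>i<r. gap_len k a i = m i} = A m"
    proof (intro equalityI subsetI)
      fix J assume "J \<in> gap_set r k ` {a \<in> U. \<forall>i<r. gap_len k a i = m i}"
      then obtain a where a: "a \<in> U" "\<forall>i<r. gap_len k a i = m i" "J = gap_set r k a" by blast
      have "A (gap_len k a) \<subseteq> A m" by (rule cong) (use a m in \<open>auto simp: U_def\<close>)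
      then show "J \<in> A m" using a by (auto simp: U_def)
    next
      fix J assume J: "J \<in> A m"
      obtain a where a: "a \<in> gap_vectors r k" "gap_set r k a = J" "\<And>i. i < r \<Longrightarrow> gap_len k a i = m i"
        using gap_vector_exists[OF sub[OF J] card[OF J]] by blast
      have "A m \<subseteq> A (gap_len k a)" by (rule cong) (use a m in auto)
      then show "J \<in> gap_set r k ` {a \<in> U. \<forall>i<r. gap_len k a i = m i}"
        using a J m by (auto simp: U_def)
    qed
  qed
  have card_eq: "card (\<Union>h\<in>set hs. gap_cone r k h m) = card (A m)"
    if "\<And>i. i < r \<Longrightarrow> 0 < m i" for m
  proof -
    have "bij_betw (gap_set r k) {a \<in> U. \<forall>i<r. gap_len k a i = m i} (A m)" by (rule bij) (rule that)
    from bij_betw_same_card[OF this] show ?thesis by (simp only: slice)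
  qed
  have "set hs \<subseteq> gap_vectors r k" by (auto simp: hs Min_def U_def)
  from eventually_poly_union_gap_cones[OF this] show ?thesis
    by (rule eventually_poly_cong) (simp only: card_eq)
qed

section \<open>Dimension counts in vector spaces\<close>

abbreviation submod :: "('a, 'r) ring_scheme \<Rightarrow> 'v set \<Rightarrow> ('a, 'v, 'e) module_scheme \<Rightarrow> bool" where
  "submod \<equiv> LinearCombinations.submodule"

lemmas submod_add = LinearCombinations.submodule.m_closed
  and submod_zero = LinearCombinations.submodule.zero_closed
  and submod_smult = LinearCombinations.submodule.smult_closed
  and submod_subset = LinearCombinations.submodule.subset

text \<open>Subspaces are measured inside \<open>V\<close> itself, so that a basis can be extended
  along a chain of subspaces without changing the carrier.\<close>

definition (in vectorspace) has_dim :: "'c set \<Rightarrow> nat \<Rightarrow> bool" where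
  "has_dim U n \<longleftrightarrow> (\<exists>A. finite A \<and> A \<subseteq> carrier V \<and> lin_indpt A \<and> span A = U \<and> card A = n)"

context Module.module
begin

lemma submodule_neg_closed:
  assumes "submod R U M" "u \<in> U"
  shows "\<ominus>\<^bsub>M\<^esub> u \<in> U"
  using assms submod_smult[OF assms(1), of "\<ominus>\<^bsub>R\<^esub> \<one>\<^bsub>R\<^esub>" u]
    submod_subset[OF assms(1)] by (auto simp: smult_minus_1)

lemma submodule_minus_closed:
  assumes "submod R U M" "u \<in> U" "w \<in> U"
  shows "u \<ominus>\<^bsub>M\<^esub> w \<in> U"
  using submod_add[OF assms(1,2) submodule_neg_closed[OF assms(1,3)]]
  by (simp add: a_minus_def)

lemma span_empty_eq: "span {} = {\<zero>\<^bsub>M\<^esub>}"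
  unfolding span_def lincomb_def by auto

text \<open>The vectors of the desired form already make up a submodule that contains the
  generators.\<close>

lemma span_insertD:
  assumes A: "A \<subseteq> carrier M" "w \<in> carrier M" and u: "u \<in> span (insert w A)"
  obtains s c where "s \<in> span A" "c \<in> carrier R" "u = s \<oplus>\<^bsub>M\<^esub> c \<odot>\<^bsub>M\<^esub> w"
proof -
  let ?U = "{s \<oplus>\<^bsub>M\<^esub> c \<odot>\<^bsub>M\<^esub> w |s c. s \<in> span A \<and> c \<in> carrier R}"
  note sub = span_is_submodule[OF A(1)]
  note car = submod_subset[OF sub, THEN subsetD]
  have "submod R ?U M"
  proof
    show "?U \<subseteq> carrier M" using car A by auto
    show "\<zero>\<^bsub>M\<^esub> \<in> ?U"
      using submod_zero[OF sub] A(2)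
      by (auto intro!: exI[of _ "\<zero>\<^bsub>M\<^esub>"] exI[of _ "\<zero>\<^bsub>R\<^esub>"])
  next
    fix a b assume "a \<in> ?U" "b \<in> ?U"
    then obtain s c s' c' where *: "s \<in> span A" "c \<in> carrier R" "a = s \<oplus>\<^bsub>M\<^esub> c \<odot>\<^bsub>M\<^esub> w"
      "s' \<in> span A" "c' \<in> carrier R" "b = s' \<oplus>\<^bsub>M\<^esub> c' \<odot>\<^bsub>M\<^esub> w" by blast
    have "a \<oplus>\<^bsub>M\<^esub> b = (s \<oplus>\<^bsub>M\<^esub> s') \<oplus>\<^bsub>M\<^esub> (c \<oplus>\<^bsub>R\<^esub> c') \<odot>\<^bsub>M\<^esub> w"
      using * car A(2) by (simp add: smult_l_distr M.a_ac)
    moreover have "s \<oplus>\<^bsub>M\<^esub> s' \<in> span A" "c \<oplus>\<^bsub>R\<^esub> c' \<in> carrier R"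
      using * submod_add[OF sub] by auto
    ultimately show "a \<oplus>\<^bsub>M\<^esub> b \<in> ?U" by blast
  next
    fix k a assume "k \<in> carrier R" "a \<in> ?U"
    then obtain s c where *: "s \<in> span A" "c \<in> carrier R" "a = s \<oplus>\<^bsub>M\<^esub> c \<odot>\<^bsub>M\<^esub> w" "k \<in> carrier R"
      by blast
    have "k \<odot>\<^bsub>M\<^esub> a = k \<odot>\<^bsub>M\<^esub> s \<oplus>\<^bsub>M\<^esub> (k \<otimes>\<^bsub>R\<^esub> c) \<odot>\<^bsub>M\<^esub> w"
      using * car A(2) by (simp add: smult_r_distr smult_assoc1)
    moreover have "k \<odot>\<^bsub>M\<^esub> s \<in> span A" "k \<otimes>\<^bsub>R\<^esub> c \<in> carrier R"
      using * submod_smult[OF sub] by auto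
    ultimately show "k \<odot>\<^bsub>M\<^esub> a \<in> ?U" by blast
  qed
  moreover have "insert w A \<subseteq> ?U"
  proof (intro insert_subsetI subsetI)
    have "w = \<zero>\<^bsub>M\<^esub> \<oplus>\<^bsub>M\<^esub> \<one>\<^bsub>R\<^esub> \<odot>\<^bsub>M\<^esub> w" using A(2) by simp
    then show "w \<in> ?U" using submod_zero[OF sub] by blast
    fix a assume "a \<in> A"
    then have "a = a \<oplus>\<^bsub>M\<^esub> \<zero>\<^bsub>R\<^esub> \<odot>\<^bsub>M\<^esub> w" "a \<in> span A" using A in_own_span by auto
    then show "a \<in> ?U" by blast
  qed
  ultimately show thesis using span_is_subset u that by blast
qed

end

context vectorspace
begin

lemma has_dim_zero: "has_dim {\<zero>\<^bsub>V\<^esub>} 0"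
  unfolding has_dim_def by (rule exI[of _ "{}"]) (simp add: span_empty_eq lin_dep_def)

lemma has_dim_step:
  assumes dim: "has_dim U n" and U': "submod K U' V" "U \<subseteq> U'" "w \<in> U'" "w \<notin> U"
    and gen: "\<And>u. u \<in> U' \<Longrightarrow> \<exists>s\<in>U. \<exists>c\<in>carrier K. u = s \<oplus>\<^bsub>V\<^esub> c \<odot>\<^bsub>V\<^esub> w"
  shows "has_dim U' (Suc n)"
proof -
  obtain A where A: "finite A" "A \<subseteq> carrier V" "lin_indpt A" "span A = U" "card A = n"
    using dim unfolding has_dim_def by blast
  have w: "w \<in> carrier V" using U' submod_subset by blast
  have "w \<notin> A" using A(2,4) U'(4) in_own_span by blast
  have "lin_indpt (A \<union> {w})"
    using lin_dep_iff_in_span[OF A(2,3) w \<open>w \<notin> A\<close>] A(4) U'(4) by simp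
  moreover have "span (A \<union> {w}) = U'"
  proof
    show "span (A \<union> {w}) \<subseteq> U'"
      by (rule span_is_subset) (use A U' in_own_span in blast)+
    have sub: "submod K (span (A \<union> {w})) V"
      by (rule span_is_submodule) (use A w in blast)
    have "U \<subseteq> span (A \<union> {w})" using A(4) span_is_monotone[of A "A \<union> {w}"] by blast
    moreover have "w \<in> span (A \<union> {w})" using in_own_span[of "A \<union> {w}"] A w by blast
    ultimately have "s \<oplus>\<^bsub>V\<^esub> c \<odot>\<^bsub>V\<^esub> w \<in> span (A \<union> {w})" if "s \<in> U" "c \<in> carrier K" for s c
      using that submod_add[OF sub]
        submod_smult[OF sub] by blast
    then show "U' \<subseteq> span (A \<union> {w})" using gen by blast
  qed
  moreover have "card (A \<union> {w}) = Suc n" using A(1,5) \<open>w \<notin> A\<close> by simp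
  moreover have "finite (A \<union> {w})" "A \<union> {w} \<subseteq> carrier V" using A w by auto
  ultimately show ?thesis unfolding has_dim_def by blast
qed

lemma has_dim_carrierD:
  assumes "has_dim (carrier V) n"
  shows "fin_dim" "dim = n"
  using assms dim_basis unfolding has_dim_def fin_dim_def basis_def by blast+

end

text \<open>With \<open>v\<close> spanning \<open>P\<close>, these are the leading terms of the preimage of \<open>W\<close> in the free
  module on \<open>B\<close>, where \<open>B\<close> is ordered by \<open>\<kappa>\<close>.\<close>

definition leading ::
  "('a, 'r) ring_scheme \<Rightarrow> ('a, 'p, 'q) module_scheme \<Rightarrow> ('i \<Rightarrow> 'p) \<Rightarrow> ('i \<Rightarrow> 'o::linorder) \<Rightarrow>
   'i set \<Rightarrow> 'p set \<Rightarrow> 'i set" where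
  "leading K P v \<kappa> B W =
     {b \<in> B. \<exists>u\<in>LinearCombinations.module.span K P (v ` {c \<in> B. \<kappa> c < \<kappa> b}). v b \<oplus>\<^bsub>P\<^esub> u \<in> W}"

lemma leading_mono: "W \<subseteq> W' \<Longrightarrow> leading K P v \<kappa> B W \<subseteq> leading K P v \<kappa> B W'"
  unfolding leading_def by blast

lemma leading_subset: "leading K P v \<kappa> B W \<subseteq> B"
  unfolding leading_def by blast

text \<open>As the largest index, \<open>x\<close> does not enter the spans attached to the others,
  and the span attached to \<open>x\<close> is that of all of \<open>S\<close>.\<close>

lemma leading_insert:
  assumes "x \<notin> S" "\<forall>y\<in>S. \<kappa> y < \<kappa> x"
  shows "leading K P v \<kappa> (insert x S) W = leading K P v \<kappa> S W \<union>
     (if \<exists>u\<in>LinearCombinations.module.span K P (v ` S). v x \<oplus>\<^bsub>P\<^esub> u \<in> W then {x} else {})"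
proof -
  have "{c \<in> insert x S. \<kappa> c < \<kappa> x} = S" using assms by auto
  moreover have "{c \<in> insert x S. \<kappa> c < \<kappa> b} = {c \<in> S. \<kappa> c < \<kappa> b}" if "b \<in> S" for b
    using assms(2) that by auto
  ultimately show ?thesis using assms(1) unfolding leading_def by auto
qed

text \<open>\<open>R\<close> is the graph of an isomorphism from \<open>N'/N\<close> to \<open>F'/F\<close>.\<close>

locale quotient_relation =
  V: vectorspace K V + P: vectorspace K P
  for K :: "('a, 'r) ring_scheme" and V :: "('a, 'v, 'e) module_scheme"
    and P :: "('a, 'p, 'q) module_scheme" +
  fixes F F' :: "'v set" and N N' :: "'p set" and R :: "'p \<Rightarrow> 'v \<Rightarrow> bool"
  assumes F: "submod K F V" and F': "submod K F' V"
    and FF': "F \<subseteq> F'"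
    and N: "submod K N P" and N': "submod K N' P"
    and R_dom: "R y z \<Longrightarrow> y \<in> N'" and R_ran: "R y z \<Longrightarrow> z \<in> F'"
    and R_total: "y \<in> N' \<Longrightarrow> \<exists>z. R y z" and R_surj: "z \<in> F' \<Longrightarrow> \<exists>y. R y z"
    and R_add: "R y z \<Longrightarrow> R y' z' \<Longrightarrow> R (y \<oplus>\<^bsub>P\<^esub> y') (z \<oplus>\<^bsub>V\<^esub> z')"
    and R_smult: "c \<in> carrier K \<Longrightarrow> R y z \<Longrightarrow> R (c \<odot>\<^bsub>P\<^esub> y) (c \<odot>\<^bsub>V\<^esub> z)"
    and R_iff: "R y z \<Longrightarrow> y \<in> N \<longleftrightarrow> z \<in> F"
    and R_zero: "y \<in> N \<Longrightarrow> z \<in> F \<Longrightarrow> R y z"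
begin

lemmas N'_car = submod_subset[OF N', THEN subsetD]
lemmas N_car = submod_subset[OF N, THEN subsetD]
lemmas F'_car = submod_subset[OF F', THEN subsetD]

lemma R_minus:
  assumes "R y z" "R y' z'"
  shows "R (y \<ominus>\<^bsub>P\<^esub> y') (z \<ominus>\<^bsub>V\<^esub> z')"
proof -
  have "R ((\<ominus>\<^bsub>K\<^esub> \<one>\<^bsub>K\<^esub>) \<odot>\<^bsub>P\<^esub> y') ((\<ominus>\<^bsub>K\<^esub> \<one>\<^bsub>K\<^esub>) \<odot>\<^bsub>V\<^esub> z')"
    by (rule R_smult[OF _ assms(2)]) simp
  then have "R (\<ominus>\<^bsub>P\<^esub> y') (\<ominus>\<^bsub>V\<^esub> z')"
    using R_dom[OF assms(2)] R_ran[OF assms(2)] N'_car F'_car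
    by (simp add: V.smult_minus_1 P.smult_minus_1)
  from R_add[OF assms(1) this] show ?thesis by (simp add: a_minus_def)
qed

text \<open>As \<open>S\<close> grows from the empty set to a generating set, these subspaces climb
  from \<open>F\<close> to \<open>F'\<close>, and every new vector raises the dimension by at most
  one.\<close>

definition slice :: "'p set \<Rightarrow> 'v set" where
  "slice S = {z. \<exists>y\<in>P.span S. R y z}"

lemma slice_submodule:
  assumes "S \<subseteq> carrier P"
  shows "submod K (slice S) V"
proof
  note sub = P.span_is_submodule[OF assms]
  show "slice S \<subseteq> carrier V" using R_ran F'_car by (auto simp: slice_def)
  show "\<zero>\<^bsub>V\<^esub> \<in> slice S"
    using submod_zero[OF sub] R_zero
      submod_zero[OF N] submod_zero[OF F]
    by (auto simp: slice_def)
  show "a \<oplus>\<^bsub>V\<^esub> b \<in> slice S" if "a \<in> slice S" "b \<in> slice S" for a b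
    using that submod_add[OF sub] R_add unfolding slice_def by blast
  show "c \<odot>\<^bsub>V\<^esub> a \<in> slice S" if "c \<in> carrier K" "a \<in> slice S" for c a
    using that submod_smult[OF sub] R_smult unfolding slice_def by blast
qed

lemma slice_mono: "S \<subseteq> S' \<Longrightarrow> slice S \<subseteq> slice S'"
  using P.span_is_monotone unfolding slice_def by blast

lemma slice_empty: "slice {} = F"
proof -
  have "R \<zero>\<^bsub>P\<^esub> z \<longleftrightarrow> z \<in> F" for z
    using R_iff R_zero submod_zero[OF N] by blast
  then show ?thesis by (simp add: slice_def P.span_empty_eq)
qed

text \<open>If \<open>w\<close> leads an element of \<open>N'\<close> but none of \<open>N\<close>,
  the partner under \<open>R\<close> of such an element is a new basis vector. If \<open>w\<close>
  leads an element of \<open>N\<close>, that element is related to zero and can be used to remove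
  \<open>w\<close>. If \<open>w\<close> leads nothing in \<open>N'\<close>, then \<open>w\<close>
  cannot occur in an element of \<open>N'\<close> at all.\<close>

lemma slice_insert:
  assumes S: "S \<subseteq> carrier P" and w: "w \<in> carrier P" and dim: "V.has_dim (slice S) n"
  defines "lead \<equiv> \<lambda>W. \<exists>u\<in>P.span S. w \<oplus>\<^bsub>P\<^esub> u \<in> W"
  shows "V.has_dim (slice (insert w S)) (n + (if lead N' \<and> \<not> lead N then 1 else 0))"
proof -
  note sub = P.span_is_submodule[OF S]
  note span_car = submod_subset[OF sub, THEN subsetD]
  have reduce: "(s \<oplus>\<^bsub>P\<^esub> c \<odot>\<^bsub>P\<^esub> w) \<ominus>\<^bsub>P\<^esub> c \<odot>\<^bsub>P\<^esub> (w \<oplus>\<^bsub>P\<^esub> u) \<in> P.span S"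
    if "s \<in> P.span S" "u \<in> P.span S" "c \<in> carrier K" for s u c
  proof -
    have "(s \<oplus>\<^bsub>P\<^esub> c \<odot>\<^bsub>P\<^esub> w) \<ominus>\<^bsub>P\<^esub> c \<odot>\<^bsub>P\<^esub> (w \<oplus>\<^bsub>P\<^esub> u) = s \<ominus>\<^bsub>P\<^esub> c \<odot>\<^bsub>P\<^esub> u"
    proof -
      define cw cu where "cw = c \<odot>\<^bsub>P\<^esub> w" and "cu = c \<odot>\<^bsub>P\<^esub> u"
      have [simp]: "s \<in> carrier P" "cw \<in> carrier P" "cu \<in> carrier P"
        using that w span_car by (auto simp: cw_def cu_def)
      have "c \<odot>\<^bsub>P\<^esub> (w \<oplus>\<^bsub>P\<^esub> u) = cw \<oplus>\<^bsub>P\<^esub> cu"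
        using that w span_car by (simp add: cw_def cu_def P.smult_r_distr)
      moreover have "(s \<oplus>\<^bsub>P\<^esub> cw) \<ominus>\<^bsub>P\<^esub> (cw \<oplus>\<^bsub>P\<^esub> cu) = s \<ominus>\<^bsub>P\<^esub> cu"
      proof -
        have "(s \<oplus>\<^bsub>P\<^esub> cw) \<oplus>\<^bsub>P\<^esub> (\<ominus>\<^bsub>P\<^esub> cw \<oplus>\<^bsub>P\<^esub> \<ominus>\<^bsub>P\<^esub> cu) = s \<oplus>\<^bsub>P\<^esub> ((cw \<oplus>\<^bsub>P\<^esub> \<ominus>\<^bsub>P\<^esub> cw) \<oplus>\<^bsub>P\<^esub> \<ominus>\<^bsub>P\<^esub> cu)"
          by (simp only: P.M.a_assoc P.M.a_closed P.M.a_inv_closed \<open>s \<in> carrier P\<close> \<open>cw \<in> carrier P\<close> \<open>cu \<in> carrier P\<close>)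
        then show ?thesis by (simp add: a_minus_def P.M.minus_add P.M.r_neg)
      qed
      ultimately show ?thesis by (simp add: cw_def cu_def)
    qed
    then show ?thesis
      using that P.submodule_minus_closed[OF sub] submod_smult[OF sub] by simp
  qed
  show ?thesis
  proof (cases "lead N' \<and> \<not> lead N")
    case True
    then obtain u0 where u0: "u0 \<in> P.span S" "w \<oplus>\<^bsub>P\<^esub> u0 \<in> N'" by (auto simp: lead_def)
    then obtain z0 where z0: "R (w \<oplus>\<^bsub>P\<^esub> u0) z0" using R_total by blast
    have sub': "submod K (P.span (insert w S)) P"
      by (rule P.span_is_submodule) (use S w in blast)
    have "w \<oplus>\<^bsub>P\<^esub> u0 \<in> P.span (insert w S)"
    proof (rule submod_add[OF sub'])
      show "w \<in> P.span (insert w S)" using P.in_own_span[of "insert w S"] S w by blast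
      show "u0 \<in> P.span (insert w S)" using u0(1) P.span_is_monotone[of S "insert w S"] by blast
    qed
    then have z0_in: "z0 \<in> slice (insert w S)" using z0 by (auto simp: slice_def)
    have z0_car: "z0 \<in> carrier V" using R_ran[OF z0] F'_car by blast
    \<comment> \<open>Otherwise \<open>w \<oplus> u0\<close> and some \<open>y1\<close> in the span
      of \<open>S\<close> are related to the same vector, so their difference lies in
      \<open>N\<close> and is led by \<open>w\<close>.\<close>
    have z0_notin: "z0 \<notin> slice S"
    proof
      assume "z0 \<in> slice S"
      then obtain y1 where y1: "y1 \<in> P.span S" "R y1 z0" by (auto simp: slice_def)
      have "R ((w \<oplus>\<^bsub>P\<^esub> u0) \<ominus>\<^bsub>P\<^esub> y1) (z0 \<ominus>\<^bsub>V\<^esub> z0)" by (rule R_minus[OF z0 y1(2)])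
      then have "(w \<oplus>\<^bsub>P\<^esub> u0) \<ominus>\<^bsub>P\<^esub> y1 \<in> N"
        using R_iff z0_car submod_zero[OF F] by (simp add: a_minus_def V.M.r_neg)
      moreover have "(w \<oplus>\<^bsub>P\<^esub> u0) \<ominus>\<^bsub>P\<^esub> y1 = w \<oplus>\<^bsub>P\<^esub> (u0 \<ominus>\<^bsub>P\<^esub> y1)"
        using w u0(1) y1(1) span_car by (simp add: a_minus_def P.M.a_assoc)
      ultimately have "lead N"
        using P.submodule_minus_closed[OF sub u0(1) y1(1)] unfolding lead_def by auto
      with True show False by simp
    qed
    have "V.has_dim (slice (insert w S)) (Suc n)"
    proof (rule V.has_dim_step[OF dim _ _ z0_in z0_notin])
      show "submod K (slice (insert w S)) V"
        by (rule slice_submodule) (use S w in blast)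
      show "slice S \<subseteq> slice (insert w S)" by (rule slice_mono) blast
      fix z assume "z \<in> slice (insert w S)"
      then obtain y where y: "y \<in> P.span (insert w S)" "R y z" by (auto simp: slice_def)
      obtain s c where s: "s \<in> P.span S" "c \<in> carrier K" "y = s \<oplus>\<^bsub>P\<^esub> c \<odot>\<^bsub>P\<^esub> w"
        by (rule P.span_insertD[OF S w y(1)])
      have "R (y \<ominus>\<^bsub>P\<^esub> c \<odot>\<^bsub>P\<^esub> (w \<oplus>\<^bsub>P\<^esub> u0)) (z \<ominus>\<^bsub>V\<^esub> c \<odot>\<^bsub>V\<^esub> z0)"
        by (intro R_minus y R_smult z0 s(2))
      then have "z \<ominus>\<^bsub>V\<^esub> c \<odot>\<^bsub>V\<^esub> z0 \<in> slice S"
        using reduce[OF s(1) u0(1) s(2)] s(3) by (auto simp: slice_def)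
      moreover have "z = (z \<ominus>\<^bsub>V\<^esub> c \<odot>\<^bsub>V\<^esub> z0) \<oplus>\<^bsub>V\<^esub> c \<odot>\<^bsub>V\<^esub> z0"
        using R_ran[OF y(2)] F'_car z0_car s(2) by (simp add: a_minus_def V.M.a_assoc V.M.l_neg)
      ultimately show "\<exists>s\<in>slice S. \<exists>c\<in>carrier K. z = s \<oplus>\<^bsub>V\<^esub> c \<odot>\<^bsub>V\<^esub> z0" using s(2) by blast
    qed
    with True show ?thesis by simp
  next
    case False
    have "slice (insert w S) \<subseteq> slice S"
    proof
      fix z assume "z \<in> slice (insert w S)"
      then obtain y where y: "y \<in> P.span (insert w S)" "R y z" by (auto simp: slice_def)
      obtain s c where s: "s \<in> P.span S" "c \<in> carrier K" "y = s \<oplus>\<^bsub>P\<^esub> c \<odot>\<^bsub>P\<^esub> w"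
        by (rule P.span_insertD[OF S w y(1)])
      show "z \<in> slice S"
      proof (cases "lead N")
        case True
        then obtain u0 where u0: "u0 \<in> P.span S" "w \<oplus>\<^bsub>P\<^esub> u0 \<in> N" by (auto simp: lead_def)
        then have "R (w \<oplus>\<^bsub>P\<^esub> u0) \<zero>\<^bsub>V\<^esub>"
          using R_zero submod_zero[OF F] by blast
        then have "R (y \<ominus>\<^bsub>P\<^esub> c \<odot>\<^bsub>P\<^esub> (w \<oplus>\<^bsub>P\<^esub> u0)) (z \<ominus>\<^bsub>V\<^esub> c \<odot>\<^bsub>V\<^esub> \<zero>\<^bsub>V\<^esub>)"
          by (intro R_minus y R_smult s(2))
        moreover have "z \<ominus>\<^bsub>V\<^esub> c \<odot>\<^bsub>V\<^esub> \<zero>\<^bsub>V\<^esub> = z"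
          using R_ran[OF y(2)] F'_car s(2) by (simp add: a_minus_def)
        ultimately show ?thesis using reduce[OF s(1) u0(1) s(2)] s(3) by (auto simp: slice_def)
      next
        case nl: False
        then have nl': "\<not> lead N'" using False by blast
        \<comment> \<open>Dividing by a nonzero coefficient would turn \<open>y\<close> into an
          element of \<open>N'\<close> led by \<open>w\<close>.\<close>
        have "c = \<zero>\<^bsub>K\<^esub>"
        proof (rule ccontr)
          assume "c \<noteq> \<zero>\<^bsub>K\<^esub>"
          then have inv: "inv\<^bsub>K\<^esub> c \<in> carrier K" "inv\<^bsub>K\<^esub> c \<otimes>\<^bsub>K\<^esub> c = \<one>\<^bsub>K\<^esub>"
            using s(2) V.field_Units by (auto intro: V.Units_l_inv)
          have "inv\<^bsub>K\<^esub> c \<odot>\<^bsub>P\<^esub> y = inv\<^bsub>K\<^esub> c \<odot>\<^bsub>P\<^esub> s \<oplus>\<^bsub>P\<^esub> w"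
            using s inv w span_car by (simp add: P.smult_r_distr P.smult_assoc1[symmetric])
          also have "\<dots> = w \<oplus>\<^bsub>P\<^esub> inv\<^bsub>K\<^esub> c \<odot>\<^bsub>P\<^esub> s"
            using s inv w span_car by (simp add: P.M.a_comm)
          finally have "w \<oplus>\<^bsub>P\<^esub> inv\<^bsub>K\<^esub> c \<odot>\<^bsub>P\<^esub> s \<in> N'"
            using R_dom[OF y(2)] inv submod_smult[OF N'] by metis
          moreover have "inv\<^bsub>K\<^esub> c \<odot>\<^bsub>P\<^esub> s \<in> P.span S"
            using s inv submod_smult[OF sub] by blast
          ultimately show False using nl' unfolding lead_def by blast
        qed
        then have "y = s" using s w span_car by simp
        then show ?thesis using y(2) s(1) by (auto simp: slice_def)
      qed
    qed
    moreover have "slice S \<subseteq> slice (insert w S)" by (rule slice_mono) blast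
    ultimately have "slice (insert w S) = slice S" by blast
    then show ?thesis using dim by (simp only: if_not_P[OF False] add_0_right)
  qed
qed

text \<open>The vectors are added in increasing order of \<open>\<kappa>\<close>. Then the span
  present when \<open>b\<close> is added is the one in the definition of \<open>leading\<close>, and
  \<open>slice_insert\<close> says whether \<open>b\<close> counts.\<close>

lemma has_dim_by_leading:
  assumes "finite B" "v ` B \<subseteq> carrier P" "inj_on \<kappa> B" "N' \<subseteq> P.span (v ` B)" "V.has_dim F n"
  shows "V.has_dim F' (n + card (leading K P v \<kappa> B N' - leading K P v \<kappa> B N))"
proof -
  have "V.has_dim (slice (v ` B)) (n + card (leading K P v \<kappa> B N' - leading K P v \<kappa> B N))"
    using assms(1-3)
  proof (induction rule: finite_ranking_induct[where f = \<kappa>])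
    case empty
    then show ?case using assms(5) by (simp add: slice_empty leading_def)
  next
    case (insert x S)
    show ?case
    proof (cases "x \<in> S")
      case True
      then have "insert x S = S" by blast
      then show ?thesis using insert by simp
    next
      case False
      have strict: "\<forall>y\<in>S. \<kappa> y < \<kappa> x"
      proof
        fix y assume that: "y \<in> S"
        have "\<kappa> y \<noteq> \<kappa> x" using insert.prems(2) that False by (metis inj_onD insertCI)
        then show "\<kappa> y < \<kappa> x" using insert.hyps(2)[OF that] by simp
      qed
      let ?L = "\<lambda>S W. leading K P v \<kappa> S W"
      let ?lead = "\<lambda>W. \<exists>u\<in>P.span (v ` S). v x \<oplus>\<^bsub>P\<^esub> u \<in> W"
      have IH: "V.has_dim (slice (v ` S)) (n + card (?L S N' - ?L S N))"
        using insert by (auto intro: inj_on_subset)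
      have notin: "x \<notin> ?L S W" for W
        using False subsetD[OF leading_subset[of K P v \<kappa> S W]] by auto
      have "?L (insert x S) N' - ?L (insert x S) N =
          (?L S N' - ?L S N) \<union> (if ?lead N' \<and> \<not> ?lead N then {x} else {})"
      proof -
        have ins: "?L (insert x S) W = ?L S W \<union> (if ?lead W then {x} else {})" for W
          by (rule leading_insert[OF False strict])
        show ?thesis unfolding ins using notin[of N] notin[of N'] by auto
      qed
      moreover have "x \<notin> ?L S N' - ?L S N" using notin[of N'] by simp
      moreover have "finite (?L S N' - ?L S N)"
        by (rule finite_Diff, rule finite_subset[OF leading_subset insert.hyps(1)])
      ultimately have "card (?L (insert x S) N' - ?L (insert x S) N) =
          card (?L S N' - ?L S N) + (if ?lead N' \<and> \<not> ?lead N then 1 else 0)"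
        by simp
      then show ?thesis
        using slice_insert[OF _ _ IH, of "v x"] insert.prems(1) by (simp add: add.assoc)
    qed
  qed
  moreover have "slice (v ` B) = F'"
    using assms(4) R_dom R_ran R_surj unfolding slice_def by blast
  ultimately show ?thesis by simp
qed

end

section \<open>Cosets\<close>

text \<open>Always formed with the addition of the ambient \<open>V\<close>: the quotients below are
  taken of \<open>V\<close> with a smaller carrier, and this form lets their cosets be treated as
  cosets in \<open>V\<close>.\<close>

definition coset :: "('a, 'v, 'e) module_scheme \<Rightarrow> 'v set \<Rightarrow> 'v \<Rightarrow> 'v set" where
  "coset V U z = (\<lambda>u. u \<oplus>\<^bsub>V\<^esub> z) ` U"

lemma a_r_coset_eq_coset: "U +>\<^bsub>V\<lparr>carrier := W\<rparr>\<^esub> z = coset V U z"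
  unfolding a_r_coset_def r_coset_def coset_def by auto

lemma carrier_quot_module: "carrier (quot_module (V\<lparr>carrier := W\<rparr>) U) = coset V U ` W"
  unfolding quot_module_def A_RCOSETS_def RCOSETS_def coset_def r_coset_def by auto

context Module.module
begin

lemma coset_zero: "submod R U M \<Longrightarrow> coset M U \<zero>\<^bsub>M\<^esub> = U"
  using submod_subset[of R U M] by (force simp: coset_def)

lemma coset_eq_iff:
  assumes U: "submod R U M" and z: "z \<in> carrier M" "z' \<in> carrier M"
  shows "coset M U z = coset M U z' \<longleftrightarrow> z \<ominus>\<^bsub>M\<^esub> z' \<in> U"
proof
  note car = submod_subset[OF U, THEN subsetD]
  note zero = submod_zero[OF U]
  {
    assume eq: "coset M U z = coset M U z'"
    have "z = \<zero>\<^bsub>M\<^esub> \<oplus>\<^bsub>M\<^esub> z" using z by simp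
    then have "z \<in> coset M U z" using zero unfolding coset_def by blast
    then have "z \<in> coset M U z'" using eq by simp
    then obtain u where "u \<in> U" "z = u \<oplus>\<^bsub>M\<^esub> z'" unfolding coset_def by blast
    then show "z \<ominus>\<^bsub>M\<^esub> z' \<in> U" using car z by (simp add: a_minus_def M.a_assoc M.r_neg)
  next
    assume d: "z \<ominus>\<^bsub>M\<^esub> z' \<in> U"
    have sub: "coset M U a \<subseteq> coset M U b" if ab: "a \<ominus>\<^bsub>M\<^esub> b \<in> U" "a \<in> carrier M" "b \<in> carrier M" for a b
    proof
      fix x assume "x \<in> coset M U a"
      then obtain u where u: "u \<in> U" "x = u \<oplus>\<^bsub>M\<^esub> a" unfolding coset_def by blast
      have "x = (u \<oplus>\<^bsub>M\<^esub> (a \<ominus>\<^bsub>M\<^esub> b)) \<oplus>\<^bsub>M\<^esub> b"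
        using u ab car by (simp add: a_minus_def M.a_assoc M.l_neg)
      moreover have "u \<oplus>\<^bsub>M\<^esub> (a \<ominus>\<^bsub>M\<^esub> b) \<in> U"
        using submod_add[OF U u(1) ab(1)] .
      ultimately show "x \<in> coset M U b" unfolding coset_def by blast
    qed
    have "\<ominus>\<^bsub>M\<^esub> (z \<ominus>\<^bsub>M\<^esub> z') = z' \<ominus>\<^bsub>M\<^esub> z"
      using z by (simp add: a_minus_def M.minus_add M.a_comm)
    then have "z' \<ominus>\<^bsub>M\<^esub> z \<in> U" using submodule_neg_closed[OF U d] by simp
    then show "coset M U z = coset M U z'" using sub d z by blast
  }
qed

lemma coset_eq_self_iff:
  assumes U: "submod R U M" and z: "z \<in> carrier M"
  shows "coset M U z = U \<longleftrightarrow> z \<in> U"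
proof -
  have neg: "\<ominus>\<^bsub>M\<^esub> \<zero>\<^bsub>M\<^esub> = \<zero>\<^bsub>M\<^esub>" by (metis M.l_zero M.a_inv_closed M.zero_closed M.r_neg)
  show ?thesis
    using coset_eq_iff[OF U z M.zero_closed] z by (simp add: coset_zero[OF U] a_minus_def neg)
qed

end

lemma quot_module_add:
  fixes M :: "('a, 'b) module"
  assumes M: "Module.module R M" and U: "submod R U M" and z: "z \<in> carrier M" "z' \<in> carrier M"
  shows "coset M U z \<oplus>\<^bsub>quot_module (M\<lparr>carrier := W\<rparr>) U\<^esub> coset M U z' = coset M U (z \<oplus>\<^bsub>M\<^esub> z')"
proof -
  interpret Module.module R M by (rule M)
  note car = submod_subset[OF U, THEN subsetD]
  have "coset M U z \<oplus>\<^bsub>quot_module (M\<lparr>carrier := W\<rparr>) U\<^esub> coset M U z' =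
      {(u \<oplus>\<^bsub>M\<^esub> z) \<oplus>\<^bsub>M\<^esub> (u' \<oplus>\<^bsub>M\<^esub> z') |u u'. u \<in> U \<and> u' \<in> U}"
    unfolding quot_module_def set_add_def set_mult_def coset_def by auto
  also have "\<dots> = {(u \<oplus>\<^bsub>M\<^esub> u') \<oplus>\<^bsub>M\<^esub> (z \<oplus>\<^bsub>M\<^esub> z') |u u'. u \<in> U \<and> u' \<in> U}"
  proof -
    have "(u \<oplus>\<^bsub>M\<^esub> z) \<oplus>\<^bsub>M\<^esub> (u' \<oplus>\<^bsub>M\<^esub> z') = (u \<oplus>\<^bsub>M\<^esub> u') \<oplus>\<^bsub>M\<^esub> (z \<oplus>\<^bsub>M\<^esub> z')"
      if "u \<in> U" "u' \<in> U" for u u'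
      using that car z by (simp add: M.a_ac)
    then show ?thesis by (metis (no_types, lifting))
  qed
  also have "\<dots> = coset M U (z \<oplus>\<^bsub>M\<^esub> z')"
  proof (intro equalityI subsetI)
    fix x assume "x \<in> coset M U (z \<oplus>\<^bsub>M\<^esub> z')"
    then obtain u where u: "u \<in> U" "x = u \<oplus>\<^bsub>M\<^esub> (z \<oplus>\<^bsub>M\<^esub> z')" unfolding coset_def by blast
    then have "x = (u \<oplus>\<^bsub>M\<^esub> \<zero>\<^bsub>M\<^esub>) \<oplus>\<^bsub>M\<^esub> (z \<oplus>\<^bsub>M\<^esub> z')" using car by simp
    then show "x \<in> {(u \<oplus>\<^bsub>M\<^esub> u') \<oplus>\<^bsub>M\<^esub> (z \<oplus>\<^bsub>M\<^esub> z') |u u'. u \<in> U \<and> u' \<in> U}"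
      using u(1) submod_zero[OF U] by blast
  qed (use submod_add[OF U] in \<open>auto simp: coset_def\<close>)
  finally show ?thesis .
qed

text \<open>The scalar multiple is a union over all members of the coset; every member yields the
  same coset, and there is at least one member.\<close>

lemma quot_module_smult:
  fixes M :: "('a, 'b) module"
  assumes M: "Module.module R M" and U: "submod R U M" and z: "z \<in> carrier M" and c: "c \<in> carrier R"
  shows "c \<odot>\<^bsub>quot_module (M\<lparr>carrier := W\<rparr>) U\<^esub> coset M U z = coset M U (c \<odot>\<^bsub>M\<^esub> z)"
proof -
  interpret Module.module R M by (rule M)
  note car = submod_subset[OF U, THEN subsetD]
  have "coset M U (c \<odot>\<^bsub>M\<^esub> (u \<oplus>\<^bsub>M\<^esub> z)) = coset M U (c \<odot>\<^bsub>M\<^esub> z)" if "u \<in> U" for u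
  proof -
    have "c \<odot>\<^bsub>M\<^esub> (u \<oplus>\<^bsub>M\<^esub> z) \<ominus>\<^bsub>M\<^esub> c \<odot>\<^bsub>M\<^esub> z = c \<odot>\<^bsub>M\<^esub> u"
      using that car z c by (simp add: smult_r_distr a_minus_def M.a_assoc M.r_neg)
    then show ?thesis
      using that car z c coset_eq_iff[OF U] submod_smult[OF U c that] by simp
  qed
  moreover have "U \<noteq> {}" using submod_zero[OF U] by blast
  ultimately show ?thesis
    unfolding quot_module_def by (auto simp: a_r_coset_eq_coset coset_def[of M U z])
qed

section \<open>Dimension of a filtered space whose graded space is a subquotient\<close>

lemma submodule_trans:
  assumes "Module.module K P" "submod K N P"
    "submod K N' (P\<lparr>carrier := N\<rparr>)"
  shows "submod K N' P" "N' \<subseteq> N"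
  using assms unfolding LinearCombinations.submodule_def by auto

text \<open>The situation at a single graph: \<open>V\<close> is the filtered value of
  \<open>M\<close>, and \<open>\<eta>\<close> identifies its graded space with the subquotient
  \<open>N / N'\<close> of the value of \<open>P\<close>.\<close>

locale graded_subquotient =
  V: vectorspace K V + P: vectorspace K P
  for K :: "('a, 'r) ring_scheme" and V :: "('a, 'v) module" and P :: "('a, 'p) module" +
  fixes n :: nat and F :: "nat \<Rightarrow> 'v set" and N N' :: "'p set" and \<eta> :: "(nat \<Rightarrow> 'v set) \<Rightarrow> 'p set"
  assumes F_sub: "i \<le> n \<Longrightarrow> submod K (F i) V"
    and F_zero: "F 0 = {\<zero>\<^bsub>V\<^esub>}" and F_top: "F n = carrier V"
    and F_mono: "i < n \<Longrightarrow> F i \<subseteq> F (Suc i)"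
    and N_sub: "submod K N P"
    and N'_sub: "submod K N' P" and N'_le: "N' \<subseteq> N"
    and \<eta>_hom: "\<eta> \<in> LinearCombinations.module_hom K
        (dsum_module {..<n} (\<lambda>i. quot_module (V\<lparr>carrier := F (Suc i)\<rparr>) (F i)))
        (quot_module (P\<lparr>carrier := N\<rparr>) N')"
    and \<eta>_bij: "bij_betw \<eta>
        (carrier (dsum_module {..<n} (\<lambda>i. quot_module (V\<lparr>carrier := F (Suc i)\<rparr>) (F i))))
        (carrier (quot_module (P\<lparr>carrier := N\<rparr>) N'))"
begin

abbreviation "Gr \<equiv> dsum_module {..<n} (\<lambda>i. quot_module (V\<lparr>carrier := F (Suc i)\<rparr>) (F i))"

text \<open>The sum of the first \<open>i\<close> summands of the graded space: \<open>F j\<close>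
  is the zero class of the summand numbered \<open>j\<close>.\<close>

definition E :: "nat \<Rightarrow> (nat \<Rightarrow> 'v set) set" where
  "E i = {x \<in> carrier Gr. \<forall>j<n. i \<le> j \<longrightarrow> x j = F j}"

text \<open>The preimage in \<open>N\<close> of the part of \<open>N / N'\<close> that corresponds
  to \<open>E i\<close>. These form a chain from \<open>N'\<close> to \<open>N\<close> whose
  successive quotients are those of the filtration \<open>F\<close>.\<close>

definition Npre :: "nat \<Rightarrow> 'p set" where
  "Npre i = {y \<in> N. \<exists>x\<in>E i. \<eta> x = coset P N' y}"

lemmas N_car = submod_subset[OF N_sub, THEN subsetD]

lemma F_car: "i \<le> n \<Longrightarrow> z \<in> F i \<Longrightarrow> z \<in> carrier V"
  using F_sub submod_subset by blast

lemma carrier_Gr: "carrier Gr = (\<Pi>\<^sub>E i\<in>{..<n}. coset V (F i) ` F (Suc i))"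
  unfolding dsum_module_def by (simp add: carrier_quot_module)

lemma E_Suc_coset:
  assumes "x \<in> carrier Gr" "j < n"
  obtains z where "z \<in> F (Suc j)" "x j = coset V (F j) z"
  using assms unfolding carrier_Gr by (auto simp: PiE_def Pi_def)

lemma Gr_add: "x \<oplus>\<^bsub>Gr\<^esub> x' = (\<lambda>j\<in>{..<n}. x j \<oplus>\<^bsub>quot_module (V\<lparr>carrier := F (Suc j)\<rparr>) (F j)\<^esub> x' j)"
  by (simp add: dsum_module_def)

lemma Gr_smult: "c \<odot>\<^bsub>Gr\<^esub> x = (\<lambda>j\<in>{..<n}. c \<odot>\<^bsub>quot_module (V\<lparr>carrier := F (Suc j)\<rparr>) (F j)\<^esub> x j)"
  by (simp add: dsum_module_def)

lemma quot_add:
  assumes "j < n" "z \<in> carrier V" "z' \<in> carrier V"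
  shows "coset V (F j) z \<oplus>\<^bsub>quot_module (V\<lparr>carrier := F (Suc j)\<rparr>) (F j)\<^esub> coset V (F j) z' =
    coset V (F j) (z \<oplus>\<^bsub>V\<^esub> z')"
  by (rule quot_module_add[OF V.module_axioms]) (use assms F_sub in auto)

lemma quot_smult:
  assumes "j < n" "z \<in> carrier V" "c \<in> carrier K"
  shows "c \<odot>\<^bsub>quot_module (V\<lparr>carrier := F (Suc j)\<rparr>) (F j)\<^esub> coset V (F j) z = coset V (F j) (c \<odot>\<^bsub>V\<^esub> z)"
  by (rule quot_module_smult[OF V.module_axioms]) (use assms F_sub in auto)

lemma coset_F_zero: "j < n \<Longrightarrow> coset V (F j) \<zero>\<^bsub>V\<^esub> = F j"
  by (rule V.coset_zero) (use F_sub in auto)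

lemma E_add:
  assumes "x \<in> E i" "x' \<in> E i"
  shows "x \<oplus>\<^bsub>Gr\<^esub> x' \<in> E i"
proof -
  have "(x \<oplus>\<^bsub>Gr\<^esub> x') j \<in> coset V (F j) ` F (Suc j)" if j: "j < n" for j
  proof -
    obtain z z' where "z \<in> F (Suc j)" "x j = coset V (F j) z" "z' \<in> F (Suc j)" "x' j = coset V (F j) z'"
      using E_Suc_coset assms j unfolding E_def by (metis (no_types, lifting) mem_Collect_eq)
    then show ?thesis
      using j quot_add[OF j] F_car[of "Suc j"] submod_add[OF F_sub[of "Suc j"]]
      by (simp add: Gr_add)
  qed
  moreover have "(x \<oplus>\<^bsub>Gr\<^esub> x') j = F j" if "j < n" "i \<le> j" for j
    using that assms quot_add[of j "\<zero>\<^bsub>V\<^esub>" "\<zero>\<^bsub>V\<^esub>"] by (simp add: Gr_add E_def coset_F_zero)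
  ultimately show ?thesis unfolding E_def carrier_Gr by (auto simp: Gr_add)
qed

lemma E_smult:
  assumes "x \<in> E i" "c \<in> carrier K"
  shows "c \<odot>\<^bsub>Gr\<^esub> x \<in> E i"
proof -
  have "(c \<odot>\<^bsub>Gr\<^esub> x) j \<in> coset V (F j) ` F (Suc j)" if j: "j < n" for j
  proof -
    obtain z where "z \<in> F (Suc j)" "x j = coset V (F j) z"
      using E_Suc_coset assms j unfolding E_def by (metis (no_types, lifting) mem_Collect_eq)
    then show ?thesis
      using j quot_smult[OF j] F_car[of "Suc j"] assms(2)
        submod_smult[OF F_sub[of "Suc j"]]
      by (simp add: Gr_smult)
  qed
  moreover have "(c \<odot>\<^bsub>Gr\<^esub> x) j = F j" if "j < n" "i \<le> j" for j
    using that assms quot_smult[of j "\<zero>\<^bsub>V\<^esub>" c] by (simp add: Gr_smult E_def coset_F_zero)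
  ultimately show ?thesis unfolding E_def carrier_Gr by (auto simp: Gr_smult)
qed

lemma E_zero: "(\<lambda>j\<in>{..<n}. F j) \<in> E i"
proof -
  have "F j \<in> coset V (F j) ` F (Suc j)" if "j < n" for j
    using that coset_F_zero submod_zero[OF F_sub[of "Suc j"]]
    by (metis Suc_leI image_eqI)
  then show ?thesis unfolding E_def carrier_Gr by auto
qed

lemma E_carrier: "x \<in> E i \<Longrightarrow> x \<in> carrier Gr"
  by (simp add: E_def)

lemma E_mono: "i \<le> j \<Longrightarrow> E i \<subseteq> E j"
  by (auto simp: E_def)

lemma E_SucD: "x \<in> E (Suc i) \<Longrightarrow> x i = F i \<Longrightarrow> x \<in> E i"
  by (auto simp: E_def le_eq_less_or_eq Suc_le_eq)

lemma \<eta>_add: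
  assumes "x \<in> carrier Gr" "x' \<in> carrier Gr" "\<eta> x = coset P N' y" "\<eta> x' = coset P N' y'" "y \<in> N" "y' \<in> N"
  shows "\<eta> (x \<oplus>\<^bsub>Gr\<^esub> x') = coset P N' (y \<oplus>\<^bsub>P\<^esub> y')"
  using LinearCombinations.module_hom_add[OF \<eta>_hom assms(1,2)] assms N_car
  by (simp add: quot_module_add[OF P.module_axioms N'_sub])

lemma \<eta>_smult:
  assumes "x \<in> carrier Gr" "\<eta> x = coset P N' y" "y \<in> N" "c \<in> carrier K"
  shows "\<eta> (c \<odot>\<^bsub>Gr\<^esub> x) = coset P N' (c \<odot>\<^bsub>P\<^esub> y)"
  using LinearCombinations.module_hom_smult[OF \<eta>_hom assms(4,1)] assms N_car
  by (simp add: quot_module_smult[OF P.module_axioms N'_sub])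

lemma \<eta>_coset:
  assumes "x \<in> carrier Gr"
  obtains y where "y \<in> N" "\<eta> x = coset P N' y"
proof -
  have "\<eta> x \<in> coset P N' ` N"
    using \<eta>_bij assms unfolding bij_betw_def carrier_quot_module by blast
  then show thesis using that by blast
qed

lemma \<eta>_zero: "\<eta> (\<lambda>j\<in>{..<n}. F j) = N'"
proof -
  let ?z = "\<lambda>j\<in>{..<n}. F j"
  have z: "?z \<in> carrier Gr" using E_zero E_carrier by blast
  obtain y where y: "y \<in> N" "\<eta> ?z = coset P N' y" by (rule \<eta>_coset[OF z])
  \<comment> \<open>Writing the zero vector as a multiple by the zero scalar reduces the claim to
    compatibility of \<open>\<eta>\<close> with scalars.\<close>
  have "\<zero>\<^bsub>K\<^esub> \<odot>\<^bsub>Gr\<^esub> ?z = ?z"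
  proof
    fix j show "(\<zero>\<^bsub>K\<^esub> \<odot>\<^bsub>Gr\<^esub> ?z) j = ?z j"
      using quot_smult[of j "\<zero>\<^bsub>V\<^esub>" "\<zero>\<^bsub>K\<^esub>"] by (simp add: Gr_smult coset_F_zero)
  qed
  then have "\<eta> ?z = coset P N' (\<zero>\<^bsub>K\<^esub> \<odot>\<^bsub>P\<^esub> y)"
    using \<eta>_smult[OF z y(2,1), of "\<zero>\<^bsub>K\<^esub>"] by simp
  also have "\<dots> = N'" using y N_car by (simp add: P.coset_zero[OF N'_sub])
  finally show ?thesis .
qed

lemma Npre_0: "Npre 0 = N'"
proof -
  have "E 0 = {\<lambda>j\<in>{..<n}. F j}"
  proof (intro equalityI subsetI)
    fix x assume "x \<in> E 0"
    then have "x \<in> extensional {..<n}" "\<forall>j<n. x j = F j"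
      unfolding E_def carrier_Gr by (auto simp: PiE_def)
    then show "x \<in> {\<lambda>j\<in>{..<n}. F j}" by (auto simp: fun_eq_iff extensional_def restrict_def)
  qed (use E_zero in auto)
  then have "y \<in> Npre 0 \<longleftrightarrow> y \<in> N \<and> coset P N' y = N'" for y
    unfolding Npre_def using \<eta>_zero by auto
  then show ?thesis
    using N'_le N_car P.coset_eq_self_iff[OF N'_sub] by blast
qed

lemma Npre_n: "Npre n = N"
proof -
  have "E n = carrier Gr" by (auto simp: E_def)
  moreover have "\<exists>x\<in>carrier Gr. \<eta> x = coset P N' y" if "y \<in> N" for y
  proof -
    have "coset P N' y \<in> \<eta> ` carrier Gr"
      using that unfolding bij_betw_imp_surj_on[OF \<eta>_bij] carrier_quot_module by blast
    then show ?thesis by force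
  qed
  ultimately show ?thesis unfolding Npre_def by auto
qed

lemma Npre_submodule: "submod K (Npre i) P"
proof
  show "Npre i \<subseteq> carrier P" using N_car by (auto simp: Npre_def)
  have "\<eta> (\<lambda>j\<in>{..<n}. F j) = coset P N' \<zero>\<^bsub>P\<^esub>" by (simp only: \<eta>_zero P.coset_zero[OF N'_sub])
  then show "\<zero>\<^bsub>P\<^esub> \<in> Npre i"
    using E_zero submod_zero[OF N_sub] unfolding Npre_def by blast
next
  fix y y' assume "y \<in> Npre i" "y' \<in> Npre i"
  then obtain x x' where *: "y \<in> N" "x \<in> E i" "\<eta> x = coset P N' y"
    "y' \<in> N" "x' \<in> E i" "\<eta> x' = coset P N' y'" unfolding Npre_def by blast
  have "\<eta> (x \<oplus>\<^bsub>Gr\<^esub> x') = coset P N' (y \<oplus>\<^bsub>P\<^esub> y')"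
    by (rule \<eta>_add) (use * E_carrier in auto)
  then show "y \<oplus>\<^bsub>P\<^esub> y' \<in> Npre i"
    using E_add[OF *(2,5)] submod_add[OF N_sub *(1,4)]
    unfolding Npre_def by blast
next
  fix c y assume c: "c \<in> carrier K" and "y \<in> Npre i"
  then obtain x where *: "y \<in> N" "x \<in> E i" "\<eta> x = coset P N' y" unfolding Npre_def by blast
  have "\<eta> (c \<odot>\<^bsub>Gr\<^esub> x) = coset P N' (c \<odot>\<^bsub>P\<^esub> y)"
    by (rule \<eta>_smult) (use * c E_carrier in auto)
  then show "c \<odot>\<^bsub>P\<^esub> y \<in> Npre i"
    using E_smult[OF *(2) c] submod_smult[OF N_sub c *(1)]
    unfolding Npre_def by blast
qed

lemma Npre_mono: "i \<le> j \<Longrightarrow> Npre i \<subseteq> Npre j"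
  using E_mono[of i j] unfolding Npre_def by blast

text \<open>Two vectors are related when the class of \<open>y\<close> is the image of a graded
  vector in \<open>E (Suc i)\<close> whose last component is the class of \<open>z\<close>. The
  relation descends to an isomorphism of \<open>Npre (Suc i) / Npre i\<close> with
  \<open>F (Suc i) / F i\<close>.\<close>

lemma step_relation:
  assumes i: "i < n"
  shows "quotient_relation K V P (F i) (F (Suc i)) (Npre i) (Npre (Suc i))
    (\<lambda>y z. y \<in> N \<and> z \<in> F (Suc i) \<and> (\<exists>x\<in>E (Suc i). \<eta> x = coset P N' y \<and> x i = coset V (F i) z))"
    (is "quotient_relation K V P _ _ _ _ ?R")
proof (intro quotient_relation.intro quotient_relation_axioms.intro)
  show "vectorspace K V" "vectorspace K P" by (rule V.vectorspace_axioms P.vectorspace_axioms)+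
  show "submod K (F i) V" "submod K (F (Suc i)) V"
    using i F_sub by auto
  show "F i \<subseteq> F (Suc i)" by (rule F_mono[OF i])
  show "submod K (Npre i) P" "submod K (Npre (Suc i)) P"
    by (rule Npre_submodule)+
  have Fi: "submod K (F i) V" using i F_sub by auto
  have car: "z \<in> carrier V" if "z \<in> F (Suc i)" for z using F_car[of "Suc i"] i that by simp
  show "y \<in> Npre (Suc i)" if "?R y z" for y z using that unfolding Npre_def by blast
  show "z \<in> F (Suc i)" if "?R y z" for y z using that by blast
  show "\<exists>z. ?R y z" if y: "y \<in> Npre (Suc i)" for y
  proof -
    obtain x where x: "y \<in> N" "x \<in> E (Suc i)" "\<eta> x = coset P N' y" using y unfolding Npre_def by blast
    obtain z where "z \<in> F (Suc i)" "x i = coset V (F i) z" by (rule E_Suc_coset[OF E_carrier[OF x(2)] i])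
    then show ?thesis using x by blast
  qed
  show "\<exists>y. ?R y z" if z: "z \<in> F (Suc i)" for z
  proof -
    \<comment> \<open>The graded vector with the class of \<open>z\<close> in place \<open>i\<close>
      and zero classes elsewhere.\<close>
    let ?x = "\<lambda>j\<in>{..<n}. if j = i then coset V (F i) z else F j"
    have "F j \<in> coset V (F j) ` F (Suc j)" if "j < n" for j
      using that coset_F_zero submod_zero[OF F_sub[of "Suc j"]]
      by (metis Suc_leI image_eqI)
    then have x: "?x \<in> E (Suc i)" using z unfolding E_def carrier_Gr by auto
    obtain y where "y \<in> N" "\<eta> ?x = coset P N' y" by (rule \<eta>_coset[OF E_carrier[OF x]])
    moreover have "?x i = coset V (F i) z" using i by simp
    ultimately show ?thesis using x z by blast
  qed
  show "?R (y \<oplus>\<^bsub>P\<^esub> y') (z \<oplus>\<^bsub>V\<^esub> z')" if R: "?R y z" and R': "?R y' z'" for y z y' z'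
  proof -
    obtain x x' where x: "x \<in> E (Suc i)" "\<eta> x = coset P N' y" "x i = coset V (F i) z"
      "x' \<in> E (Suc i)" "\<eta> x' = coset P N' y'" "x' i = coset V (F i) z'"
      using R R' by blast
    have "x \<oplus>\<^bsub>Gr\<^esub> x' \<in> E (Suc i)" by (rule E_add[OF x(1,4)])
    moreover have "\<eta> (x \<oplus>\<^bsub>Gr\<^esub> x') = coset P N' (y \<oplus>\<^bsub>P\<^esub> y')"
      by (rule \<eta>_add) (use x R R' E_carrier in auto)
    moreover have "(x \<oplus>\<^bsub>Gr\<^esub> x') i = coset V (F i) (z \<oplus>\<^bsub>V\<^esub> z')"
      using i x(3,6) quot_add[OF i] R R' car by (simp add: Gr_add)
    moreover have "y \<oplus>\<^bsub>P\<^esub> y' \<in> N" "z \<oplus>\<^bsub>V\<^esub> z' \<in> F (Suc i)"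
      using R R' i submod_add[OF N_sub]
        submod_add[OF F_sub[of "Suc i"]] by auto
    ultimately show ?thesis by blast
  qed
  show "?R (c \<odot>\<^bsub>P\<^esub> y) (c \<odot>\<^bsub>V\<^esub> z)" if c: "c \<in> carrier K" and R: "?R y z" for c y z
  proof -
    obtain x where x: "x \<in> E (Suc i)" "\<eta> x = coset P N' y" "x i = coset V (F i) z"
      using R by blast
    have "c \<odot>\<^bsub>Gr\<^esub> x \<in> E (Suc i)" by (rule E_smult[OF x(1) c])
    moreover have "\<eta> (c \<odot>\<^bsub>Gr\<^esub> x) = coset P N' (c \<odot>\<^bsub>P\<^esub> y)"
      by (rule \<eta>_smult) (use x R c E_carrier in auto)
    moreover have "(c \<odot>\<^bsub>Gr\<^esub> x) i = coset V (F i) (c \<odot>\<^bsub>V\<^esub> z)"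
      using i x(3) quot_smult[OF i] R car c by (simp add: Gr_smult)
    moreover have "c \<odot>\<^bsub>P\<^esub> y \<in> N" "c \<odot>\<^bsub>V\<^esub> z \<in> F (Suc i)"
      using R i c submod_smult[OF N_sub]
        submod_smult[OF F_sub[of "Suc i"]] by auto
    ultimately show ?thesis by blast
  qed
  show "y \<in> Npre i \<longleftrightarrow> z \<in> F i" if R: "?R y z" for y z
  proof -
    obtain x where x: "x \<in> E (Suc i)" "\<eta> x = coset P N' y" "x i = coset V (F i) z"
      using R by blast
    have z: "x i = F i \<longleftrightarrow> z \<in> F i" using x(3) V.coset_eq_self_iff[OF Fi] R car by simp
    show ?thesis
    proof
      assume "y \<in> Npre i"
      then obtain x' where x': "x' \<in> E i" "\<eta> x' = coset P N' y" unfolding Npre_def by blast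
      \<comment> \<open>By injectivity of \<open>\<eta>\<close> the graded vector behind
        \<open>y\<close> is unique; lying in \<open>E i\<close>, it has zero component at
        \<open>i\<close>.\<close>
      have "x' = x"
        using inj_onD[OF bij_betw_imp_inj_on[OF \<eta>_bij] _ E_carrier[OF x'(1)] E_carrier[OF x(1)]]
          x(2) x'(2) by simp
      then have "x i = F i" using x'(1) i by (auto simp: E_def)
      then show "z \<in> F i" using z by simp
    next
      assume "z \<in> F i"
      then have "x \<in> E i" using E_SucD[OF x(1)] z by simp
      then show "y \<in> Npre i" using R x(2) unfolding Npre_def by blast
    qed
  qed
  show "?R y z" if y: "y \<in> Npre i" and z: "z \<in> F i" for y z
  proof -
    obtain x where x: "y \<in> N" "x \<in> E i" "\<eta> x = coset P N' y" using y unfolding Npre_def by blast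
    have zF: "z \<in> F (Suc i)" using F_mono[OF i] z by blast
    have "x i = coset V (F i) z"
      using x(2) i z V.coset_eq_self_iff[OF Fi car[OF zF]] by (simp add: E_def)
    then show ?thesis using x zF E_mono[of i "Suc i"] by auto
  qed
qed

text \<open>The counts for the single steps telescope along the chain \<open>Npre\<close>. Leading
  sets grow along the chain, so the differences of natural numbers are genuine.\<close>

theorem dim_eq_leading:
  assumes "finite B" "v ` B \<subseteq> carrier P" "inj_on \<kappa> B" "P.span (v ` B) = carrier P"
  shows "V.fin_dim" "V.dim = card (leading K P v \<kappa> B N) - card (leading K P v \<kappa> B N')"
proof -
  let ?L = "\<lambda>i. leading K P v \<kappa> B (Npre i)"
  have fin: "finite (?L i)" for i by (rule finite_subset[OF leading_subset assms(1)])
  have "V.has_dim (F i) (card (?L i) - card (?L 0))" if "i \<le> n" for i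
    using that
  proof (induction i)
    case 0
    show ?case by (simp add: F_zero V.has_dim_zero)
  next
    case (Suc i)
    then have i: "i < n" by simp
    have "Npre (Suc i) \<subseteq> P.span (v ` B)"
      unfolding assms(4) by (rule submod_subset[OF Npre_submodule])
    from quotient_relation.has_dim_by_leading[OF step_relation[OF i] assms(1-3) this Suc.IH]
    have "V.has_dim (F (Suc i)) (card (?L i) - card (?L 0) + card (?L (Suc i) - ?L i))"
      using Suc.prems by simp
    moreover have "?L 0 \<subseteq> ?L i" "?L i \<subseteq> ?L (Suc i)"
      by (intro leading_mono Npre_mono; simp)+
    then have "card (?L 0) \<le> card (?L i)" "card (?L (Suc i) - ?L i) = card (?L (Suc i)) - card (?L i)"
      "card (?L i) \<le> card (?L (Suc i))"
      using fin by (auto intro: card_mono card_Diff_subset)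
    ultimately show ?case by simp
  qed
  from this[of n] have "V.has_dim (carrier V) (card (leading K P v \<kappa> B N) - card (leading K P v \<kappa> B N'))"
    by (simp add: F_top Npre_n Npre_0)
  from V.has_dim_carrierD[OF this]
  show "V.fin_dim" "V.dim = card (leading K P v \<kappa> B N) - card (leading K P v \<kappa> B N')" .
qed

end

section \<open>The first homology of a graph\<close>

lemma vector_space_rat_fun: "vector_space (\<lambda>(q::rat) (c :: 'd \<Rightarrow> rat) d. q * c d)"
  by unfold_locales (auto simp: fun_eq_iff algebra_simps)

interpretation rat_fun: vector_space "\<lambda>(q::rat) (c :: 'd \<Rightarrow> rat) d. q * c d"
  by (rule vector_space_rat_fun)

lemma H1_subspace: "rat_fun.subspace (H1 G)"
  unfolding rat_fun.subspace_def H1_def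
  by (auto simp: sum.distrib sum_distrib_left[symmetric])

lemma H1_span:
  assumes "finite (darts G)"
  shows "H1 G \<subseteq> rat_fun.span ((\<lambda>d d'. if d' = d then 1 else 0) ` darts G)"
proof
  fix c assume c: "c \<in> H1 G"
  let ?e = "\<lambda>d d'. if d' = d then 1 else 0 :: rat"
  have "c = (\<Sum>d\<in>darts G. (\<lambda>d'. c d * ?e d d'))"
  proof
    fix x
    have "(\<Sum>d\<in>D. (\<lambda>d'. c d * ?e d d')) x = (\<Sum>d\<in>D. c d * ?e d x)" for D
      by (induction D rule: infinite_finite_induct) auto
    then have "(\<Sum>d\<in>darts G. (\<lambda>d'. c d * ?e d d')) x = (\<Sum>d\<in>darts G. c d * ?e d x)" .
    also have "\<dots> = c x"
    proof (cases "x \<in> darts G")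
      case True
      then show ?thesis using assms by (simp add: sum.delta' if_distrib[of "(*) _"] cong: if_cong)
    next
      case False
      then have "c x = 0" using c by (simp add: H1_def)
      with False show ?thesis by (auto intro!: sum.neutral)
    qed
    finally show "c x = (\<Sum>d\<in>darts G. (\<lambda>d'. c d * ?e d d')) x" by simp
  qed
  moreover have "(\<Sum>d\<in>darts G. (\<lambda>d'. c d * ?e d d')) \<in> rat_fun.span (?e ` darts G)"
    by (intro rat_fun.span_sum rat_fun.span_scale rat_fun.span_base) auto
  ultimately show "c \<in> rat_fun.span (?e ` darts G)" by simp
qed

lemma H1_basis:
  assumes "finite (darts G)"
  obtains B where "B \<subseteq> H1 G" "rat_fun.independent B" "H1 G \<subseteq> rat_fun.span B" "finite B" "card B = genus G"
proof -
  obtain B where B: "B \<subseteq> H1 G" "rat_fun.independent B" "H1 G \<subseteq> rat_fun.span B" "card B = genus G"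
    using rat_fun.basis_exists[of "H1 G"] unfolding genus_def by blast
  have "B \<subseteq> rat_fun.span ((\<lambda>d d'. if d' = d then 1 else 0) ` darts G)"
    using B(1) H1_span[OF assms] by blast
  then have "finite B" using rat_fun.independent_span_bound B(2) assms by blast
  with B that show thesis by blast
qed

lemma genus_eq_0_iff:
  assumes "finite (darts G)"
  shows "genus G = 0 \<longleftrightarrow> (\<forall>c\<in>H1 G. \<forall>d. c d = 0)"
proof
  assume "genus G = 0"
  then obtain B where "H1 G \<subseteq> rat_fun.span B" "finite B" "card B = 0"
    using H1_basis[OF assms] by metis
  then have "H1 G \<subseteq> {0}" by simp
  then show "\<forall>c\<in>H1 G. \<forall>d. c d = 0" by (auto simp: fun_eq_iff)
next
  assume "\<forall>c\<in>H1 G. \<forall>d. c d = 0"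
  then have "H1 G \<subseteq> rat_fun.span {}" by (auto simp: fun_eq_iff)
  then show "genus G = 0"
    using rat_fun.dim_le_card[of "H1 G" "{}"] unfolding genus_def by simp
qed

text \<open>The map is linear on all chains but has to be injective only on cycles. Applied in both
  directions, this yields invariance of the genus without matching bases.\<close>

lemma genus_le_genus:
  fixes T :: "('d \<Rightarrow> rat) \<Rightarrow> ('e \<Rightarrow> rat)"
  assumes "finite (darts G)" "finite (darts G')"
    and add: "\<And>c c'. T (c + c') = T c + T c'"
    and scale: "\<And>q c. T (\<lambda>d. q * c d) = (\<lambda>d. q * T c d)"
    and H1: "\<And>c. c \<in> H1 G \<Longrightarrow> T c \<in> H1 G'"
    and inj: "\<And>c. c \<in> H1 G \<Longrightarrow> T c = 0 \<Longrightarrow> c = 0"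
  shows "genus G \<le> genus G'"
proof -
  obtain B where B: "B \<subseteq> H1 G" "rat_fun.independent B" "H1 G \<subseteq> rat_fun.span B" "finite B" "card B = genus G"
    by (rule H1_basis[OF assms(1)])
  obtain B' where B': "H1 G' \<subseteq> rat_fun.span B'" "finite B'" "card B' = genus G'"
    by (rule H1_basis[OF assms(2)])
  interpret p: vector_space_pair "\<lambda>(q::rat) (c :: 'd \<Rightarrow> rat) d. q * c d" "\<lambda>(q::rat) (c :: 'e \<Rightarrow> rat) d. q * c d"
    by unfold_locales
  have lin: "Vector_Spaces.linear (\<lambda>q c d. q * c d) (\<lambda>q c d. q * c d) T"
    by unfold_locales (auto simp: add scale)
  have sp: "rat_fun.span B \<subseteq> H1 G"
    by (rule rat_fun.span_minimal[OF B(1) H1_subspace])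
  have inj': "inj_on T (rat_fun.span B)"
  proof (rule inj_onI)
    fix c c' assume c: "c \<in> rat_fun.span B" "c' \<in> rat_fun.span B" "T c = T c'"
    have "c - c' \<in> H1 G" using c(1,2) sp rat_fun.span_diff by blast
    moreover have "T (c - c') = 0" using p.linear_diff[OF lin, of c c'] c(3) by simp
    ultimately show "c = c'" using inj by fastforce
  qed
  have "rat_fun.independent (T ` B)"
    by (rule p.linear_independent_injective_image[OF lin B(2) inj'])
  moreover have "T ` B \<subseteq> rat_fun.span B'" using B(1) H1 B'(1) by blast
  ultimately have "card (T ` B) \<le> card B'"
    using rat_fun.independent_span_bound[OF B'(2)] by blast
  moreover have "inj_on T B" using inj' rat_fun.span_superset inj_on_subset by blast
  ultimately show ?thesis using B(5) B'(3) by (simp add: card_image)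
qed

section \<open>Contractions compose\<close>

lemma vertex_fiber_simps [simp]:
  "verts (vertex_fiber G \<phi> w) = {v \<in> verts G. \<phi> (Inl v) = Inl w}"
  "darts (vertex_fiber G \<phi> w) = {d \<in> darts G. \<phi> (Inr d) = Inl w}"
  "tail (vertex_fiber G \<phi> w) = tail G" "opp (vertex_fiber G \<phi> w) = opp G"
  "head (vertex_fiber G \<phi> w) = head G"
  by (auto simp: vertex_fiber_def head_def fun_eq_iff)

lemma Inl_in_cells [simp]: "Inl v \<in> cells G \<longleftrightarrow> v \<in> verts G"
  and Inr_in_cells [simp]: "Inr d \<in> cells G \<longleftrightarrow> d \<in> darts G"
  by (auto simp: cells_def)

lemma cells_cases:
  assumes "x \<in> cells G"
  obtains v where "x = Inl v" "v \<in> verts G" | d where "x = Inr d" "d \<in> darts G"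
  using assms by (auto simp: cells_def)

lemma wf_graphD:
  assumes "wf_graph G" "d \<in> darts G"
  shows "tail G d \<in> verts G" "opp G d \<in> darts G" "opp G d \<noteq> d" "opp G (opp G d) = d"
    "head G d \<in> verts G" "head G (opp G d) = tail G d"
  using assms unfolding wf_graph_def head_def by auto

lemma wf_graph_finite: "wf_graph G \<Longrightarrow> finite (verts G)" "wf_graph G \<Longrightarrow> finite (darts G)"
  by (auto simp: wf_graph_def)

lemma finite_cells: "wf_graph G \<Longrightarrow> finite (cells G)"
  by (simp add: cells_def wf_graph_def)

lemma graph_morphism_vertex:
  assumes "graph_morphism G G' \<phi>" "v \<in> verts G"
  obtains w where "w \<in> verts G'" "\<phi> (Inl v) = Inl w"
proof -
  have "\<phi> (Inl v) \<in> cells G'" "\<phi> (Inl v) = cell_tail G' (\<phi> (Inl v))"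
    using assms unfolding graph_morphism_def by (auto simp: cell_tail_def Pi_def dest!: bspec[of _ _ "Inl v"])
  then show thesis using that by (cases "\<phi> (Inl v)") (auto simp: cell_tail_def)
qed

lemma graph_morphism_dart:
  assumes "graph_morphism G G' \<phi>" "wf_graph G" "d \<in> darts G"
  obtains (vertex) w where "w \<in> verts G'" "\<phi> (Inr d) = Inl w" "\<phi> (Inr (opp G d)) = Inl w"
      "\<phi> (Inl (tail G d)) = Inl w" "\<phi> (Inl (head G d)) = Inl w"
    | (dart) d' where "d' \<in> darts G'" "\<phi> (Inr d) = Inr d'" "\<phi> (Inr (opp G d)) = Inr (opp G' d')"
      "\<phi> (Inl (tail G d)) = Inl (tail G' d')" "\<phi> (Inl (head G d)) = Inl (head G' d')"
proof -
  have o: "opp G d \<in> darts G" using wf_graphD(2)[OF assms(2,3)] .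
  have m: "\<phi> (cell_tail G x) = cell_tail G' (\<phi> x)" "\<phi> (cell_opp G x) = cell_opp G' (\<phi> x)"
    "\<phi> x \<in> cells G'" if "x \<in> cells G" for x
    using assms(1) that unfolding graph_morphism_def by auto
  have d: "\<phi> (Inl (tail G d)) = cell_tail G' (\<phi> (Inr d))" "\<phi> (Inr (opp G d)) = cell_opp G' (\<phi> (Inr d))"
    "\<phi> (Inr d) \<in> cells G'" "\<phi> (Inl (head G d)) = cell_tail G' (\<phi> (Inr (opp G d)))"
    using m[of "Inr d"] m[of "Inr (opp G d)"] assms(3) o by (auto simp: cell_tail_def cell_opp_def head_def)
  show thesis
  proof (cases "\<phi> (Inr d)")
    case (Inl w)
    then show ?thesis using d vertex by (simp add: cell_tail_def cell_opp_def)
  next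
    case (Inr d')
    then show ?thesis using d dart by (simp add: cell_tail_def cell_opp_def head_def)
  qed
qed

lemma wf_vertex_fiber:
  assumes "graph_morphism G G' \<phi>" "wf_graph G"
  shows "wf_graph (vertex_fiber G \<phi> w)"
  unfolding wf_graph_def
proof (intro conjI ballI)
  fix d assume d: "d \<in> darts (vertex_fiber G \<phi> w)"
  then have d': "d \<in> darts G" "\<phi> (Inr d) = Inl w" by auto
  note wf = wf_graphD[OF assms(2) d'(1)]
  from assms d'(1) show "tail (vertex_fiber G \<phi> w) d \<in> verts (vertex_fiber G \<phi> w)"
    by (rule graph_morphism_dart) (use d' wf in auto)
  from assms d'(1) show "opp (vertex_fiber G \<phi> w) d \<in> darts (vertex_fiber G \<phi> w)"
    by (rule graph_morphism_dart) (use d' wf in auto)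
  show "opp (vertex_fiber G \<phi> w) d \<noteq> d" "opp (vertex_fiber G \<phi> w) (opp (vertex_fiber G \<phi> w) d) = d"
    using wf by auto
qed (use assms(2) in \<open>auto simp: wf_graph_def\<close>)

abbreviation adj :: "('v, 'd) graph \<Rightarrow> ('v \<times> 'v) set" where
  "adj G \<equiv> {(tail G d, head G d) |d. d \<in> darts G}"

lemma sum_antisymmetric:
  fixes c :: "'d \<Rightarrow> rat"
  assumes "\<And>d. d \<in> D \<Longrightarrow> o' d \<in> D" "\<And>d. d \<in> D \<Longrightarrow> o' (o' d) = d" "\<And>d. d \<in> D \<Longrightarrow> c (o' d) = - c d"
  shows "(\<Sum>d\<in>D. c d) = 0"
proof -
  have "(\<Sum>d\<in>D. c d) = (\<Sum>d\<in>D. c (o' d))"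
    by (rule sum.reindex_bij_witness[of _ o' o']) (use assms in auto)
  also have "\<dots> = - (\<Sum>d\<in>D. c d)" using assms(3) by (simp add: sum_negf)
  finally show ?thesis by simp
qed

lemma graph_morphism_compose:
  assumes "graph_morphism G G' \<phi>" "graph_morphism G' G'' \<psi>" "wf_graph G"
  shows "graph_morphism G G'' (compose (cells G) \<psi> \<phi>)"
proof -
  have "cell_tail G x \<in> cells G" "cell_opp G x \<in> cells G" if "x \<in> cells G" for x
    using that wf_graphD[OF assms(3)] by (auto simp: cell_tail_def cell_opp_def elim!: cells_cases)
  then show ?thesis
    using assms(1,2) unfolding graph_morphism_def by (auto simp: compose_def)
qed

context
  fixes G :: "('v, 'd) graph" and G' :: "('w, 'e) graph" and G'' :: "('x, 'f) graph" and \<phi> \<psi>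
  assumes \<phi>: "contraction G G' \<phi>" and \<psi>: "contraction G' G'' \<psi>"
    and wf: "wf_graph G" and wf': "wf_graph G'"
begin

private lemma \<phi>m: "graph_morphism G G' \<phi>" and \<psi>m: "graph_morphism G' G'' \<psi>"
  using \<phi> \<psi> by (auto simp: contraction_def)

private abbreviation "\<chi> \<equiv> compose (cells G) \<psi> \<phi>"

private lemma \<chi>_Inl: "v \<in> verts G \<Longrightarrow> \<chi> (Inl v) = \<psi> (\<phi> (Inl v))"
  and \<chi>_Inr: "d \<in> darts G \<Longrightarrow> \<chi> (Inr d) = \<psi> (\<phi> (Inr d))"
  by (auto simp: compose_def)

private lemma fiber_tree: "y \<in> verts G' \<Longrightarrow> graph_of_genus 0 (vertex_fiber G \<phi> y)"
  and fiber_tree': "w \<in> verts G'' \<Longrightarrow> graph_of_genus 0 (vertex_fiber G' \<psi> w)"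
  using \<phi> \<psi> by (auto simp: contraction_def)

private lemma unique_lift: "d' \<in> darts G' \<Longrightarrow> \<exists>!d. d \<in> darts G \<and> \<phi> (Inr d) = Inr d'"
  using \<phi> by (auto simp: contraction_def)

text \<open>A walk in the fiber of \<open>\<psi>\<close> is lifted edge by edge, every dart having a
  lift; the ends of consecutive lifts are joined inside the connected fibers of
  \<open>\<phi>\<close>.\<close>

private lemma compose_fiber_connected:
  assumes w: "w \<in> verts G''"
  shows "connected_graph (vertex_fiber G \<chi> w)"
proof -
  let ?F = "vertex_fiber G \<chi> w" and ?F' = "vertex_fiber G' \<psi> w"
  have inner: "(u, v) \<in> (adj ?F)\<^sup>*"
    if u: "u \<in> verts G" "\<phi> (Inl u) = Inl x" and v: "v \<in> verts G" "\<phi> (Inl v) = Inl x"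
      and x: "x \<in> verts ?F'" for u v x
  proof -
    have "connected_graph (vertex_fiber G \<phi> x)"
      using fiber_tree x by (simp add: graph_of_genus_def)
    then have "(u, v) \<in> (adj (vertex_fiber G \<phi> x))\<^sup>*"
      using u v unfolding connected_graph_def by auto
    moreover have "adj (vertex_fiber G \<phi> x) \<subseteq> adj ?F"
      using x by (auto simp: \<chi>_Inr)
    ultimately show ?thesis using rtrancl_mono by blast
  qed
  have lift: "(x, y) \<in> (adj ?F')\<^sup>* \<Longrightarrow> x \<in> verts ?F' \<Longrightarrow> y \<in> verts ?F' \<and>
      (\<forall>u\<in>verts G. \<forall>v\<in>verts G. \<phi> (Inl u) = Inl x \<longrightarrow> \<phi> (Inl v) = Inl y \<longrightarrow> (u, v) \<in> (adj ?F)\<^sup>*)" for x y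
  proof (induction rule: rtrancl_induct)
    case base
    then show ?case using inner by blast
  next
    case (step y z)
    then obtain d' where d': "d' \<in> darts G'" "\<psi> (Inr d') = Inl w" "y = tail G' d'" "z = head G' d'" by auto
    have z: "z \<in> verts ?F'"
      using \<psi>m wf' d'(1) by (rule graph_morphism_dart) (use d' wf_graphD[OF wf' d'(1)] in auto)
    obtain d where d: "d \<in> darts G" "\<phi> (Inr d) = Inr d'" using unique_lift[OF d'(1)] by blast
    have t: "\<phi> (Inl (tail G d)) = Inl y" "\<phi> (Inl (head G d)) = Inl z"
      using \<phi>m wf d(1) by (rule graph_morphism_dart; use d d' in auto)+
    have "(u, v) \<in> (adj ?F)\<^sup>*"
      if u: "u \<in> verts G" "\<phi> (Inl u) = Inl x" and v: "v \<in> verts G" "\<phi> (Inl v) = Inl z" for u v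
    proof -
      have "(u, tail G d) \<in> (adj ?F)\<^sup>*"
        using step.IH[OF step.prems] u t(1) wf_graphD[OF wf d(1)] by blast
      also have "(tail G d, head G d) \<in> adj ?F"
        using d d'(2) by (auto simp: \<chi>_Inr)
      also have "(head G d, v) \<in> (adj ?F)\<^sup>*"
        by (rule inner[OF _ t(2) v z]) (use wf_graphD[OF wf d(1)] in auto)
      finally show ?thesis .
    qed
    with z show ?case by blast
  qed
  have "connected_graph ?F'" using fiber_tree'[OF w] by (simp add: graph_of_genus_def)
  show ?thesis
    unfolding connected_graph_def
  proof (intro ballI)
    fix u v assume uv: "u \<in> verts ?F" "v \<in> verts ?F"
    obtain x where x: "x \<in> verts G'" "\<phi> (Inl u) = Inl x" by (rule graph_morphism_vertex[OF \<phi>m, of u]) (use uv in auto)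
    obtain y where y: "y \<in> verts G'" "\<phi> (Inl v) = Inl y" by (rule graph_morphism_vertex[OF \<phi>m, of v]) (use uv in auto)
    have xy: "x \<in> verts ?F'" "y \<in> verts ?F'" using x y uv by (auto simp: \<chi>_Inl)
    then have "(x, y) \<in> (adj ?F')\<^sup>*" using \<open>connected_graph ?F'\<close> unfolding connected_graph_def by blast
    from lift[OF this xy(1)] show "(u, v) \<in> (adj ?F)\<^sup>*" using x y uv by auto
  qed
qed

text \<open>The values of a cycle on the darts not collapsed by \<open>\<phi>\<close> form a cycle
  in the fiber of \<open>\<psi>\<close>, a tree, and hence vanish. What is left lives on the fibers
  of \<open>\<phi>\<close>, which are trees as well.\<close>

private lemma compose_fiber_acyclic:
  assumes w: "w \<in> verts G''" and c: "c \<in> H1 (vertex_fiber G \<chi> w)"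
  shows "c d = 0"
proof -
  let ?F = "vertex_fiber G \<chi> w" and ?F' = "vertex_fiber G' \<psi> w"
  define L where "L d' = (THE d. d \<in> darts G \<and> \<phi> (Inr d) = Inr d')" for d'
  have L: "L d' \<in> darts G" "\<phi> (Inr (L d')) = Inr d'" if "d' \<in> darts G'" for d'
    using theI'[OF unique_lift[OF that]] by (auto simp: L_def)
  have L_eq: "L d' = d" if "d \<in> darts G" "\<phi> (Inr d) = Inr d'" "d' \<in> darts G'" for d d'
    using unique_lift[OF that(3)] L[OF that(3)] that by blast
  have wfF: "wf_graph ?F" by (rule wf_vertex_fiber[OF graph_morphism_compose[OF \<phi>m \<psi>m wf] wf])
  have fin: "finite (darts ?F)" "finite (darts G)" "finite (verts G)"
    using wf_graph_finite[OF wf] wf_graph_finite[OF wfF] by auto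
  have c_out: "c d = 0" if "d \<notin> darts ?F" for d using c that unfolding H1_def by blast
  have c_opp: "c (opp G d) = - c d" if "d \<in> darts ?F" for d using c that unfolding H1_def by auto
  have c_sum: "(\<Sum>d | d \<in> darts ?F \<and> tail G d = v. c d) = 0" if "v \<in> verts ?F" for v
    using c that unfolding H1_def by auto
  have dF: "d \<in> darts ?F \<longleftrightarrow> d \<in> darts G \<and> \<psi> (\<phi> (Inr d)) = Inl w" for d
    by (auto simp: \<chi>_Inr)
  define c' where "c' d' = (if d' \<in> darts ?F' then c (L d') else 0)" for d'
  have "c' \<in> H1 ?F'"
    unfolding H1_def
  proof (intro CollectI conjI allI ballI impI)
    fix d' assume "d' \<notin> darts ?F'"
    then show "c' d' = 0" by (simp only: c'_def if_False)
  next
    fix d' assume d': "d' \<in> darts ?F'"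
    then have d'G: "d' \<in> darts G'" by simp
    have o: "opp G' d' \<in> darts ?F'"
      using wf_graphD(2)[OF wf_vertex_fiber[OF \<psi>m wf'] d'] by simp
    have "\<phi> (Inr (opp G (L d'))) = Inr (opp G' d')"
      using \<phi>m wf L(1)[OF d'G] by (rule graph_morphism_dart) (use L(2)[OF d'G] in auto)
    then have "L (opp G' d') = opp G (L d')"
      using L_eq wf_graphD[OF wf L(1)[OF d'G]] wf_graphD[OF wf' d'G] by blast
    moreover have "L d' \<in> darts ?F" using L[OF d'G] d' by (simp only: dF) simp
    ultimately show "c' (opp ?F' d') = - c' d'"
      using d' o c_opp[of "L d'"] by (simp only: c'_def vertex_fiber_simps(4) if_True)
  next
    fix y assume y: "y \<in> verts ?F'"
    \<comment> \<open>\<open>?A\<close> consists of the darts starting in the preimage of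
      \<open>y\<close>, \<open>?C\<close> of those collapsed into \<open>y\<close>. The boundary of
      \<open>c'\<close> at \<open>y\<close> is the sum over \<open>?A - ?C\<close>; the part over
      \<open>?C\<close> cancels in opposite pairs, and the sum over \<open>?A\<close> is a sum of
      boundaries of \<open>c\<close>.\<close>
    let ?A = "{d \<in> darts ?F. \<phi> (Inl (tail G d)) = Inl y}"
    let ?C = "{d \<in> darts ?F. \<phi> (Inr d) = Inl y}"
    have sub: "?C \<subseteq> ?A"
    proof
      fix d assume d: "d \<in> ?C"
      then have "d \<in> darts G" by simp
      with \<phi>m wf have "\<phi> (Inl (tail G d)) = Inl y" by (rule graph_morphism_dart) (use d in auto)
      with d show "d \<in> ?A" by simp
    qed
    have "(\<Sum>d' | d' \<in> darts ?F' \<and> tail ?F' d' = y. c' d') = (\<Sum>d\<in>?A - ?C. c d)"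
    proof (rule sum.reindex_bij_witness[of _ "\<lambda>d. projr (\<phi> (Inr d))" L])
      fix d' assume "d' \<in> {d' \<in> darts ?F'. tail ?F' d' = y}"
      then have d': "d' \<in> darts G'" "\<psi> (Inr d') = Inl w" "tail G' d' = y" by auto
      show "projr (\<phi> (Inr (L d'))) = d'" using L[OF d'(1)] by simp
      have "\<phi> (Inl (tail G (L d'))) = Inl y"
        using \<phi>m wf L(1)[OF d'(1)] by (rule graph_morphism_dart) (use L(2)[OF d'(1)] d' in auto)
      then show "L d' \<in> ?A - ?C" using L[OF d'(1)] d' by (auto simp: \<chi>_Inr)
      show "c (L d') = c' d'" using d' by (simp add: c'_def)
    next
      fix d assume "d \<in> ?A - ?C"
      then have d: "d \<in> darts G" "\<psi> (\<phi> (Inr d)) = Inl w" "\<phi> (Inl (tail G d)) = Inl y" "\<phi> (Inr d) \<noteq> Inl y"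
        by (auto simp: \<chi>_Inr)
      obtain d' where d': "d' \<in> darts G'" "\<phi> (Inr d) = Inr d'" "\<phi> (Inl (tail G d)) = Inl (tail G' d')"
        using \<phi>m wf d(1) by (rule graph_morphism_dart) (use d in auto)
      show "L (projr (\<phi> (Inr d))) = d" using L_eq[OF d(1) d'(2,1)] d'(2) by simp
      show "projr (\<phi> (Inr d)) \<in> {d' \<in> darts ?F'. tail ?F' d' = y}" using d d' by auto
    qed
    also have "\<dots> = (\<Sum>d\<in>?A. c d) - (\<Sum>d\<in>?C. c d)"
      by (rule sum_diff[OF _ sub]) (use fin(2) in simp)
    also have "(\<Sum>d\<in>?C. c d) = 0"
    proof (rule sum_antisymmetric[where o' = "opp G"])
      fix d assume d: "d \<in> ?C"
      then have dG: "d \<in> darts ?F" "d \<in> darts G" by auto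
      show "opp G (opp G d) = d" using wf_graphD[OF wf dG(2)] by simp
      show "c (opp G d) = - c d" using c_opp dG by blast
      have "\<phi> (Inr (opp G d)) = Inl y"
        using \<phi>m wf dG(2) by (rule graph_morphism_dart) (use d in auto)
      then show "opp G d \<in> ?C" using wf_graphD(2)[OF wfF dG(1)] by simp
    qed
    also have "(\<Sum>d\<in>?A. c d) = (\<Sum>v | v \<in> verts G \<and> \<phi> (Inl v) = Inl y. \<Sum>d | d \<in> ?A \<and> tail G d = v. c d)"
      by (rule sum.group[symmetric]) (use fin wf_graphD[OF wf] in auto)
    also have "\<dots> = 0"
    proof (rule sum.neutral, rule ballI)
      fix v assume "v \<in> {v \<in> verts G. \<phi> (Inl v) = Inl y}"
      then have v: "v \<in> verts G" "\<phi> (Inl v) = Inl y" by auto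
      then have "v \<in> verts ?F" using y by (simp add: \<chi>_Inl)
      moreover have "{d. d \<in> ?A \<and> tail G d = v} = {d. d \<in> darts ?F \<and> tail G d = v}" using v by auto
      ultimately show "(\<Sum>d | d \<in> ?A \<and> tail G d = v. c d) = 0" using c_sum by simp
    qed
    finally show "(\<Sum>d' | d' \<in> darts ?F' \<and> tail ?F' d' = y. c' d') = 0" by simp
  qed
  moreover have "genus ?F' = 0" "finite (darts ?F')"
    using fiber_tree'[OF w] by (auto simp: graph_of_genus_def wf_graph_def)
  ultimately have c'0: "c' d' = 0" for d' using genus_eq_0_iff by blast
  have uncontracted: "c d = 0" if "d \<in> darts ?F" "\<phi> (Inr d) = Inr d'" for d d'
  proof -
    have dG: "d \<in> darts G" using that by simp
    have d': "d' \<in> darts G'" using \<phi>m wf dG by (rule graph_morphism_dart) (use that in auto)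
    have "L d' = d" by (rule L_eq[OF dG that(2) d'])
    moreover have "d' \<in> darts ?F'" using that d' by (auto simp: \<chi>_Inr)
    ultimately show ?thesis using c'0[of d'] by (simp only: c'_def if_True)
  qed
  show ?thesis
  proof (cases "d \<in> darts ?F \<and> (\<exists>x. \<phi> (Inr d) = Inl x)")
    case False
    then show ?thesis using uncontracted c_out by (cases "\<phi> (Inr d)") auto
  next
    case True
    then obtain x where x: "\<phi> (Inr d) = Inl x" by blast
    have dG: "d \<in> darts G" using True by simp
    have xG: "x \<in> verts G'" using \<phi>m wf dG by (rule graph_morphism_dart) (use x in auto)
    have xF: "\<psi> (Inl x) = Inl w" using True x by (auto simp: \<chi>_Inr)
    let ?X = "vertex_fiber G \<phi> x"
    \<comment> \<open>The restriction of \<open>c\<close> to the fiber over \<open>x\<close> is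
      still a cycle, because \<open>c\<close> is already known to vanish on all uncollapsed darts at
      its vertices.\<close>
    define b where "b e = (if e \<in> darts ?X then c e else 0)" for e
    have XF: "darts ?X \<subseteq> darts ?F" using xF by (auto simp: \<chi>_Inr)
    have "b \<in> H1 ?X"
      unfolding H1_def
    proof (intro CollectI conjI allI ballI impI)
      fix e assume "e \<notin> darts ?X"
      then show "b e = 0" by (simp only: b_def if_False)
    next
      fix e assume e: "e \<in> darts ?X"
      have "opp G e \<in> darts ?X" using wf_graphD(2)[OF wf_vertex_fiber[OF \<phi>m wf] e] by simp
      then show "b (opp ?X e) = - b e" using e c_opp XF by (simp only: b_def vertex_fiber_simps(4) if_True) blast
    next
      fix v assume v: "v \<in> verts ?X"
      have "(\<Sum>e | e \<in> darts ?X \<and> tail ?X e = v. b e) = (\<Sum>e | e \<in> darts ?F \<and> tail G e = v. c e)"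
      proof (rule sum.mono_neutral_cong_left)
        show "finite {e. e \<in> darts ?F \<and> tail G e = v}" using fin by simp
        show "{e. e \<in> darts ?X \<and> tail ?X e = v} \<subseteq> {e. e \<in> darts ?F \<and> tail G e = v}" using XF by auto
        show "\<forall>e\<in>{e. e \<in> darts ?F \<and> tail G e = v} - {e. e \<in> darts ?X \<and> tail ?X e = v}. c e = 0"
        proof
          fix e assume e: "e \<in> {e. e \<in> darts ?F \<and> tail G e = v} - {e. e \<in> darts ?X \<and> tail ?X e = v}"
          then have eG: "e \<in> darts G" "e \<in> darts ?F" "tail G e = v" "\<phi> (Inr e) \<noteq> Inl x" by auto
          obtain e' where "\<phi> (Inr e) = Inr e'"
            using \<phi>m wf eG(1) by (rule graph_morphism_dart) (use eG v in auto)
          then show "c e = 0" using uncontracted eG(2) by blast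
        qed
        show "\<And>e. e \<in> {e. e \<in> darts ?X \<and> tail ?X e = v} \<Longrightarrow> b e = c e" by (simp add: b_def)
      qed
      also have "\<dots> = 0" by (rule c_sum) (use v xF in \<open>auto simp: \<chi>_Inl\<close>)
      finally show "(\<Sum>e | e \<in> darts ?X \<and> tail ?X e = v. b e) = 0" .
    qed
    moreover have "genus ?X = 0" "finite (darts ?X)"
      using fiber_tree[OF xG] by (auto simp: graph_of_genus_def wf_graph_def)
    ultimately have "b d = 0" using genus_eq_0_iff by blast
    then show ?thesis using dG x by (simp add: b_def)
  qed
qed

lemma contraction_compose: "contraction G G'' (compose (cells G) \<psi> \<phi>)"
  unfolding contraction_def
proof (intro conjI ballI)
  show m: "graph_morphism G G'' \<chi>" by (rule graph_morphism_compose[OF \<phi>m \<psi>m wf])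
  have surj: "\<phi> ` cells G = cells G'" "\<psi> ` cells G' = cells G''" using \<phi> \<psi> by (auto simp: contraction_def)
  have "\<chi> ` cells G = \<psi> ` (\<phi> ` cells G)" by (auto simp: compose_def)
  then show "\<chi> ` cells G = cells G''" using surj by simp
  show "graph_of_genus 0 (vertex_fiber G \<chi> w)" if w: "w \<in> verts G''" for w
    unfolding graph_of_genus_def
  proof (intro conjI)
    show wfF: "wf_graph (vertex_fiber G \<chi> w)" by (rule wf_vertex_fiber[OF m wf])
    show "connected_graph (vertex_fiber G \<chi> w)" by (rule compose_fiber_connected[OF w])
    show "genus (vertex_fiber G \<chi> w) = 0"
      using genus_eq_0_iff[OF wf_graph_finite(2)[OF wfF]] compose_fiber_acyclic[OF w] by blast
    obtain y where y: "y \<in> verts G'" "\<psi> (Inl y) = Inl w"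
      using fiber_tree'[OF w] by (auto simp: graph_of_genus_def)
    obtain v where "v \<in> verts G" "\<phi> (Inl v) = Inl y"
      using fiber_tree[OF y(1)] by (auto simp: graph_of_genus_def)
    with y show "verts (vertex_fiber G \<chi> w) \<noteq> {}" by (auto simp: \<chi>_Inl)
  qed
  show "\<exists>!d. d \<in> darts G \<and> \<chi> (Inr d) = Inr d''" if d'': "d'' \<in> darts G''" for d''
  proof -
    obtain d' where d': "d' \<in> darts G'" "\<psi> (Inr d') = Inr d''"
      and u': "\<And>e. e \<in> darts G' \<Longrightarrow> \<psi> (Inr e) = Inr d'' \<Longrightarrow> e = d'"
      using \<psi> d'' unfolding contraction_def by blast
    obtain d where d: "d \<in> darts G" "\<phi> (Inr d) = Inr d'"
      and u: "\<And>e. e \<in> darts G \<Longrightarrow> \<phi> (Inr e) = Inr d' \<Longrightarrow> e = d"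
      using unique_lift[OF d'(1)] by blast
    show ?thesis
    proof (rule ex1I[of _ d])
      show "d \<in> darts G \<and> \<chi> (Inr d) = Inr d''" using d d' by (simp add: \<chi>_Inr)
      fix e assume e: "e \<in> darts G \<and> \<chi> (Inr e) = Inr d''"
      then have eG: "e \<in> darts G" "\<psi> (\<phi> (Inr e)) = Inr d''" by (auto simp: \<chi>_Inr)
      from \<phi>m wf eG(1) have "\<phi> (Inr e) = Inr d'"
      proof (rule graph_morphism_dart)
        fix v assume "v \<in> verts G'" "\<phi> (Inr e) = Inl v"
        then show ?thesis using graph_morphism_vertex[OF \<psi>m, of v] eG(2) by (metis sum.distinct(1))
      next
        fix e' assume "e' \<in> darts G'" "\<phi> (Inr e) = Inr e'"
        then show ?thesis using u' eG(2) by simp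
      qed
      then show "e = d" using u eG(1) by blast
    qed
  qed
qed

end

section \<open>Collapsing at most one edge\<close>

lemma tree_single_vertex:
  assumes "verts T = {v}" "darts T = {}"
  shows "graph_of_genus 0 T"
  using assms genus_eq_0_iff[of T]
  by (auto simp: graph_of_genus_def wf_graph_def connected_graph_def H1_def)

lemma tree_single_edge:
  assumes "wf_graph T" "verts T = {tail T e, head T e}" "darts T = {e, opp T e}" "tail T e \<noteq> head T e"
  shows "graph_of_genus 0 T"
  unfolding graph_of_genus_def
proof (intro conjI)
  have e: "opp T (opp T e) = e" "opp T e \<noteq> e" using wf_graphD[OF assms(1), of e] assms(3) by auto
  have "(tail T e, head T e) \<in> adj T" "(head T e, tail T e) \<in> adj T"
    using assms(3) e by (auto simp: head_def)
  then show "connected_graph T"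
    unfolding connected_graph_def using assms(2) by auto
  show "genus T = 0"
  proof (subst genus_eq_0_iff, simp add: assms(3), intro ballI allI)
    fix c d assume c: "c \<in> H1 T"
    have "{d. d \<in> darts T \<and> tail T d = tail T e} = {e}"
      using assms(3,4) by (auto simp: head_def)
    moreover have "(\<Sum>d | d \<in> darts T \<and> tail T d = tail T e. c d) = 0"
      using c assms(2) unfolding H1_def by auto
    ultimately have "c e = 0" by simp
    moreover have "c (opp T e) = - c e" using c assms(3) unfolding H1_def by auto
    moreover have "c d = 0" if "d \<notin> darts T" using c that unfolding H1_def by auto
    ultimately show "c d = 0" using assms(3) by (cases "d \<in> darts T") auto
  qed
qed (use assms in auto)

lemma contractionI:
  assumes "graph_morphism G G' \<phi>" "\<phi> ` cells G = cells G'"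
    and "\<And>w. w \<in> verts G' \<Longrightarrow> graph_of_genus 0 (vertex_fiber G \<phi> w)"
    and inj: "\<And>d d' x. d \<in> darts G \<Longrightarrow> d' \<in> darts G \<Longrightarrow> \<phi> (Inr d) = Inr x \<Longrightarrow> \<phi> (Inr d') = Inr x \<Longrightarrow> d = d'"
  shows "contraction G G' \<phi>"
  unfolding contraction_def
proof (intro conjI ballI)
  fix x assume "x \<in> darts G'"
  then have "Inr x \<in> \<phi> ` cells G" using assms(2) by simp
  then obtain y where y: "y \<in> cells G" "\<phi> y = Inr x" by force
  from y(1) obtain d where "d \<in> darts G" "y = Inr d"
  proof (cases rule: cells_cases)
    case (1 v)
    then show ?thesis using graph_morphism_vertex[OF assms(1), of v] y(2) by (metis sum.distinct(1))
  qed blast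
  then show "\<exists>!d. d \<in> darts G \<and> \<phi> (Inr d) = Inr x" using y(2) inj by blast
qed (use assms in auto)

lemma contraction_isoI:
  assumes m: "graph_morphism G G' \<phi>" and surj: "\<phi> ` cells G = cells G'" and inj: "inj_on \<phi> (cells G)"
    and darts: "\<And>d. d \<in> darts G \<Longrightarrow> \<exists>d'. \<phi> (Inr d) = Inr d'"
  shows "contraction G G' \<phi>"
proof (rule contractionI[OF m surj])
  fix w assume "w \<in> verts G'"
  then have "Inl w \<in> \<phi> ` cells G" using surj by simp
  then obtain y where y: "y \<in> cells G" "\<phi> y = Inl w" by force
  from y(1) obtain v where v: "v \<in> verts G" "y = Inl v"
  proof (cases rule: cells_cases)
    case (2 d)
    then show ?thesis using darts[of d] y(2) by auto
  qed blast
  have "verts (vertex_fiber G \<phi> w) = {v}"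
    using v y inj by (auto dest: inj_onD[of _ _ "Inl _" "Inl v"])
  moreover have "darts (vertex_fiber G \<phi> w) = {}" using darts by fastforce
  ultimately show "graph_of_genus 0 (vertex_fiber G \<phi> w)" by (rule tree_single_vertex)
next
  fix d d' x assume "d \<in> darts G" "d' \<in> darts G" "\<phi> (Inr d) = Inr x" "\<phi> (Inr d') = Inr x"
  then show "d = d'" using inj_onD[OF inj, of "Inr d" "Inr d'"] by simp
qed

text \<open>The only fiber with more than one point is the collapsed edge together with its two
  distinct ends, which is a tree.\<close>

lemma contraction_edgeI:
  assumes m: "graph_morphism G G' \<phi>" and wf: "wf_graph G" and surj: "\<phi> ` cells G = cells G'"
    and e: "e \<in> darts G" "tail G e \<noteq> head G e" "\<phi> (Inr e) = Inl w0"
    and coll: "\<And>d w. d \<in> darts G \<Longrightarrow> \<phi> (Inr d) = Inl w \<Longrightarrow> d \<in> {e, opp G e}"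
    and injv: "\<And>u v. u \<in> verts G \<Longrightarrow> v \<in> verts G \<Longrightarrow> \<phi> (Inl u) = \<phi> (Inl v) \<Longrightarrow>
      u = v \<or> {u, v} = {tail G e, head G e}"
    and injd: "\<And>d d' x. d \<in> darts G \<Longrightarrow> d' \<in> darts G \<Longrightarrow> \<phi> (Inr d) = Inr x \<Longrightarrow> \<phi> (Inr d') = Inr x \<Longrightarrow> d = d'"
  shows "contraction G G' \<phi>"
proof (rule contractionI[OF m surj _ injd])
  fix w assume w: "w \<in> verts G'"
  let ?F = "vertex_fiber G \<phi> w"
  have wfF: "wf_graph ?F" by (rule wf_vertex_fiber[OF m wf])
  have e': "\<phi> (Inr (opp G e)) = Inl w0" "\<phi> (Inl (tail G e)) = Inl w0" "\<phi> (Inl (head G e)) = Inl w0"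
    using m wf e(1) by (rule graph_morphism_dart; use e(3) in auto)+
  note wfe = wf_graphD[OF wf e(1)]
  show "graph_of_genus 0 ?F"
  proof (cases "w = w0")
    case True
    show ?thesis
    proof (rule tree_single_edge[OF wfF, of e])
      show "darts ?F = {e, opp (vertex_fiber G \<phi> w) e}" using coll e e' wfe True by auto
      show "verts ?F = {tail ?F e, head ?F e}"
      proof (intro equalityI subsetI)
        fix v assume "v \<in> verts ?F"
        then have "v \<in> verts G" "\<phi> (Inl v) = \<phi> (Inl (tail G e))" using True e' by auto
        then have "v = tail G e \<or> {v, tail G e} = {tail G e, head G e}" using injv wfe(1) by blast
        then show "v \<in> {tail ?F e, head ?F e}" by auto
      qed (use e' wfe True in auto)
    qed (use e in auto)
  next
    case False
    have "Inl w \<in> \<phi> ` cells G" using surj w by simp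
    then obtain y where y: "y \<in> cells G" "\<phi> y = Inl w" by force
    from y(1) obtain v where v: "v \<in> verts G" "y = Inl v"
    proof (cases rule: cells_cases)
      case (2 d)
      then show ?thesis using coll[of d w] y(2) e(3) e'(1) False by auto
    qed blast
    have "verts ?F = {v}"
    proof (intro equalityI subsetI)
      fix u assume "u \<in> verts ?F"
      then have "u = v \<or> {u, v} = {tail G e, head G e}" using v y by (intro injv) auto
      then show "u \<in> {v}"
        using e' False v y \<open>u \<in> verts ?F\<close> by (auto simp: doubleton_eq_iff)
    qed (use v y in auto)
    moreover have "darts ?F = {}" using coll e(3) e'(1) False by fastforce
    ultimately show ?thesis by (rule tree_single_vertex)
  qed
qed

section \<open>Graphs on natural numbers\<close>

lemma genus_le_of_iso:
  assumes wf: "wf_graph G" "wf_graph G'" and h: "bij_betw h (darts G') (darts G)"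
    and f: "inj_on f (verts G')" "f ` verts G' = verts G"
    and tail: "\<And>d. d \<in> darts G' \<Longrightarrow> tail G (h d) = f (tail G' d)"
    and opp: "\<And>d. d \<in> darts G' \<Longrightarrow> opp G (h d) = h (opp G' d)"
  shows "genus G \<le> genus G'"
proof (rule genus_le_genus[where T = "\<lambda>c d. if d \<in> darts G' then c (h d) else 0"])
  fix c assume c: "c \<in> H1 G"
  have hG: "h d \<in> darts G" if "d \<in> darts G'" for d using h that by (auto simp: bij_betw_def)
  show "(\<lambda>d. if d \<in> darts G' then c (h d) else 0) \<in> H1 G'"
    unfolding H1_def
  proof (intro CollectI conjI allI impI ballI)
    fix d assume d: "d \<in> darts G'"
    have "c (opp G (h d)) = - c (h d)" using c hG[OF d] by (auto simp: H1_def)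
    then show "(if opp G' d \<in> darts G' then c (h (opp G' d)) else 0) = - (if d \<in> darts G' then c (h d) else 0)"
      using d wf_graphD[OF wf(2) d] opp[OF d] by simp
  next
    fix v assume v: "v \<in> verts G'"
    have bij: "bij_betw h {d. d \<in> darts G' \<and> tail G' d = v} {d. d \<in> darts G \<and> tail G d = f v}"
    proof (rule bij_betw_imageI)
      show "inj_on h {d. d \<in> darts G' \<and> tail G' d = v}"
        using h by (auto simp: bij_betw_def intro: inj_on_subset)
      show "h ` {d. d \<in> darts G' \<and> tail G' d = v} = {d. d \<in> darts G \<and> tail G d = f v}"
      proof (intro equalityI subsetI)
        fix d assume d: "d \<in> {d. d \<in> darts G \<and> tail G d = f v}"
        then obtain d' where d': "d' \<in> darts G'" "d = h d'" using h by (auto simp: bij_betw_def)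
        then have "f (tail G' d') = f v" using d tail by auto
        then have "tail G' d' = v" using inj_onD[OF f(1)] v wf_graphD(1)[OF wf(2) d'(1)] by blast
        then show "d \<in> h ` {d. d \<in> darts G' \<and> tail G' d = v}" using d' by blast
      qed (use hG tail in auto)
    qed
    have "(\<Sum>d | d \<in> darts G' \<and> tail G' d = v. if d \<in> darts G' then c (h d) else 0) =
        (\<Sum>d | d \<in> darts G' \<and> tail G' d = v. c (h d))"
      by (rule sum.cong) auto
    also have "\<dots> = (\<Sum>d | d \<in> darts G \<and> tail G d = f v. c d)"
      by (rule sum.reindex_bij_betw[OF bij])
    also have "\<dots> = 0" using c v f(2) by (auto simp: H1_def)
    finally show "(\<Sum>d | d \<in> darts G' \<and> tail G' d = v. if d \<in> darts G' then c (h d) else 0) = 0" .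
  qed simp
  show "c = 0" if z: "(\<lambda>d. if d \<in> darts G' then c (h d) else 0) = 0"
  proof
    fix d show "c d = 0 d"
    proof (cases "d \<in> darts G")
      case True
      then obtain d' where "d' \<in> darts G'" "d = h d'" using h by (auto simp: bij_betw_def)
      then show ?thesis using fun_cong[OF z, of d'] by simp
    next
      case False
      then show ?thesis using c by (simp add: H1_def)
    qed
  qed
qed (use wf in \<open>auto simp: wf_graph_def fun_eq_iff\<close>)

lemma to_ngraph_simps [simp]:
  "verts (to_ngraph G) = to_nat ` verts G" "darts (to_ngraph G) = to_nat ` darts G"
  "tail (to_ngraph G) n = to_nat (tail G (from_nat n))" "opp (to_ngraph G) n = to_nat (opp G (from_nat n))"
  "head (to_ngraph G) n = to_nat (head G (from_nat n))"
  by (auto simp: to_ngraph_def head_def)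

lemma wf_to_ngraph: "wf_graph G \<Longrightarrow> wf_graph (to_ngraph G)"
  by (auto simp: wf_graph_def)

lemma genus_to_ngraph:
  assumes "wf_graph G"
  shows "genus (to_ngraph G) = genus G"
proof (rule antisym)
  note wf' = wf_to_ngraph[OF assms]
  show "genus (to_ngraph G) \<le> genus G"
    by (rule genus_le_of_iso[OF wf' assms, where h = to_nat and f = to_nat]) (auto simp: bij_betw_def)
  show "genus G \<le> genus (to_ngraph G)"
    by (rule genus_le_of_iso[OF assms wf', where h = from_nat and f = from_nat])
      (auto simp: bij_betw_def inj_on_def image_iff)
qed

lemma connected_to_ngraph:
  assumes "connected_graph G"
  shows "connected_graph (to_ngraph G)"
proof -
  have "(u, v) \<in> (adj G)\<^sup>* \<Longrightarrow> (to_nat u, to_nat v) \<in> (adj (to_ngraph G))\<^sup>*" for u v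
  proof (induction rule: rtrancl_induct)
    case (step y z)
    then obtain d where "d \<in> darts G" "y = tail G d" "z = head G d" by blast
    then have "(to_nat y, to_nat z) \<in> adj (to_ngraph G)" by force
    with step show ?case by (meson rtrancl.rtrancl_into_rtrancl)
  qed simp
  then show ?thesis using assms unfolding connected_graph_def by auto
qed

text \<open>Representations take values only on graphs of natural numbers. Contractions between
  subdivisions are transported there by composing with this isomorphism and with
  \<open>decode\<close>.\<close>

definition encode :: "('v::countable, 'd::countable) graph \<Rightarrow> 'v + 'd \<Rightarrow> nat + nat" where
  "encode G = restrict (map_sum to_nat to_nat) (cells G)"

definition decode :: "('v::countable, 'd::countable) graph \<Rightarrow> nat + nat \<Rightarrow> 'v + 'd" where
  "decode G = restrict (map_sum from_nat from_nat) (cells (to_ngraph G))"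

lemma encode_contraction:
  assumes "wf_graph G"
  shows "contraction G (to_ngraph G) (encode G)"
proof (rule contraction_isoI)
  show "graph_morphism G (to_ngraph G) (encode G)"
    unfolding graph_morphism_def
    by (auto simp: encode_def cell_tail_def cell_opp_def wf_graphD[OF assms] elim!: cells_cases)
  show "encode G ` cells G = cells (to_ngraph G)"
    by (auto simp: encode_def cells_def image_Un image_image Plus_def)
  show "inj_on (encode G) (cells G)"
    by (auto simp: encode_def inj_on_def elim!: cells_cases)
qed (auto simp: encode_def)

lemma decode_contraction:
  assumes "wf_graph G"
  shows "contraction (to_ngraph G) G (decode G)"
proof (rule contraction_isoI)
  show "graph_morphism (to_ngraph G) G (decode G)"
    unfolding graph_morphism_def
    by (auto simp: decode_def cell_tail_def cell_opp_def wf_graphD[OF assms] elim!: cells_cases)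
  show "decode G ` cells (to_ngraph G) = cells G"
    by (auto simp: decode_def cells_def image_Un image_image Plus_def)
  show "inj_on (decode G) (cells (to_ngraph G))"
    by (auto simp: decode_def inj_on_def elim!: cells_cases)
qed (auto simp: decode_def)

section \<open>Subdivisions\<close>

locale subdivision =
  fixes G :: "('v, 'd) graph" and es :: "'d list"
  assumes wf: "wf_graph G" and es_darts: "set es \<subseteq> darts G" and es_distinct: "distinct (map (edge_of G) es)"
begin

abbreviation S :: "(nat \<Rightarrow> nat) \<Rightarrow> ('v + nat \<times> nat, 'd + nat \<times> nat \<times> bool) graph" where
  "S m \<equiv> subdivide G es m"

abbreviation "pv m \<equiv> path_vertex G es m"

abbreviation "cut_edges \<equiv> edge_of G ` set es"

lemma subdivide_simps [simp]:
  "Inl v \<in> verts (S m) \<longleftrightarrow> v \<in> verts G"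
  "Inr (i, j) \<in> verts (S m) \<longleftrightarrow> i < length es \<and> 0 < j \<and> j < m i"
  "Inl d \<in> darts (S m) \<longleftrightarrow> d \<in> darts G \<and> edge_of G d \<notin> cut_edges"
  "Inr (i, j, b) \<in> darts (S m) \<longleftrightarrow> i < length es \<and> j < m i"
  "tail (S m) (Inl d) = Inl (tail G d)"
  "tail (S m) (Inr (i, j, b)) = pv m i (if b then j else Suc j)"
  "opp (S m) (Inl d) = Inl (opp G d)" "opp (S m) (Inr (i, j, b)) = Inr (i, j, \<not> b)"
  "head (S m) (Inl d) = Inl (head G d)"
  "head (S m) (Inr (i, j, b)) = pv m i (if b then Suc j else j)"
  by (auto simp: subdivide_def head_def)

lemma es_nth: "i < length es \<Longrightarrow> es ! i \<in> darts G"
  using es_darts nth_mem by blast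

lemma edge_of_opp: "d \<in> darts G \<Longrightarrow> edge_of G (opp G d) = edge_of G d"
  using wf_graphD[OF wf] by (auto simp: edge_of_def)

lemma pv_in_verts:
  assumes "i < length es" "j \<le> m i"
  shows "pv m i j \<in> verts (S m)"
  using assms wf_graphD[OF wf es_nth] by (auto simp: path_vertex_def)

lemma wf_subdivide: "wf_graph (S m)"
  unfolding wf_graph_def
proof (intro conjI ballI)
  have "{(i, j). i < length es \<and> 0 < j \<and> j < m i} \<subseteq> (SIGMA i:{..<length es}. {..<m i})"
    by auto
  then have "finite {(i, j). i < length es \<and> 0 < j \<and> j < m i}"
    by (rule finite_subset) simp
  then show "finite (verts (S m))" using wf_graph_finite[OF wf] by (simp add: subdivide_def)
  have "{(i, j, b). i < length es \<and> j < m i} \<subseteq> (SIGMA i:{..<length es}. {..<m i} \<times> UNIV)"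
    by auto
  then have "finite {(i, j, b :: bool). i < length es \<and> j < m i}"
    by (rule finite_subset) simp
  then show "finite (darts (S m))" using wf_graph_finite[OF wf] by (simp add: subdivide_def)
  fix x assume x: "x \<in> darts (S m)"
  consider d where "x = Inl d" | i j b where "x = Inr (i, j, b)" by (metis sumE prod.exhaust)
  then have "tail (S m) x \<in> verts (S m) \<and> opp (S m) x \<in> darts (S m) \<and> opp (S m) x \<noteq> x \<and>
      opp (S m) (opp (S m) x) = x"
    using x wf_graphD[OF wf] by cases (auto simp: edge_of_opp pv_in_verts)
  then show "tail (S m) x \<in> verts (S m)" "opp (S m) x \<in> darts (S m)" "opp (S m) x \<noteq> x"
    "opp (S m) (opp (S m) x) = x" by auto
qed

text \<open>Meaningful only for darts of cut edges; unique there because the listed edges are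
  distinct.\<close>

definition idx :: "'d \<Rightarrow> nat" where
  "idx d = (THE i. i < length es \<and> edge_of G (es ! i) = edge_of G d)"

lemma idx_eqI:
  assumes "i < length es" "edge_of G (es ! i) = edge_of G d"
  shows "idx d = i"
  unfolding idx_def
proof (rule the_equality)
  fix k assume k: "k < length es \<and> edge_of G (es ! k) = edge_of G d"
  then have "map (edge_of G) es ! k = map (edge_of G) es ! i" using assms by simp
  then show "k = i"
    using nth_eq_iff_index_eq[OF es_distinct, of k i] assms(1) k by simp
qed (use assms in auto)

lemma cutE:
  assumes "edge_of G d \<in> cut_edges" "d \<in> darts G"
  obtains "idx d < length es" "d = es ! idx d" | "idx d < length es" "d = opp G (es ! idx d)" "d \<noteq> es ! idx d"
proof -
  obtain i where i: "i < length es" "edge_of G (es ! i) = edge_of G d"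
    using assms(1) by (metis imageE in_set_conv_nth)
  then have idx: "idx d = i" by (rule idx_eqI)
  have "d \<in> {es ! i, opp G (es ! i)}" using i(2) by (auto simp: edge_of_def)
  then show thesis using that idx i(1) by (cases "d = es ! idx d") auto
qed

lemma idx_nth: "i < length es \<Longrightarrow> idx (es ! i) = i" "i < length es \<Longrightarrow> idx (opp G (es ! i)) = i"
  by (auto intro!: idx_eqI simp: edge_of_opp es_nth)

text \<open>The dart of the subdivision with the same initial segment as \<open>d\<close>.\<close>

definition first_dart :: "(nat \<Rightarrow> nat) \<Rightarrow> 'd \<Rightarrow> 'd + nat \<times> nat \<times> bool" where
  "first_dart m d = (if edge_of G d \<notin> cut_edges then Inl d
     else if d = es ! idx d then Inr (idx d, 0, True) else Inr (idx d, m (idx d) - 1, False))"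

lemma first_dart_nth:
  assumes "i < length es"
  shows "first_dart m (es ! i) = Inr (i, 0, True)" "first_dart m (opp G (es ! i)) = Inr (i, m i - 1, False)"
  using assms idx_nth[OF assms] wf_graphD(3)[OF wf es_nth[OF assms]]
  by (auto simp: first_dart_def edge_of_opp es_nth)

lemma adjI: "d \<in> darts H \<Longrightarrow> tail H d = x \<Longrightarrow> head H d = y \<Longrightarrow> (x, y) \<in> adj H"
  by blast

lemma sym_adj: "wf_graph H \<Longrightarrow> sym (adj H)"
proof (rule symI)
  fix x y assume H: "wf_graph H" and "(x, y) \<in> adj H"
  then obtain d where d: "d \<in> darts H" "x = tail H d" "y = head H d" by blast
  have "y = tail H (opp H d)" "x = head H (opp H d)" "opp H d \<in> darts H"
    using d wf_graphD[OF H d(1)] by (auto simp: head_def)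
  then show "(y, x) \<in> adj H" by blast
qed

section \<open>Connectedness and genus of a subdivision\<close>

context
  fixes m :: "nat \<Rightarrow> nat"
  assumes pos: "\<And>i. i < length es \<Longrightarrow> 0 < m i"
begin

lemma connected_subdivide:
  assumes "connected_graph G"
  shows "connected_graph (S m)"
proof -
  let ?R = "(adj (S m))\<^sup>*"
  have sym: "(y, x) \<in> ?R" if "(x, y) \<in> ?R" for x y
    using that sym_rtrancl[OF sym_adj[OF wf_subdivide[of m]]] by (meson symD)
  have path: "(Inl (tail G (es ! i)), pv m i j) \<in> ?R" if "i < length es" "j \<le> m i" for i j
    using that(2)
  proof (induction j)
    case 0
    then show ?case by (simp add: path_vertex_def)
  next
    case (Suc j)
    have "(pv m i j, pv m i (Suc j)) \<in> adj (S m)"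
      by (rule adjI[of "Inr (i, j, True)"]) (use that(1) Suc.prems in auto)
    moreover have "(Inl (tail G (es ! i)), pv m i j) \<in> ?R" using Suc by simp
    ultimately show ?case by (rule rtrancl_into_rtrancl[rotated])
  qed
  have edge: "(Inl (tail G d), Inl (head G d)) \<in> ?R" if d: "d \<in> darts G" for d
  proof (cases "edge_of G d \<in> cut_edges")
    case False
    then have "Inl d \<in> darts (S m)" using d by simp
    then have "(Inl (tail G d), Inl (head G d)) \<in> adj (S m)" by (rule adjI) auto
    then show ?thesis by (rule r_into_rtrancl)
  next
    case True
    have nth: "(Inl (tail G (es ! i)), Inl (head G (es ! i))) \<in> ?R" if "i < length es" for i
      using path[OF that, of "m i"] pos[OF that] by (simp add: path_vertex_def)
    from True d show ?thesis
    proof (cases rule: cutE)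
      case 1
      then show ?thesis using nth[OF 1(1)] by simp
    next
      case 2
      have "tail G d = head G (es ! idx d)" "head G d = tail G (es ! idx d)"
        using arg_cong[OF 2(2), of "tail G"] arg_cong[OF 2(2), of "head G"]
          wf_graphD[OF wf es_nth[OF 2(1)]] by (auto simp: head_def)
      then show ?thesis using sym[OF nth[OF 2(1)]] by simp
    qed
  qed
  have orig: "(Inl u, Inl v) \<in> ?R" if "u \<in> verts G" "v \<in> verts G" for u v
  proof -
    have "(u, v) \<in> (adj G)\<^sup>*" using assms that unfolding connected_graph_def by blast
    then show ?thesis
    proof (induction rule: rtrancl_induct)
      case (step y z)
      then obtain d where "d \<in> darts G" "y = tail G d" "z = head G d" by blast
      then have "(Inl y, Inl z) \<in> ?R" using edge by simp
      with step.IH show ?case by (rule rtrancl_trans)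
    qed simp
  qed
  have base: "\<exists>v\<in>verts G. (Inl v, x) \<in> ?R" if x: "x \<in> verts (S m)" for x
  proof (cases x)
    case (Inl v)
    then show ?thesis using x by auto
  next
    case (Inr ij)
    obtain i j where ij: "ij = (i, j)" by (cases ij)
    then have "i < length es" "0 < j" "j < m i" using x Inr by auto
    then show ?thesis
      using path[of i j] wf_graphD(1)[OF wf es_nth[of i]] Inr ij by (auto simp: path_vertex_def)
  qed
  show ?thesis
    unfolding connected_graph_def
  proof (intro ballI)
    fix x y assume "x \<in> verts (S m)" "y \<in> verts (S m)"
    then obtain u v where "u \<in> verts G" "(Inl u, x) \<in> ?R" "v \<in> verts G" "(Inl v, y) \<in> ?R"
      using base by meson
    then show "(x, y) \<in> ?R" using sym[of "Inl u" x] orig[of u v] by (meson rtrancl_trans)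
  qed
qed

lemma first_dart_in_darts: "d \<in> darts G \<Longrightarrow> first_dart m d \<in> darts (S m)"
proof (cases "edge_of G d \<in> cut_edges")
  case True
  assume d: "d \<in> darts G"
  from True d have "idx d < length es" by (rule cutE)
  with True pos show ?thesis unfolding first_dart_def by simp
qed (simp add: first_dart_def)

lemma tail_first_dart:
  assumes "d \<in> darts G"
  shows "tail (S m) (first_dart m d) = Inl (tail G d)"
proof (cases "edge_of G d \<in> cut_edges")
  case True
  from this assms show ?thesis
  proof (cases rule: cutE)
    case 1
    then show ?thesis using True by (simp add: first_dart_def path_vertex_def)
  next
    case 2
    then have "tail G d = head G (es ! idx d)" by (simp add: head_def)
    then show ?thesis using True 2 pos[OF 2(1)] by (simp add: first_dart_def path_vertex_def)
  qed
qed (simp add: first_dart_def)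

lemma inj_first_dart: "inj_on (first_dart m) (darts G)"
proof (rule inj_onI)
  fix d d' assume d: "d \<in> darts G" "d' \<in> darts G" "first_dart m d = first_dart m d'"
  show "d = d'"
  proof (cases "edge_of G d \<in> cut_edges \<and> edge_of G d' \<in> cut_edges")
    case False
    then show ?thesis using d(3) by (auto simp: first_dart_def split: if_splits)
  next
    case True
    then have "idx d = idx d'" "d = es ! idx d \<longleftrightarrow> d' = es ! idx d'"
      using d(3) by (auto simp: first_dart_def split: if_splits)
    then show ?thesis using cutE[of d] cutE[of d'] True d(1,2) by metis
  qed
qed

text \<open>\<open>first_dart\<close> identifies the star of an original vertex in \<open>G\<close>
  with its star in the subdivision, so the cycle conditions there correspond.\<close>

lemma darts_at_original_vertex:
  "{x. x \<in> darts (S m) \<and> tail (S m) x = Inl v} = first_dart m ` {d. d \<in> darts G \<and> tail G d = v}"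
proof (intro equalityI subsetI)
  fix x assume x: "x \<in> {x. x \<in> darts (S m) \<and> tail (S m) x = Inl v}"
  consider d where "x = Inl d" | i j b where "x = Inr (i, j, b)" by (metis sumE prod.exhaust)
  then show "x \<in> first_dart m ` {d. d \<in> darts G \<and> tail G d = v}"
  proof cases
    case 1
    then show ?thesis using x by (auto simp: first_dart_def intro!: image_eqI[of _ _ d])
  next
    case 2
    then have ij: "i < length es" "j < m i" using x by auto
    show ?thesis
    proof (cases b)
      case True
      then have "j = 0" "v = tail G (es ! i)" using x 2 ij by (auto simp: path_vertex_def split: if_splits)
      then show ?thesis using 2 True ij first_dart_nth(1)[OF ij(1), of m] es_nth[OF ij(1)] by force
    next
      case False
      then have "Suc j = m i" "v = head G (es ! i)" using x 2 ij by (auto simp: path_vertex_def split: if_splits)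
      then have "x = first_dart m (opp G (es ! i))" "v = tail G (opp G (es ! i))"
        using 2 False first_dart_nth(2)[OF ij(1), of m] by (auto simp: head_def)
      then show ?thesis using wf_graphD(2)[OF wf es_nth[OF ij(1)]] by blast
    qed
  qed
qed (use tail_first_dart first_dart_in_darts in auto)

lemma darts_at_path_vertex:
  assumes "i < length es" "Suc j < m i"
  shows "{x. x \<in> darts (S m) \<and> tail (S m) x = Inr (i, Suc j)} = {Inr (i, Suc j, True), Inr (i, j, False)}"
proof (intro equalityI subsetI)
  fix x assume x: "x \<in> {x. x \<in> darts (S m) \<and> tail (S m) x = Inr (i, Suc j)}"
  consider d where "x = Inl d" | i' j' b where "x = Inr (i', j', b)" by (metis sumE prod.exhaust)
  then show "x \<in> {Inr (i, Suc j, True), Inr (i, j, False)}"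
    using x by cases (auto simp: path_vertex_def split: if_splits)
qed (use assms in \<open>auto simp: path_vertex_def\<close>)

text \<open>An inner vertex of a path has just two darts, so the flow of a cycle passes through it
  unchanged.\<close>

lemma H1_const_on_path:
  assumes c: "c \<in> H1 (S m)" and "i < length es" "j < m i"
  shows "c (Inr (i, j, True)) = c (Inr (i, 0, True))" "c (Inr (i, j, False)) = - c (Inr (i, 0, True))"
proof -
  have opp: "c (Inr (i, j, False)) = - c (Inr (i, j, True))" if "j < m i" for j
  proof -
    have "Inr (i, j, True) \<in> darts (S m)" using assms(2) that by simp
    then have "c (opp (S m) (Inr (i, j, True))) = - c (Inr (i, j, True))" using c unfolding H1_def by blast
    then show ?thesis by simp
  qed
  show *: "c (Inr (i, j, True)) = c (Inr (i, 0, True))"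
    using assms(3)
  proof (induction j)
    case (Suc j)
    have "Inr (i, Suc j) \<in> verts (S m)" using assms(2) Suc.prems by simp
    then have "(\<Sum>x | x \<in> darts (S m) \<and> tail (S m) x = Inr (i, Suc j). c x) = 0"
      using c unfolding H1_def by blast
    then have "c (Inr (i, Suc j, True)) + c (Inr (i, j, False)) = 0"
      unfolding darts_at_path_vertex[OF assms(2) Suc.prems] by simp
    then show ?case using Suc opp[of j] by simp
  qed simp
  show "c (Inr (i, j, False)) = - c (Inr (i, 0, True))" using * opp[OF assms(3)] by simp
qed

text \<open>A cycle on the subdivision is determined by its values on first darts, and those form a
  cycle on \<open>G\<close>; conversely a cycle on \<open>G\<close> is spread with constant value
  along every path.\<close>

lemma genus_subdivide: "genus (S m) = genus G"
proof (rule antisym)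
  have fin: "finite (darts G)" "finite (darts (S m))"
    using wf_graph_finite[OF wf] wf_graph_finite[OF wf_subdivide] by auto
  show "genus (S m) \<le> genus G"
  proof (rule genus_le_genus[OF fin(2,1), where T = "\<lambda>c d. if d \<in> darts G then c (first_dart m d) else 0"])
    fix c assume c: "c \<in> H1 (S m)"
    \<comment> \<open>The first dart of the reversed edge is the last path edge run backwards;
      constancy along the path gives the change of sign.\<close>
    have nth: "c (first_dart m (opp G (es ! i))) = - c (first_dart m (es ! i))" if "i < length es" for i
      using that H1_const_on_path(2)[OF c that, of "m i - 1"] pos[OF that] by (simp add: first_dart_nth)
    show "(\<lambda>d. if d \<in> darts G then c (first_dart m d) else 0) \<in> H1 G"
      unfolding H1_def
    proof (intro CollectI conjI allI ballI impI)
      fix d assume d: "d \<in> darts G"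
      have "c (first_dart m (opp G d)) = - c (first_dart m d)"
      proof (cases "edge_of G d \<in> cut_edges")
        case True
        from this d show ?thesis
        proof (cases rule: cutE)
          case 1
          then show ?thesis using nth by metis
        next
          case 2
          then have "opp G d = es ! idx d" using wf_graphD(4)[OF wf es_nth] by metis
          then show ?thesis using nth[OF 2(1)] 2(2) by (metis minus_equation_iff)
        qed
      next
        case False
        then have "Inl d \<in> darts (S m)" using d by simp
        then have "c (opp (S m) (Inl d)) = - c (Inl d)" using c unfolding H1_def by blast
        then show ?thesis using False d by (simp add: first_dart_def edge_of_opp)
      qed
      then show "(if opp G d \<in> darts G then c (first_dart m (opp G d)) else 0) =
          - (if d \<in> darts G then c (first_dart m d) else 0)"
        using d wf_graphD[OF wf d] by simp
    next
      fix v assume v: "v \<in> verts G"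
      have "(\<Sum>d | d \<in> darts G \<and> tail G d = v. if d \<in> darts G then c (first_dart m d) else 0) =
          (\<Sum>d | d \<in> darts G \<and> tail G d = v. c (first_dart m d))"
        by (rule sum.cong) auto
      also have "\<dots> = (\<Sum>x\<in>first_dart m ` {d. d \<in> darts G \<and> tail G d = v}. c x)"
        by (rule sum.reindex_cong[symmetric, of "first_dart m"]) (auto intro: inj_on_subset[OF inj_first_dart])
      also have "\<dots> = 0"
        unfolding darts_at_original_vertex[symmetric] using c v by (auto simp: H1_def)
      finally show "(\<Sum>d | d \<in> darts G \<and> tail G d = v. if d \<in> darts G then c (first_dart m d) else 0) = 0" .
    qed simp
    show "c = 0" if z: "(\<lambda>d. if d \<in> darts G then c (first_dart m d) else 0) = 0"
    proof
      fix x show "c x = 0 x"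
      proof (cases "x \<in> darts (S m)")
        case False
        then show ?thesis using c unfolding H1_def by auto
      next
        case True
        have z': "c (first_dart m d) = 0" if "d \<in> darts G" for d
          using fun_cong[OF z, of d] that by simp
        consider d where "x = Inl d" | i j b where "x = Inr (i, j, b)" by (metis sumE prod.exhaust)
        then show ?thesis
        proof cases
          case 1
          then show ?thesis using True z'[of d] by (simp add: first_dart_def)
        next
          case 2
          then have ij: "i < length es" "j < m i" using True by auto
          have "c (Inr (i, 0, True)) = 0" using z'[OF es_nth[OF ij(1)]] ij by (simp add: first_dart_nth)
          then show ?thesis using H1_const_on_path[OF c ij] 2 by (cases b) auto
        qed
      qed
    qed
  qed (auto simp: fun_eq_iff)
  show "genus G \<le> genus (S m)"
  proof (rule genus_le_genus[OF fin, where T = "\<lambda>c x. if x \<in> darts (S m) then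
        (case x of Inl d \<Rightarrow> c d | Inr (i, j, b) \<Rightarrow> if b then c (es ! i) else c (opp G (es ! i))) else 0"])
    fix c assume c: "c \<in> H1 G"
    let ?T = "\<lambda>x. if x \<in> darts (S m) then
        (case x of Inl d \<Rightarrow> c d | Inr (i, j, b) \<Rightarrow> if b then c (es ! i) else c (opp G (es ! i))) else 0"
    have c_opp: "c (opp G d) = - c d" if "d \<in> darts G" for d using c that by (auto simp: H1_def)
    have T_first: "?T (first_dart m d) = c d" if d: "d \<in> darts G" for d
    proof (cases "edge_of G d \<in> cut_edges")
      case True
      from this d show ?thesis
        by (cases rule: cutE)
          (use first_dart_in_darts[OF d] True in \<open>auto simp: first_dart_def\<close>)
    qed (use d in \<open>simp add: first_dart_def\<close>)
    show "?T \<in> H1 (S m)"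
      unfolding H1_def
    proof (intro CollectI conjI allI ballI impI)
      fix x assume x: "x \<in> darts (S m)"
      have "opp (S m) x \<in> darts (S m)" using wf_graphD(2)[OF wf_subdivide x] .
      then show "?T (opp (S m) x) = - ?T x"
        using x c_opp es_nth by (auto split: sum.splits)
    next
      fix v assume v: "v \<in> verts (S m)"
      show "(\<Sum>x | x \<in> darts (S m) \<and> tail (S m) x = v. ?T x) = 0"
      proof (cases v)
        case (Inl w)
        have "(\<Sum>x | x \<in> darts (S m) \<and> tail (S m) x = v. ?T x) = (\<Sum>d | d \<in> darts G \<and> tail G d = w. c d)"
          unfolding Inl darts_at_original_vertex
          by (rule sum.reindex_cong[of "first_dart m"])
            (use T_first in \<open>auto intro: inj_on_subset[OF inj_first_dart]\<close>)
        also have "\<dots> = 0" using c v Inl by (auto simp: H1_def)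
        finally show ?thesis .
      next
        case (Inr ij)
        obtain i j where ij: "ij = (i, Suc j)" "i < length es" "Suc j < m i"
          using v Inr by (cases ij) (auto simp: gr0_conv_Suc)
        show ?thesis
          unfolding Inr ij(1) darts_at_path_vertex[OF ij(2,3)]
          using ij c_opp[OF es_nth[OF ij(2)]] by simp
      qed
    qed simp
    show "c = 0" if z: "?T = 0"
    proof
      fix d show "c d = 0 d"
        using T_first[of d] fun_cong[OF z, of "first_dart m d"] c by (cases "d \<in> darts G") (auto simp: H1_def)
    qed
  qed (auto simp: fun_eq_iff split: sum.splits)
qed

end

end

section \<open>Contractions between subdivisions\<close>

text \<open>A discrete intermediate value theorem that also locates a step by which the value is
  left.\<close>

lemma unit_steps_hit:
  fixes s :: "nat \<Rightarrow> nat"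
  assumes "s 0 = 0" "\<And>j. j < n \<Longrightarrow> s (Suc j) = s j \<or> s (Suc j) = Suc (s j)" "k < s n"
  shows "\<exists>j<n. s j = k \<and> s (Suc j) = Suc k"
  using assms(2,3)
proof (induction n)
  case 0
  then show ?case using assms(1) by simp
next
  case (Suc n)
  show ?case
  proof (cases "k < s n")
    case True
    then show ?thesis using Suc.IH Suc.prems(1) by (meson less_SucI)
  next
    case False
    then have "s n = k" "s (Suc n) = Suc k" using Suc.prems(1)[of n] Suc.prems(2) by auto
    then show ?thesis by blast
  qed
qed

lemma unit_steps_mono:
  fixes s :: "nat \<Rightarrow> nat"
  assumes "\<And>j. j < n \<Longrightarrow> s (Suc j) = s j \<or> s (Suc j) = Suc (s j)" "j \<le> j'" "j' \<le> n"
  shows "s j \<le> s j'"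
  using assms(2,3)
proof (induction j' rule: dec_induct)
  case (step j')
  then show ?case using assms(1)[of j'] by auto
qed simp

context subdivision
begin

text \<open>\<open>s i\<close> gives the effect on vertex positions in the path numbered \<open>i\<close>; an edge is collapsed
  iff its ends get the same position.\<close>

definition path_map ::
  "(nat \<Rightarrow> nat \<Rightarrow> nat) \<Rightarrow> (nat \<Rightarrow> nat) \<Rightarrow> (nat \<Rightarrow> nat) \<Rightarrow>
   ('v + nat \<times> nat) + ('d + nat \<times> nat \<times> bool) \<Rightarrow> ('v + nat \<times> nat) + ('d + nat \<times> nat \<times> bool)" where
  "path_map s m' m = restrict (\<lambda>x. case x of
      Inl (Inl v) \<Rightarrow> Inl (Inl v)
    | Inl (Inr (i, j)) \<Rightarrow> Inl (pv m i (s i j))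
    | Inr (Inl d) \<Rightarrow> Inr (Inl d)
    | Inr (Inr (i, j, b)) \<Rightarrow>
        if s i (Suc j) = s i j then Inl (pv m i (s i j)) else Inr (Inr (i, s i j, b))) (cells (S m'))"

lemma path_map_simps:
  "v \<in> verts G \<Longrightarrow> path_map s m' m (Inl (Inl v)) = Inl (Inl v)"
  "Inr (i, j) \<in> verts (S m') \<Longrightarrow> path_map s m' m (Inl (Inr (i, j))) = Inl (pv m i (s i j))"
  "Inl d \<in> darts (S m') \<Longrightarrow> path_map s m' m (Inr (Inl d)) = Inr (Inl d)"
  "Inr (i, j, b) \<in> darts (S m') \<Longrightarrow> path_map s m' m (Inr (Inr (i, j, b))) =
     (if s i (Suc j) = s i j then Inl (pv m i (s i j)) else Inr (Inr (i, s i j, b)))"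
  unfolding path_map_def by (subst restrict_apply', simp, simp)+

context
  fixes m m' :: "nat \<Rightarrow> nat" and s :: "nat \<Rightarrow> nat \<Rightarrow> nat"
  assumes pos: "\<And>i. i < length es \<Longrightarrow> 0 < m i"
    and s_0: "\<And>i. i < length es \<Longrightarrow> s i 0 = 0"
    and s_end: "\<And>i. i < length es \<Longrightarrow> s i (m' i) = m i"
    and s_step: "\<And>i j. i < length es \<Longrightarrow> j < m' i \<Longrightarrow> s i (Suc j) = s i j \<or> s i (Suc j) = Suc (s i j)"
begin

lemma s_mono: "i < length es \<Longrightarrow> j \<le> j' \<Longrightarrow> j' \<le> m' i \<Longrightarrow> s i j \<le> s i j'"
  using unit_steps_mono[of "m' i" "s i" j j'] s_step by blast

lemma s_le: "i < length es \<Longrightarrow> j \<le> m' i \<Longrightarrow> s i j \<le> m i"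
  using s_mono[of i j "m' i"] s_end by simp

lemma path_map_pv:
  assumes "i < length es" "j \<le> m' i"
  shows "path_map s m' m (Inl (pv m' i j)) = Inl (pv m i (s i j))"
proof -
  have "0 < m' i" using s_0[OF assms(1)] s_end[OF assms(1)] pos[OF assms(1)] by (cases "m' i") auto
  then show ?thesis
    using assms s_0[OF assms(1)] s_end[OF assms(1)] pos[OF assms(1)] wf_graphD[OF wf es_nth[OF assms(1)]]
    by (auto simp: path_vertex_def path_map_simps)
qed

lemma path_map_morphism: "graph_morphism (S m') (S m) (path_map s m' m)"
proof -
  have ext: "path_map s m' m x = undefined" if "x \<notin> cells (S m')" for x
    using that by (simp add: path_map_def)
  have "path_map s m' m x \<in> cells (S m) \<and>
      path_map s m' m (cell_tail (S m') x) = cell_tail (S m) (path_map s m' m x) \<and>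
      path_map s m' m (cell_opp (S m') x) = cell_opp (S m) (path_map s m' m x)"
    if x: "x \<in> cells (S m')" for x
    using x
  proof (cases rule: cells_cases)
    case (1 y)
    have "path_map s m' m x \<in> cells (S m) \<and> (\<exists>z. path_map s m' m x = Inl z)"
    proof (cases y)
      case (Inl v)
      then show ?thesis using 1 by (simp add: path_map_simps)
    next
      case (Inr ij)
      obtain i j where ij: "ij = (i, j)" by (cases ij)
      then have i: "i < length es" "j < m' i" using 1 Inr by auto
      then have "path_map s m' m x = Inl (pv m i (s i j))"
        using 1 Inr ij by (simp add: path_map_simps)
      moreover have "pv m i (s i j) \<in> verts (S m)" by (rule pv_in_verts) (use i s_le in auto)
      ultimately show ?thesis by simp
    qed
    then show ?thesis using 1 by (auto simp: cell_tail_def cell_opp_def)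
  next
    case (2 y)
    show ?thesis
    proof (cases y)
      case (Inl d)
      then have d: "d \<in> darts G" "edge_of G d \<notin> cut_edges" using 2 by auto
      have "Inl (opp G d) \<in> darts (S m')" using d wf_graphD[OF wf d(1)] by (simp add: edge_of_opp)
      then show ?thesis
        using 2 Inl d wf_graphD[OF wf d(1)] by (simp add: cell_tail_def cell_opp_def path_map_simps)
    next
      case (Inr ijb)
      obtain i j b where ijb: "ijb = (i, j, b)" by (cases ijb)
      then have i: "i < length es" "j < m' i" using 2 Inr by auto
      have px: "path_map s m' m x = (if s i (Suc j) = s i j then Inl (pv m i (s i j)) else Inr (Inr (i, s i j, b)))"
        using 2 Inr ijb i by (simp add: path_map_simps)
      have po: "path_map s m' m (cell_opp (S m') x) =
          (if s i (Suc j) = s i j then Inl (pv m i (s i j)) else Inr (Inr (i, s i j, \<not> b)))"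
        using 2 Inr ijb i by (simp add: cell_opp_def path_map_simps)
      have pt: "path_map s m' m (cell_tail (S m') x) = Inl (pv m i (s i (if b then j else Suc j)))"
        using 2 Inr ijb i path_map_pv[of i "if b then j else Suc j"] by (simp add: cell_tail_def)
      have le: "s i j \<le> m i" "s i (Suc j) \<le> m i" using s_le i by auto
      show ?thesis
      proof (cases "s i (Suc j) = s i j")
        case True
        then show ?thesis
          using px po pt pv_in_verts[of i "s i j" m] i le by (auto simp: cell_tail_def cell_opp_def)
      next
        case False
        then have "s i (Suc j) = Suc (s i j)" using s_step[OF i] by blast
        then show ?thesis
          using px po pt i le by (auto simp: cell_tail_def cell_opp_def)
      qed
    qed
  qed
  then show ?thesis unfolding graph_morphism_def using ext by (auto simp: PiE_def extensional_def)
qed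

lemma path_map_surj: "path_map s m' m ` cells (S m') = cells (S m)"
proof
  show "path_map s m' m ` cells (S m') \<subseteq> cells (S m)"
    using path_map_morphism unfolding graph_morphism_def by blast
  show "cells (S m) \<subseteq> path_map s m' m ` cells (S m')"
  proof
    fix x assume x: "x \<in> cells (S m)"
    have hit: "\<exists>j<m' i. s i j = k \<and> s i (Suc j) = Suc k" if "i < length es" "k < m i" for i k
      using unit_steps_hit[of "s i" "m' i" k] s_0 s_step s_end that by auto
    from x show "x \<in> path_map s m' m ` cells (S m')"
    proof (cases rule: cells_cases)
      case (1 y)
      show ?thesis
      proof (cases y)
        case (Inl v)
        then show ?thesis using 1 path_map_simps(1)[of v s m' m] by (force intro: image_eqI[of _ _ "Inl (Inl v)"])
      next
        case (Inr ij)
        obtain i k where ij: "ij = (i, k)" by (cases ij)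
        then have i: "i < length es" "0 < k" "k < m i" using 1 Inr by auto
        obtain j where j: "j < m' i" "s i j = k" using hit[OF i(1,3)] by blast
        have "pv m' i j \<in> verts (S m')" by (rule pv_in_verts) (use i j in auto)
        moreover have "path_map s m' m (Inl (pv m' i j)) = Inl (Inr (i, k))"
          using path_map_pv[of i j] i j by (simp add: path_vertex_def)
        ultimately show ?thesis using 1 Inr ij by (force intro: image_eqI[of _ _ "Inl (pv m' i j)"])
      qed
    next
      case (2 y)
      show ?thesis
      proof (cases y)
        case (Inl d)
        then show ?thesis using 2 path_map_simps(3)[of d m' s m] by (force intro: image_eqI[of _ _ "Inr (Inl d)"])
      next
        case (Inr ijb)
        obtain i k b where ijb: "ijb = (i, k, b)" by (cases ijb)
        then have i: "i < length es" "k < m i" using 2 Inr by auto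
        obtain j where j: "j < m' i" "s i j = k" "s i (Suc j) = Suc k" using hit[OF i] by blast
        then show ?thesis
          using 2 Inr ijb i path_map_simps(4)[of i j b m' s m]
          by (force intro: image_eqI[of _ _ "Inr (Inr (i, j, b))"])
      qed
    qed
  qed
qed

lemma path_map_inj_darts:
  assumes "x \<in> darts (S m')" "y \<in> darts (S m')"
    "path_map s m' m (Inr x) = Inr z" "path_map s m' m (Inr y) = Inr z"
  shows "x = y"
proof -
  \<comment> \<open>After an edge that is not collapsed, the position of its initial vertex is never
    attained again.\<close>
  have inc: "s i j \<noteq> s i j'" if "i < length es" "j < j'" "j' \<le> m' i" "s i (Suc j) \<noteq> s i j" for i j j'
    using s_mono[of i "Suc j" j'] s_step[of i j] that by auto
  consider d where "x = Inl d" | i j b where "x = Inr (i, j, b)" by (metis sumE prod.exhaust)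
  then show ?thesis
  proof cases
    case 1
    then have z: "z = Inl d" using assms(1,3) by (simp add: path_map_simps)
    consider d' where "y = Inl d'" | i j b where "y = Inr (i, j, b)" by (metis sumE prod.exhaust)
    then show ?thesis
      using assms(2,4) z 1 by cases (auto simp: path_map_simps split: if_splits)
  next
    case 2
    then have i: "i < length es" "j < m' i" using assms(1) by auto
    have z: "z = Inr (i, s i j, b)" "s i (Suc j) \<noteq> s i j"
      using assms(1,3) 2 by (auto simp: path_map_simps split: if_splits)
    consider d' where "y = Inl d'" | i' j' b' where "y = Inr (i', j', b')" by (metis sumE prod.exhaust)
    then show ?thesis
    proof cases
      case 1
      then show ?thesis using assms(2,4) z by (auto simp: path_map_simps)
    next
      case y: 2
      then have "i' = i" "b' = b" "s i j' = s i j" "s i (Suc j') \<noteq> s i j'" "j' < m' i"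
        using assms(2,4) z by (auto simp: path_map_simps split: if_splits)
      moreover from this have "j = j'"
        using inc[of i j j'] inc[of i j' j] i z(2) by (metis less_imp_le linorder_neqE_nat)
      ultimately show ?thesis using y 2 by simp
    qed
  qed
qed

end

text \<open>Vertices \<open>p\<close> and \<open>p + 1\<close> get the same position, so exactly
  edge \<open>p\<close> is collapsed. On edges, \<open>shift i p\<close> goes the opposite way and
  lists the edges that survive.\<close>

definition collapse_at :: "nat \<Rightarrow> nat \<Rightarrow> nat \<Rightarrow> nat \<Rightarrow> nat" where
  "collapse_at i p i' j = (if i' = i \<and> p < j then j - 1 else j)"

text \<open>Positivity of \<open>m i\<close> gives the longer path at least two edges, so the
  collapsed edge has distinct ends and its collapse has contractible fibers.\<close>

lemma path_map_collapse_contraction: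
  assumes pos: "\<And>i. i < length es \<Longrightarrow> 0 < m i" and i: "i < length es" and p: "p \<le> m i"
  shows "contraction (S (m(i := Suc (m i)))) (S m) (path_map (collapse_at i p) (m(i := Suc (m i))) m)"
proof -
  let ?m' = "m(i := Suc (m i))" and ?s = "collapse_at i p"
  let ?f = "path_map ?s ?m' m"
  have steps: "?s k 0 = 0" "?s k (?m' k) = m k" "?s k (Suc j) = ?s k j \<or> ?s k (Suc j) = Suc (?s k j)"
    if "k < length es" for k j
    using p by (auto simp: collapse_at_def)
  note path = pos steps(1,2) steps(3)
  have "2 \<le> ?m' i" using pos[OF i] by simp
  show ?thesis
  proof (rule contraction_edgeI[where e = "Inr (i, p, True)" and ?w0.0 = "pv m i p"])
    show "graph_morphism (S ?m') (S m) ?f" by (rule path_map_morphism) (use path in auto)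
    show "wf_graph (S ?m')" by (rule wf_subdivide)
    show "?f ` cells (S ?m') = cells (S m)" by (rule path_map_surj) (use path in auto)
    show e: "Inr (i, p, True) \<in> darts (S ?m')" using i p by simp
    show "?f (Inr (Inr (i, p, True))) = Inl (pv m i p)"
      using e by (simp add: path_map_simps collapse_at_def)
    show "tail (S ?m') (Inr (i, p, True)) \<noteq> head (S ?m') (Inr (i, p, True))"
      using p pos[OF i] by (auto simp: path_vertex_def)
    show "x \<in> {Inr (i, p, True), opp (S ?m') (Inr (i, p, True))}"
      if x: "x \<in> darts (S ?m')" "?f (Inr x) = Inl w" for x w
    proof -
      consider d where "x = Inl d" | k j b where "x = Inr (k, j, b)" by (metis sumE prod.exhaust)
      then show ?thesis
      proof cases
        case 2
        then have "?s k (Suc j) = ?s k j" using x by (auto simp only: path_map_simps split: if_splits)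
        then have "k = i" "j = p" by (auto simp: collapse_at_def split: if_splits)
        then show ?thesis using 2 by (cases b) auto
      qed (use x in \<open>auto simp: path_map_simps\<close>)
    qed
    show "x = y" if "x \<in> darts (S ?m')" "y \<in> darts (S ?m')" "?f (Inr x) = Inr z" "?f (Inr y) = Inr z" for x y z
      by (rule path_map_inj_darts[OF _ _ _ _ that]) (use path in auto)
    show "x = y \<or> {x, y} = {tail (S ?m') (Inr (i, p, True)), head (S ?m') (Inr (i, p, True))}"
      if xy: "x \<in> verts (S ?m')" "y \<in> verts (S ?m')" "?f (Inl x) = ?f (Inl y)" for x y
    proof -
      have ends: "tail (S ?m') (Inr (i, p, True)) = pv ?m' i p" "head (S ?m') (Inr (i, p, True)) = pv ?m' i (Suc p)"
        by auto
      \<comment> \<open>An inner path vertex is merged with an original vertex only if the collapsed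
        edge is the first or the last one of its path: \<open>p = 0\<close> with
        \<open>j = 1\<close>, or \<open>p = m i\<close> with \<open>j = m i\<close>.\<close>
      have mixed: "{Inl v, Inr (k, j)} = {pv ?m' i p, pv ?m' i (Suc p)}"
        if kj: "k < length es" "0 < j" "j < ?m' k" and eq: "Inl v = pv m k (?s k j)" for v k j
      proof -
        have "?s k j = 0 \<or> ?s k j = m k" using eq by (auto simp: path_vertex_def split: if_splits)
        then have "k = i \<and> (p = 0 \<and> j = 1 \<or> p = m i \<and> j = m i)"
          using kj p pos[OF kj(1)] by (auto simp: collapse_at_def split: if_splits)
        then show ?thesis
          using eq pos[OF i] by (auto simp: path_vertex_def collapse_at_def split: if_splits)
      qed
      consider u v where "x = Inl u" "y = Inl v" | u k j where "x = Inl u" "y = Inr (k, j)"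
        | u k j where "x = Inr (k, j)" "y = Inl u" | k j k' j' where "x = Inr (k, j)" "y = Inr (k', j')"
        by (metis sumE prod.exhaust)
      then show ?thesis
      proof cases
        case 1
        then show ?thesis using xy by (simp add: path_map_simps)
      next
        case 2
        then have "{x, y} = {pv ?m' i p, pv ?m' i (Suc p)}"
          using xy mixed[of k j u] by (simp add: path_map_simps del: fun_upd_apply)
        then show ?thesis by (simp add: ends del: fun_upd_apply)
      next
        case 3
        then have "{y, x} = {pv ?m' i p, pv ?m' i (Suc p)}"
          using xy mixed[of k j u] by (simp add: path_map_simps del: fun_upd_apply)
        then show ?thesis by (simp add: ends insert_commute del: fun_upd_apply)
      next
        case 4
        have k: "k < length es" "0 < j" "j < ?m' k" "k' < length es" "0 < j'" "j' < ?m' k'"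
          using xy(1,2) unfolding 4 by (auto simp del: fun_upd_apply)
        have eq: "pv m k (?s k j) = pv m k' (?s k' j')"
          using xy by (simp add: 4 path_map_simps k del: fun_upd_apply)
        show ?thesis
        proof (cases "pv m k (?s k j)")
          case (Inl v)
          have v: "{Inl v, Inr (k, j)} = {pv ?m' i p, pv ?m' i (Suc p)}"
            "{Inl v, Inr (k', j')} = {pv ?m' i p, pv ?m' i (Suc p)}"
            using mixed[OF k(1-3), of v] mixed[OF k(4-6), of v] eq Inl by auto
          then have "{Inl v, Inr (k, j)} = {Inl v, Inr (k', j')}" by simp
          then show ?thesis using 4 by (auto simp: doubleton_eq_iff)
        next
          case (Inr w)
          then have kk: "k' = k" "?s k j = ?s k j'"
            using eq by (auto simp: path_vertex_def split: if_splits)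
          then have "j = j' \<or> k = i \<and> (j = p \<and> j' = Suc p \<or> j = Suc p \<and> j' = p)"
            using k by (auto simp: collapse_at_def split: if_splits)
          then show ?thesis
            using 4 kk k by (auto simp: path_vertex_def)
        qed
      qed
    qed
  qed
qed

lemma path_map_id_contraction:
  assumes pos: "\<And>i. i < length es \<Longrightarrow> 0 < m i" and eq: "\<And>i. i < length es \<Longrightarrow> m' i = m i"
  shows "contraction (S m') (S m) (path_map (\<lambda>i j. j) m' m)"
proof (rule contraction_isoI)
  note path = pos eq
  show "graph_morphism (S m') (S m) (path_map (\<lambda>i j. j) m' m)"
    by (rule path_map_morphism) (use path in auto)
  show "path_map (\<lambda>i j. j) m' m ` cells (S m') = cells (S m)"
    by (rule path_map_surj) (use path in auto)
  have "path_map (\<lambda>i j. j) m' m x = x" if "x \<in> cells (S m')" for x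
    using that
  proof (cases rule: cells_cases)
    case (1 y)
    then show ?thesis
      using eq by (cases y) (auto simp: path_map_simps path_vertex_def)
  next
    case (2 y)
    then show ?thesis by (cases y) (auto simp: path_map_simps)
  qed
  then show "inj_on (path_map (\<lambda>i j. j) m' m) (cells (S m'))"
    "\<And>d. d \<in> darts (S m') \<Longrightarrow> \<exists>d'. path_map (\<lambda>i j. j) m' m (Inr d) = Inr d'"
    by (auto simp: inj_on_def)
qed

end

section \<open>Contractions from a subdivision to a fixed graph\<close>

text \<open>This lets the sorted list of kept edges be shifted entry by entry.\<close>

lemma sorted_list_of_set_image:
  fixes f :: "'a::linorder \<Rightarrow> 'b::linorder"
  assumes "strict_mono f" "finite A"
  shows "sorted_list_of_set (f ` A) = map f (sorted_list_of_set A)"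
proof -
  have "sorted_wrt (\<lambda>x y. f x < f y) (sorted_list_of_set A)"
    by (rule sorted_wrt_mono_rel[OF _ strict_sorted_list_of_set]) (use assms(1) in \<open>auto simp: strict_mono_def\<close>)
  then have "sorted_wrt (<) (map f (sorted_list_of_set A))" by (simp add: sorted_wrt_map)
  moreover have "set (map f (sorted_list_of_set A)) = f ` A" using assms(2) by simp
  moreover have "length (map f (sorted_list_of_set A)) = card (f ` A)"
    using strict_mono_imp_inj_on[OF assms(1)] by (simp add: card_image inj_on_subset)
  ultimately show ?thesis
    using sorted_list_of_set_unique[of "f ` A" "map f (sorted_list_of_set A)"] assms(2) by blast
qed

lemma strict_mono_map_less:
  fixes f :: "'a::linorder \<Rightarrow> 'b::linorder"
  assumes "strict_mono f" "xs < ys"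
  shows "map f xs < map f ys"
  using assms(2)
proof (induction xs arbitrary: ys)
  case Nil
  then show ?case by (cases ys) auto
next
  case (Cons x xs)
  then show ?case
    using assms(1) by (cases ys) (auto simp: strict_mono_less strict_mono_eq)
qed

text \<open>The order on pairs is lexicographic, path number first, and the shift changes only the
  second component. This is the source of the stability of the order of contractions.\<close>

lemma strict_mono_shift: "strict_mono (shift i p)"
  by (rule strict_monoI) (auto simp: shift_def split: if_splits)

locale nsubdivision = subdivision G es for G :: ngraph and es :: "nat list"
begin

section \<open>The combinatorial data of a contraction from a subdivision\<close>

abbreviation \<Gamma> :: "(nat \<Rightarrow> nat) \<Rightarrow> ngraph" where
  "\<Gamma> m \<equiv> to_ngraph (S m)"

definition path_dart :: "nat \<times> nat \<Rightarrow> nat" where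
  "path_dart = (\<lambda>(i, j). to_nat (Inr (i, j, True) :: nat + nat \<times> nat \<times> bool))"

text \<open>The codes of cells inherited from \<open>G\<close> are the same for all
  \<open>m\<close>, so maps out of different subdivisions can be compared on them.\<close>

definition old_cell :: "nat + nat \<Rightarrow> nat + nat" where
  "old_cell = map_sum (\<lambda>v. to_nat (Inl v :: nat + nat \<times> nat)) (\<lambda>d. to_nat (Inl d :: nat + nat \<times> nat \<times> bool))"

definition old_cells :: "(nat + nat) set" where
  "old_cells = Inl ` verts G \<union> Inr ` {d \<in> darts G. edge_of G d \<notin> cut_edges}"

definition path_edges :: "(nat \<Rightarrow> nat) \<Rightarrow> (nat \<times> nat) set" where
  "path_edges m = (SIGMA i:{..<length es}. {..<m i})"

definition kept :: "(nat \<Rightarrow> nat) \<Rightarrow> ncellmap \<Rightarrow> (nat \<times> nat) set" where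
  "kept m \<phi> = {x \<in> path_edges m. \<exists>d. \<phi> (Inr (path_dart x)) = Inr d}"

definition old_part :: "ncellmap \<Rightarrow> ncellmap" where
  "old_part \<phi> = restrict (\<lambda>x. \<phi> (old_cell x)) old_cells"

text \<open>Positions are left out, so that the list survives insertions; path numbers are included,
  so that the list determines how many kept edges lie in each path.\<close>

definition labels :: "(nat \<Rightarrow> nat) \<Rightarrow> ncellmap \<Rightarrow> (nat \<times> (nat + nat)) list" where
  "labels m \<phi> = map (\<lambda>x. (fst x, \<phi> (Inr (path_dart x)))) (sorted_list_of_set (kept m \<phi>))"

lemma finite_path_edges: "finite (path_edges m)"
  by (simp add: path_edges_def)

lemma finite_kept: "finite (kept m \<phi>)"
  by (rule finite_subset[OF _ finite_path_edges[of m]]) (auto simp: kept_def)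

lemma path_dart_in_darts: "x \<in> path_edges m \<Longrightarrow> path_dart x \<in> darts (\<Gamma> m)"
  by (cases x) (auto simp: path_edges_def path_dart_def)

lemma old_cell_in_cells: "x \<in> old_cells \<Longrightarrow> old_cell x \<in> cells (\<Gamma> m)"
  by (auto simp: old_cells_def old_cell_def)

lemma finite_old_cells: "finite old_cells"
  using wf_graph_finite[OF wf] by (simp add: old_cells_def)

lemma wf_\<Gamma>: "wf_graph (\<Gamma> m)"
  by (rule wf_to_ngraph[OF wf_subdivide])

text \<open>Follow each path from its initial vertex, whose image is part of the old data: a kept
  edge leads to the head of its known image, a collapsed edge stays at the same vertex.\<close>

lemma labels_kept_old_part_determine:
  assumes \<phi>: "graph_morphism (\<Gamma> m) H \<phi>" and \<psi>: "graph_morphism (\<Gamma> m) H \<psi>"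
    and kept: "kept m \<phi> = kept m \<psi>" and labels: "labels m \<phi> = labels m \<psi>"
    and old: "old_part \<phi> = old_part \<psi>"
  shows "\<phi> = \<psi>"
proof -
  have old_eq: "\<phi> (old_cell x) = \<psi> (old_cell x)" if "x \<in> old_cells" for x
    using fun_cong[OF old, of x] that by (simp add: old_part_def)
  have kept_eq: "\<phi> (Inr (path_dart x)) = \<psi> (Inr (path_dart x))" if "x \<in> kept m \<phi>" for x
    using labels that unfolding labels_def kept[symmetric] map_eq_conv
    by (simp add: finite_kept)
  have dart: "path_dart (i, j) \<in> darts (\<Gamma> m)"
    "tail (\<Gamma> m) (path_dart (i, j)) = to_nat (pv m i j)"
    "head (\<Gamma> m) (path_dart (i, j)) = to_nat (pv m i (Suc j))"
    "opp (\<Gamma> m) (path_dart (i, j)) = to_nat (Inr (i, j, False) :: nat + nat \<times> nat \<times> bool)"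
    if "i < length es" "j < m i" for i j
    using that by (auto simp: path_dart_def)
  have lost: "\<exists>w. \<xi> (Inr (path_dart (i, j))) = Inl w \<and> \<xi> (Inl (to_nat (pv m i j))) = Inl w \<and>
      \<xi> (Inl (to_nat (pv m i (Suc j)))) = Inl w"
    if \<xi>: "graph_morphism (\<Gamma> m) H \<xi>" and ij: "i < length es" "j < m i" "(i, j) \<notin> kept m \<xi>" for \<xi> i j
    using \<xi> wf_\<Gamma> dart(1)[OF ij(1,2)]
  proof (rule graph_morphism_dart)
    fix w assume "\<xi> (Inr (path_dart (i, j))) = Inl w" "\<xi> (Inl (tail (\<Gamma> m) (path_dart (i, j)))) = Inl w"
      "\<xi> (Inl (head (\<Gamma> m) (path_dart (i, j)))) = Inl w"
    then show ?thesis unfolding dart(2,3)[OF ij(1,2)] by blast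
  next
    fix d' assume "\<xi> (Inr (path_dart (i, j))) = Inr d'"
    then show ?thesis using ij by (auto simp: kept_def path_edges_def)
  qed
  have pv_eq: "\<phi> (Inl (to_nat (pv m i j))) = \<psi> (Inl (to_nat (pv m i j)))" if "i < length es" "j \<le> m i" for i j
    using that(2)
  proof (induction j)
    case 0
    have "Inl (to_nat (pv m i 0)) = old_cell (Inl (tail G (es ! i)))"
      by (simp add: path_vertex_def old_cell_def)
    then show ?case using old_eq[of "Inl (tail G (es ! i))"] wf_graphD(1)[OF wf es_nth[OF that(1)]]
      by (simp add: old_cells_def)
  next
    case (Suc j)
    then have j: "j < m i" by simp
    show ?case
    proof (cases "(i, j) \<in> kept m \<phi>")
      case True
      then obtain d' where d': "\<phi> (Inr (path_dart (i, j))) = Inr d'" by (auto simp: kept_def)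
      then have d'': "\<psi> (Inr (path_dart (i, j))) = Inr d'" using kept_eq[OF True] by simp
      have head: "\<xi> (Inl (to_nat (pv m i (Suc j)))) = Inl (head H d')"
        if "graph_morphism (\<Gamma> m) H \<xi>" "\<xi> (Inr (path_dart (i, j))) = Inr d'" for \<xi>
        using that(1) wf_\<Gamma> dart(1)[OF \<open>i < length es\<close> j]
        by (rule graph_morphism_dart) (use that(2) in \<open>auto simp only: dart(3)[OF \<open>i < length es\<close> j]\<close>)
      show ?thesis using head[OF \<phi> d'] head[OF \<psi> d''] by simp
    next
      case False
      then show ?thesis
        using lost[OF \<phi> that(1) j] lost[OF \<psi> that(1) j] kept Suc by force
    qed
  qed
  have path_eq: "\<phi> (Inr (path_dart (i, j))) = \<psi> (Inr (path_dart (i, j)))" if "i < length es" "j < m i" for i j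
  proof (cases "(i, j) \<in> kept m \<phi>")
    case False
    then show ?thesis using lost[OF \<phi> that] lost[OF \<psi> that] kept pv_eq[OF that(1), of j] that(2) by force
  qed (rule kept_eq)
  have "\<phi> x = \<psi> x" if x: "x \<in> cells (\<Gamma> m)" for x
    using x
  proof (cases rule: cells_cases)
    case (1 n)
    then obtain y where y: "y \<in> verts (S m)" "n = to_nat y" by auto
    show ?thesis
    proof (cases y)
      case (Inl v)
      then show ?thesis using old_eq[of "Inl v"] 1 y by (auto simp: old_cell_def old_cells_def)
    next
      case (Inr ij)
      then obtain i j where "ij = (i, j)" "i < length es" "0 < j" "j < m i" using y by (cases ij) auto
      then show ?thesis using pv_eq[of i j] 1 y Inr by (simp add: path_vertex_def)
    qed
  next
    case (2 n)
    then obtain y where y: "y \<in> darts (S m)" "n = to_nat y" by auto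
    show ?thesis
    proof (cases y)
      case (Inl d)
      then show ?thesis using old_eq[of "Inr d"] 2 y by (auto simp: old_cell_def old_cells_def)
    next
      case (Inr ijb)
      then obtain i j b where ijb: "ijb = (i, j, b)" "i < length es" "j < m i" using y by (cases ijb) auto
      have opp: "\<xi> (Inr (to_nat (Inr (i, j, False) :: nat + nat \<times> nat \<times> bool))) = cell_opp H (\<xi> (Inr (path_dart (i, j))))"
        if "graph_morphism (\<Gamma> m) H \<xi>" for \<xi>
      proof -
        have "\<xi> (cell_opp (\<Gamma> m) (Inr (path_dart (i, j)))) = cell_opp H (\<xi> (Inr (path_dart (i, j))))"
          using that dart(1)[OF ijb(2,3)] unfolding graph_morphism_def by (metis Inr_in_cells)
        then show ?thesis using dart(4)[OF ijb(2,3)] by (simp add: cell_opp_def del: to_ngraph_simps)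
      qed
      show ?thesis
      proof (cases b)
        case True
        then show ?thesis using path_eq[OF ijb(2,3)] 2 y Inr ijb by (simp add: path_dart_def)
      next
        case False
        then show ?thesis using path_eq[OF ijb(2,3)] opp[OF \<phi>] opp[OF \<psi>] 2 y Inr ijb by simp
      qed
    qed
  qed
  moreover have "\<phi> \<in> extensional (cells (\<Gamma> m))" "\<psi> \<in> extensional (cells (\<Gamma> m))"
    using \<phi> \<psi> by (auto simp: graph_morphism_def PiE_def)
  ultimately show ?thesis by (rule extensionalityI[rotated 2])
qed

text \<open>Every dart of \<open>H\<close> has a single preimage, so two kept edges over one edge
  would be equal or opposite darts; \<open>path_dart\<close> uses only one orientation, which
  excludes the latter.\<close>

lemma card_kept_le:
  assumes \<phi>: "contraction (\<Gamma> m) H \<phi>" and H: "wf_graph H"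
  shows "card (kept m \<phi>) \<le> card (edges H)"
proof (rule card_inj_on_le[where f = "\<lambda>x. edge_of H (projr (\<phi> (Inr (path_dart x))))"])
  have m: "graph_morphism (\<Gamma> m) H \<phi>" using \<phi> by (simp add: contraction_def)
  show "finite (edges H)" using H by (simp add: edges_def wf_graph_def)
  have val: "\<exists>d\<in>darts H. \<phi> (Inr (path_dart x)) = Inr d \<and> \<phi> (Inr (opp (\<Gamma> m) (path_dart x))) = Inr (opp H d)"
    if "x \<in> kept m \<phi>" for x
  proof -
    have "path_dart x \<in> darts (\<Gamma> m)" using that path_dart_in_darts by (auto simp: kept_def)
    with m wf_\<Gamma> show ?thesis by (rule graph_morphism_dart) (use that in \<open>auto simp: kept_def\<close>)
  qed
  show "(\<lambda>x. edge_of H (projr (\<phi> (Inr (path_dart x))))) ` kept m \<phi> \<subseteq> edges H"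
    using val by (fastforce simp: edges_def)
  show "inj_on (\<lambda>x. edge_of H (projr (\<phi> (Inr (path_dart x))))) (kept m \<phi>)"
  proof (rule inj_onI)
    fix x y assume x: "x \<in> kept m \<phi>" and y: "y \<in> kept m \<phi>"
      and eq: "edge_of H (projr (\<phi> (Inr (path_dart x)))) = edge_of H (projr (\<phi> (Inr (path_dart y))))"
    obtain a where a: "a \<in> darts H" "\<phi> (Inr (path_dart x)) = Inr a" "\<phi> (Inr (opp (\<Gamma> m) (path_dart x))) = Inr (opp H a)"
      using val[OF x] by blast
    obtain b where b: "b \<in> darts H" "\<phi> (Inr (path_dart y)) = Inr b"
      using val[OF y] by blast
    have inj: "e = e'" if "e \<in> darts (\<Gamma> m)" "e' \<in> darts (\<Gamma> m)" "\<phi> (Inr e) = Inr b" "\<phi> (Inr e') = Inr b" for e e'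
      using \<phi> b(1) that unfolding contraction_def by blast
    have xy: "x \<in> path_edges m" "y \<in> path_edges m" using x y by (auto simp: kept_def)
    note dx = path_dart_in_darts[OF xy(1)] and dy = path_dart_in_darts[OF xy(2)]
    have "b \<in> {a, opp H a}" using eq a b by (auto simp: edge_of_def)
    then consider "b = a" | "b = opp H a" by blast
    then show "x = y"
    proof cases
      case 1
      then have "path_dart x = path_dart y" using inj[OF dx dy] a b by simp
      then show ?thesis by (cases x; cases y) (simp add: path_dart_def)
    next
      case 2
      then have "opp (\<Gamma> m) (path_dart x) = path_dart y"
        using inj[OF wf_graphD(2)[OF wf_\<Gamma> dx] dy] a b by simp
      then show ?thesis by (cases x; cases y) (simp add: path_dart_def)
    qed
  qed
qed

text \<open>\<open>f\<close> tells where the path edges of the shorter subdivision sit in the longer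
  one; \<open>e\<close> undoes \<open>f\<close>, fixes the old cells and collapses every other path
  edge. Monotonicity of \<open>f\<close> keeps the order of kept edges.\<close>

definition compatible :: "(nat \<Rightarrow> nat) \<Rightarrow> (nat \<Rightarrow> nat) \<Rightarrow> (nat \<times> nat \<Rightarrow> nat \<times> nat) \<Rightarrow> ncellmap \<Rightarrow> bool" where
  "compatible m' m f e \<longleftrightarrow> contraction (\<Gamma> m') (\<Gamma> m) e \<and> strict_mono f \<and>
     (\<forall>x\<in>old_cells. e (old_cell x) = old_cell x) \<and>
     (\<forall>x\<in>path_edges m. f x \<in> path_edges m' \<and> fst (f x) = fst x \<and> e (Inr (path_dart (f x))) = Inr (path_dart x)) \<and>
     (\<forall>y\<in>path_edges m'. y \<notin> f ` path_edges m \<longrightarrow> (\<exists>w. e (Inr (path_dart y)) = Inl w))"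

context
  fixes m' m f e and H :: ngraph and \<phi>
  assumes comp: "compatible m' m f e" and \<phi>: "graph_morphism (\<Gamma> m) H \<phi>"
begin

lemma kept_pullback_eq: "x \<in> path_edges m \<Longrightarrow> compose (cells (\<Gamma> m')) \<phi> e (Inr (path_dart (f x))) = \<phi> (Inr (path_dart x))"
  using comp path_dart_in_darts[of "f x" m'] unfolding compatible_def by (auto simp: compose_def simp del: to_ngraph_simps)

text \<open>An edge outside the range of \<open>f\<close> becomes a vertex under \<open>e\<close>,
  and a vertex has a vertex as its image under \<open>\<phi>\<close>.\<close>

lemma kept_pullback: "kept m' (compose (cells (\<Gamma> m')) \<phi> e) = f ` kept m \<phi>"
proof (intro equalityI subsetI)
  fix y assume y: "y \<in> kept m' (compose (cells (\<Gamma> m')) \<phi> e)"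
  then have yp: "y \<in> path_edges m'" by (simp add: kept_def)
  show "y \<in> f ` kept m \<phi>"
  proof (cases "y \<in> f ` path_edges m")
    case True
    then obtain x where "x \<in> path_edges m" "y = f x" by blast
    then show ?thesis using y kept_pullback_eq by (auto simp: kept_def)
  next
    case False
    then obtain w where w: "e (Inr (path_dart y)) = Inl w" using comp yp unfolding compatible_def by blast
    have "e (Inr (path_dart y)) \<in> cells (\<Gamma> m)"
      using comp path_dart_in_darts[OF yp] unfolding compatible_def contraction_def graph_morphism_def
      by (auto simp del: to_ngraph_simps)
    then have "w \<in> verts (\<Gamma> m)" using w by (simp del: to_ngraph_simps)
    then obtain u where "\<phi> (Inl w) = Inl u" by (rule graph_morphism_vertex[OF \<phi>])
    then show ?thesis using y w path_dart_in_darts[OF yp] by (auto simp: kept_def compose_def simp del: to_ngraph_simps)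
  qed
next
  fix y assume "y \<in> f ` kept m \<phi>"
  then obtain x where x: "x \<in> path_edges m" "y = f x" "\<exists>d. \<phi> (Inr (path_dart x)) = Inr d"
    by (auto simp: kept_def)
  then show "y \<in> kept m' (compose (cells (\<Gamma> m')) \<phi> e)"
    using kept_pullback_eq[OF x(1)] comp unfolding compatible_def kept_def by auto
qed

text \<open>The monotone \<open>f\<close> lists the kept edges in the same order and keeps path
  numbers and images.\<close>

lemma labels_pullback: "labels m' (compose (cells (\<Gamma> m')) \<phi> e) = labels m \<phi>"
proof -
  have f: "strict_mono f" using comp by (simp add: compatible_def)
  have fst: "fst (f x) = fst x" if "x \<in> path_edges m" for x using comp that by (simp add: compatible_def)
  show ?thesis
    unfolding labels_def kept_pullback sorted_list_of_set_image[OF f finite_kept] map_map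
    by (rule map_cong[OF refl]) (use kept_pullback_eq fst finite_kept in \<open>auto simp: kept_def\<close>)
qed

lemma old_part_pullback: "old_part (compose (cells (\<Gamma> m')) \<phi> e) = old_part \<phi>"
  using comp old_cell_in_cells[of _ m'] unfolding old_part_def compatible_def
  by (auto simp: compose_def fun_eq_iff simp del: to_ngraph_simps)

end

section \<open>Collapsing maps between the coded subdivisions\<close>

definition lifted_path_map :: "(nat \<Rightarrow> nat \<Rightarrow> nat) \<Rightarrow> (nat \<Rightarrow> nat) \<Rightarrow> (nat \<Rightarrow> nat) \<Rightarrow> ncellmap" where
  "lifted_path_map s m' m = compose (cells (\<Gamma> m'))
     (compose (cells (S m')) (encode (S m)) (path_map s m' m)) (decode (S m'))"

lemma lifted_path_map_contraction:
  assumes "contraction (S m') (S m) (path_map s m' m)"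
  shows "contraction (\<Gamma> m') (\<Gamma> m) (lifted_path_map s m' m)"
  unfolding lifted_path_map_def
  by (rule contraction_compose[OF decode_contraction[OF wf_subdivide]
        contraction_compose[OF assms encode_contraction[OF wf_subdivide] wf_subdivide wf_subdivide]
        wf_\<Gamma> wf_subdivide])

lemma lifted_path_map_apply:
  assumes "contraction (S m') (S m) (path_map s m' m)" "x \<in> cells (S m')"
  shows "lifted_path_map s m' m (map_sum to_nat to_nat x) = map_sum to_nat to_nat (path_map s m' m x)"
proof -
  have "map_sum to_nat to_nat x \<in> cells (\<Gamma> m')" using assms(2) by (auto elim!: cells_cases)
  moreover have "map_sum from_nat from_nat (map_sum to_nat to_nat x) = x" by (cases x) auto
  moreover have "path_map s m' m x \<in> cells (S m)"
    using assms unfolding contraction_def by blast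
  ultimately show ?thesis
    using assms(2) by (simp add: lifted_path_map_def compose_def encode_def decode_def)
qed

lemma lifted_path_map_old:
  assumes "contraction (S m') (S m) (path_map s m' m)" "x \<in> old_cells"
  shows "lifted_path_map s m' m (old_cell x) = old_cell x"
proof (cases x)
  case (Inl v)
  then have v: "v \<in> verts G" using assms(2) by (auto simp: old_cells_def)
  show ?thesis
    using lifted_path_map_apply[OF assms(1), of "Inl (Inl v)"] v Inl
    by (simp add: old_cell_def path_map_simps)
next
  case (Inr d)
  then have "Inl d \<in> darts (S m')" using assms(2) by (auto simp: old_cells_def)
  then show ?thesis
    using lifted_path_map_apply[OF assms(1), of "Inr (Inl d)"] path_map_simps(3)[of d m' s m] Inr
    by (simp add: old_cell_def)
qed

lemma lifted_path_map_path_dart: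
  assumes "contraction (S m') (S m) (path_map s m' m)" "(i, j) \<in> path_edges m'"
  shows "lifted_path_map s m' m (Inr (path_dart (i, j))) =
    (if s i (Suc j) = s i j then Inl (to_nat (pv m i (s i j))) else Inr (path_dart (i, s i j)))"
proof -
  have d: "Inr (i, j, True) \<in> darts (S m')" using assms(2) by (simp add: path_edges_def)
  then have "(Inr (Inr (i, j, True)) :: (nat + nat \<times> nat) + (nat + nat \<times> nat \<times> bool)) \<in> cells (S m')" by simp
  from lifted_path_map_apply[OF assms(1) this] show ?thesis
    unfolding path_map_simps(4)[OF d] path_dart_def by simp
qed

text \<open>\<open>shift i p\<close> skips exactly the edge that \<open>collapse_at i p\<close>
  collapses.\<close>

lemma compatible_shift:
  assumes pos: "\<And>i. i < length es \<Longrightarrow> 0 < m i" and i: "i < length es" and p: "p \<le> m i"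
  shows "\<exists>e. compatible (m(i := Suc (m i))) m (shift i p) e"
proof -
  let ?m' = "m(i := Suc (m i))" and ?s = "collapse_at i p"
  have con: "contraction (S ?m') (S m) (path_map ?s ?m' m)"
    by (rule path_map_collapse_contraction) (use assms in auto)
  have "compatible ?m' m (shift i p) (lifted_path_map ?s ?m' m)"
    unfolding compatible_def
  proof (intro conjI ballI impI)
    show "contraction (\<Gamma> ?m') (\<Gamma> m) (lifted_path_map ?s ?m' m)" by (rule lifted_path_map_contraction[OF con])
    show "strict_mono (shift i p)" by (rule strict_mono_shift)
    show "lifted_path_map ?s ?m' m (old_cell x) = old_cell x" if "x \<in> old_cells" for x
      by (rule lifted_path_map_old[OF con that])
    fix x assume x: "x \<in> path_edges m"
    obtain k j where kj: "x = (k, j)" by (cases x)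
    show sx: "shift i p x \<in> path_edges ?m'" and "fst (shift i p x) = fst x"
      using x kj by (auto simp: shift_def path_edges_def)
    show "lifted_path_map ?s ?m' m (Inr (path_dart (shift i p x))) = Inr (path_dart x)"
      using lifted_path_map_path_dart[OF con, of k "snd (shift i p x)"] sx kj
      by (auto simp: shift_def collapse_at_def split: if_splits)
  next
    fix y assume y: "y \<in> path_edges ?m'" "y \<notin> shift i p ` path_edges m"
    obtain k j where kj: "y = (k, j)" by (cases y)
    have "k = i \<and> j = p"
    proof (rule ccontr)
      assume "\<not> (k = i \<and> j = p)"
      then have "y = shift i p (k, ?s k j)" "(k, ?s k j) \<in> path_edges m"
        using y(1) kj p by (auto simp: shift_def collapse_at_def path_edges_def split: if_splits)
      then show False using y(2) by blast
    qed
    then show "\<exists>w. lifted_path_map ?s ?m' m (Inr (path_dart y)) = Inl w"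
      using lifted_path_map_path_dart[OF con, of k j] y(1) kj by (auto simp: collapse_at_def)
  qed
  then show ?thesis by blast
qed

text \<open>Subdivisions depend on \<open>m\<close> outside \<open>{..<length es}\<close>, through the values of \<open>tail\<close> on
  non-darts. So \<open>m\<close> and \<open>m'\<close> that agree on this set give graphs that are isomorphic but not
  equal.\<close>

lemma compatible_id:
  assumes pos: "\<And>i. i < length es \<Longrightarrow> 0 < m i" and eq: "\<And>i. i < length es \<Longrightarrow> m' i = m i"
  shows "\<exists>e. compatible m' m id e"
proof -
  let ?s = "\<lambda>i j. j"
  have con: "contraction (S m') (S m) (path_map ?s m' m)"
    by (rule path_map_id_contraction) (use assms in auto)
  have pe: "path_edges m' = path_edges m" using eq by (auto simp: path_edges_def)
  have "compatible m' m id (lifted_path_map ?s m' m)"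
    unfolding compatible_def
  proof (intro conjI ballI impI)
    show "contraction (\<Gamma> m') (\<Gamma> m) (lifted_path_map ?s m' m)" by (rule lifted_path_map_contraction[OF con])
    show "strict_mono (id :: nat \<times> nat \<Rightarrow> _)" by (simp add: strict_mono_def)
    show "lifted_path_map ?s m' m (old_cell x) = old_cell x" if "x \<in> old_cells" for x
      by (rule lifted_path_map_old[OF con that])
    fix x assume x: "x \<in> path_edges m"
    then show "id x \<in> path_edges m'" "fst (id x) = fst x" by (auto simp: pe)
    show "lifted_path_map ?s m' m (Inr (path_dart (id x))) = Inr (path_dart x)"
      using lifted_path_map_path_dart[OF con, of "fst x" "snd x"] x by (simp add: pe)
  qed (auto simp: pe)
  then show ?thesis by blast
qed

end

section \<open>Leading terms of subrepresentations of a finitely generated representation\<close>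

lemma hom_span_subset:
  assumes A: "Module.module K A" and B: "Module.module K B" and f: "f \<in> LinearCombinations.module_hom K A B"
    and X: "X \<subseteq> carrier A" and U: "submod K U B" and fX: "f ` X \<subseteq> U"
  shows "f ` LinearCombinations.module.span K A X \<subseteq> U"
proof -
  interpret A: Module.module K A by (rule A)
  interpret B: Module.module K B by (rule B)
  interpret mod_hom K A B f by unfold_locales (rule f)
  have "submod K {x \<in> carrier A. f x \<in> U} A"
    by (rule LinearCombinations.submodule.intro[OF A])
      (use submod_add[OF U] submod_zero[OF U]
        submod_smult[OF U] in auto)
  moreover have "X \<subseteq> {x \<in> carrier A. f x \<in> U}" using X fX by blast
  ultimately have "A.span X \<subseteq> {x \<in> carrier A. f x \<in> U}" by (intro A.span_is_subset)
  then show ?thesis by blast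
qed

locale generators = nsubdivision +
  fixes K :: "('a, 'r) ring_scheme" and g d :: nat and P :: "('a, 'c) rep" and gens :: "(ngraph \<times> 'c) set"
  assumes P: "is_rep K g P" and G_genus: "graph_of_genus g G" and finite_gens: "finite gens"
    and gens: "\<forall>(H, v)\<in>gens. graph_of_genus g H \<and> card (edges H) \<le> d \<and> v \<in> carrier (obj P H)"
    and gens_span: "\<forall>G. graph_of_genus g G \<longrightarrow> carrier (obj P G) =
        LinearCombinations.module.span K (obj P G)
          {act P G H \<phi> v |H v \<phi>. (H, v) \<in> gens \<and> contraction_in g G H \<phi>}"
begin

section \<open>Indices, types and the order of the generating vectors\<close>

definition pos :: "(nat \<Rightarrow> nat) \<Rightarrow> bool" where
  "pos m \<longleftrightarrow> (\<forall>i<length es. 0 < m i)"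

lemma \<Gamma>_genus: "pos m \<Longrightarrow> graph_of_genus g (\<Gamma> m)"
  using G_genus wf_\<Gamma>[of m] connected_to_ngraph[OF connected_subdivide[of m]]
    genus_to_ngraph[OF wf_subdivide] genus_subdivide[of m]
  unfolding graph_of_genus_def pos_def by (auto simp: subdivide_def)

text \<open>Indices rather than vectors: different contractions may induce equal or dependent
  vectors, and leading terms live in the free space on these triples.\<close>

definition base :: "(nat \<Rightarrow> nat) \<Rightarrow> (ngraph \<times> 'c \<times> ncellmap) set" where
  "base m = {(H, v, \<phi>). (H, v) \<in> gens \<and> contraction_in g (\<Gamma> m) H \<phi>}"

definition vec :: "(nat \<Rightarrow> nat) \<Rightarrow> ngraph \<times> 'c \<times> ncellmap \<Rightarrow> 'c" where
  "vec m = (\<lambda>(H, v, \<phi>). act P (\<Gamma> m) H \<phi> v)"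

definition type_of ::
  "(nat \<Rightarrow> nat) \<Rightarrow> ngraph \<times> 'c \<times> ncellmap \<Rightarrow> ngraph \<times> 'c \<times> ncellmap \<times> (nat \<times> (nat + nat)) list" where
  "type_of m = (\<lambda>(H, v, \<phi>). (H, v, old_part \<phi>, labels m \<phi>))"

definition kept_of :: "(nat \<Rightarrow> nat) \<Rightarrow> ngraph \<times> 'c \<times> ncellmap \<Rightarrow> (nat \<times> nat) set" where
  "kept_of m = (\<lambda>(H, v, \<phi>). kept m \<phi>)"

definition types :: "(ngraph \<times> 'c \<times> ncellmap \<times> (nat \<times> (nat + nat)) list) set" where
  "types = {type_of m b |m b. pos m \<and> b \<in> base m}"

lemma baseD:
  assumes "(H, v, \<phi>) \<in> base m"
  shows "(H, v) \<in> gens" "contraction_in g (\<Gamma> m) H \<phi>" "graph_of_genus g H" "card (edges H) \<le> d"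
    "v \<in> carrier (obj P H)" "contraction (\<Gamma> m) H \<phi>" "graph_morphism (\<Gamma> m) H \<phi>" "wf_graph H"
  using assms gens by (auto simp: base_def contraction_in_def contraction_def graph_of_genus_def)

lemma gens_wf: "(H, v) \<in> gens \<Longrightarrow> wf_graph H"
  using gens by (auto simp: graph_of_genus_def)

lemma type_of_in_types: "pos m \<Longrightarrow> b \<in> base m \<Longrightarrow> type_of m b \<in> types"
  unfolding types_def by blast

lemma finite_base: "finite (base m)"
proof (rule finite_subset)
  show "base m \<subseteq> (\<Union>(H, v)\<in>gens. {H} \<times> {v} \<times> (cells (\<Gamma> m) \<rightarrow>\<^sub>E cells H))"
    using baseD(1,7) by (fastforce simp: graph_morphism_def)
  show "finite (\<Union>(H, v)\<in>gens. {H} \<times> {v} \<times> (cells (\<Gamma> m) \<rightarrow>\<^sub>E cells H))"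
  proof (rule finite_UN_I[OF finite_gens])
    fix p assume p: "p \<in> gens"
    obtain H v where Hv: "p = (H, v)" by (cases p)
    have "finite (cells (\<Gamma> m) \<rightarrow>\<^sub>E cells H)"
      by (rule finite_PiE) (use finite_cells[OF wf_\<Gamma>] finite_cells[OF gens_wf] p Hv in auto)
    then show "finite (case p of (H, v) \<Rightarrow> {H} \<times> {v} \<times> (cells (\<Gamma> m) \<rightarrow>\<^sub>E cells H))"
      unfolding Hv by (simp only: prod.case) (intro finite_cartesian_product; simp)
  qed
qed

text \<open>A bound that does not involve \<open>m\<close>: the values on old cells form a function
  between fixed finite sets, and the list of labels has at most \<open>d\<close> entries from a
  fixed finite set.\<close>

lemma finite_types: "finite types"
proof (rule finite_subset)
  let ?X = "\<lambda>H. {xs :: (nat \<times> (nat + nat)) list. set xs \<subseteq> {..<length es} \<times> cells H \<and> length xs \<le> d}"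
  show "types \<subseteq> (\<Union>(H, v)\<in>gens. {H} \<times> {v} \<times> (old_cells \<rightarrow>\<^sub>E cells H) \<times> ?X H)"
  proof
    fix \<tau> assume "\<tau> \<in> types"
    then obtain m H v \<phi> where b: "(H, v, \<phi>) \<in> base m" "\<tau> = (H, v, old_part \<phi>, labels m \<phi>)"
      by (auto simp: types_def type_of_def)
    note b' = baseD[OF b(1)]
    have img: "\<phi> x \<in> cells H" if "x \<in> cells (\<Gamma> m)" for x
      using b'(7) that by (auto simp: graph_morphism_def)
    have "old_part \<phi> \<in> old_cells \<rightarrow>\<^sub>E cells H"
      using img old_cell_in_cells[of _ m] by (auto simp: old_part_def simp del: to_ngraph_simps)
    moreover have "labels m \<phi> \<in> ?X H"
    proof -
      have "(fst x, \<phi> (Inr (path_dart x))) \<in> {..<length es} \<times> cells H" if "x \<in> kept m \<phi>" for x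
      proof -
        have x: "x \<in> path_edges m" using that by (simp add: kept_def)
        have "\<phi> (Inr (path_dart x)) \<in> cells H"
          by (rule img) (use path_dart_in_darts[OF x] in \<open>simp del: to_ngraph_simps\<close>)
        then show ?thesis using x by (auto simp: path_edges_def)
      qed
      then show ?thesis
        using card_kept_le[OF b'(6,8)] b'(4) finite_kept[of m \<phi>] by (auto simp: labels_def)
    qed
    ultimately show "\<tau> \<in> (\<Union>(H, v)\<in>gens. {H} \<times> {v} \<times> (old_cells \<rightarrow>\<^sub>E cells H) \<times> ?X H)"
      using b'(1) b(2) by blast
  qed
  have fin: "finite (?X H)" if "wf_graph H" for H
    using finite_lists_length_le[of "{..<length es} \<times> cells H" d] finite_cells[OF that] by simp
  show "finite (\<Union>(H, v)\<in>gens. {H} \<times> {v} \<times> (old_cells \<rightarrow>\<^sub>E cells H) \<times> ?X H)"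
  proof (intro finite_UN_I[OF finite_gens])
    fix p assume p: "p \<in> gens"
    obtain H v where Hv: "p = (H, v)" by (cases p)
    then have H: "wf_graph H" using gens_wf p by blast
    have "finite (old_cells \<rightarrow>\<^sub>E cells H)"
      by (rule finite_PiE) (use finite_old_cells finite_cells[OF H] in auto)
    with fin[OF H] show "finite (case p of (H, v) \<Rightarrow> {H} \<times> {v} \<times> (old_cells \<rightarrow>\<^sub>E cells H) \<times> ?X H)"
      unfolding Hv by (simp only: prod.case) (intro finite_cartesian_product; simp)
  qed
qed

text \<open>One arbitrary numbering serves all \<open>m\<close>, so that contractions from different
  subdivisions with the same types are compared in the same way.\<close>

definition type_index :: "ngraph \<times> 'c \<times> ncellmap \<times> (nat \<times> (nat + nat)) list \<Rightarrow> nat" where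
  "type_index = (SOME h. inj_on h types)"

lemma inj_type_index: "inj_on type_index types"
proof -
  obtain h :: "ngraph \<times> 'c \<times> ncellmap \<times> (nat \<times> (nat + nat)) list \<Rightarrow> nat" where "inj_on h types"
    using finite_imp_inj_to_nat_seg[OF finite_types] by blast
  then show ?thesis unfolding type_index_def by (rule someI[of "\<lambda>h. inj_on h types"])
qed

text \<open>The type comes first because pullback does not change it; within a type the kept edges
  decide.\<close>

definition key :: "(nat \<Rightarrow> nat) \<Rightarrow> ngraph \<times> 'c \<times> ncellmap \<Rightarrow> nat \<times> (nat \<times> nat) list" where
  "key m b = (type_index (type_of m b), sorted_list_of_set (kept_of m b))"

lemma type_of_kept_of_inj:
  assumes "b \<in> base m" "b' \<in> base m" "type_of m b = type_of m b'" "kept_of m b = kept_of m b'"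
  shows "b = b'"
proof -
  obtain H v \<phi> where b: "b = (H, v, \<phi>)" by (cases b)
  obtain H' v' \<psi> where b': "b' = (H', v', \<psi>)" by (cases b')
  have "H' = H" "v' = v" "old_part \<phi> = old_part \<psi>" "labels m \<phi> = labels m \<psi>" "kept m \<phi> = kept m \<psi>"
    using assms(3,4) by (auto simp: b b' type_of_def kept_of_def)
  moreover have "\<phi> = \<psi>"
    by (rule labels_kept_old_part_determine[OF baseD(7)[OF assms(1)[unfolded b]]])
      (use calculation baseD(7)[OF assms(2)[unfolded b']] in auto)
  ultimately show ?thesis by (simp add: b b')
qed

lemma finite_kept_of: "finite (kept_of m b)"
  by (cases b) (simp add: kept_of_def finite_kept)

lemma inj_key:
  assumes "pos m"
  shows "inj_on (key m) (base m)"
proof (rule inj_onI)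
  fix b b' assume b: "b \<in> base m" "b' \<in> base m" "key m b = key m b'"
  have "type_of m b \<in> types" "type_of m b' \<in> types"
    using b assms type_of_in_types by blast+
  then have "type_of m b = type_of m b'" using b(3) inj_onD[OF inj_type_index] by (simp add: key_def)
  moreover have "set (sorted_list_of_set (kept_of m b)) = set (sorted_list_of_set (kept_of m b'))"
    using b(3) by (simp add: key_def)
  then have "kept_of m b = kept_of m b'" by (simp add: finite_kept_of)
  ultimately show "b = b'" by (rule type_of_kept_of_inj[OF b(1,2)])
qed

lemma obj_vectorspace: "graph_of_genus g X \<Longrightarrow> vectorspace K (obj P X)"
  using P by (simp add: is_rep_def)

lemma obj_module: "graph_of_genus g X \<Longrightarrow> Module.module K (obj P X)"
  using obj_vectorspace vectorspace.axioms(1) by blast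

lemma act_hom: "contraction_in g X Y \<phi> \<Longrightarrow> act P X Y \<phi> \<in> LinearCombinations.module_hom K (obj P Y) (obj P X)"
  using P by (simp add: is_rep_def)

lemma vec_in_carrier: "vec m ` base m \<subseteq> carrier (obj P (\<Gamma> m))"
proof
  fix x assume "x \<in> vec m ` base m"
  then obtain H v \<phi> where b: "(H, v, \<phi>) \<in> base m" "x = act P (\<Gamma> m) H \<phi> v" by (auto simp: vec_def)
  then show "x \<in> carrier (obj P (\<Gamma> m))"
    using act_hom[OF baseD(2)[OF b(1)]] baseD(5)[OF b(1)] LinearCombinations.module_hom_closed by blast
qed

lemma vec_span:
  assumes "pos m"
  shows "LinearCombinations.module.span K (obj P (\<Gamma> m)) (vec m ` base m) = carrier (obj P (\<Gamma> m))"
proof -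
  have "vec m ` base m = {act P (\<Gamma> m) H \<phi> v |H v \<phi>. (H, v) \<in> gens \<and> contraction_in g (\<Gamma> m) H \<phi>}"
    unfolding base_def vec_def by force
  then show ?thesis using gens_span \<Gamma>_genus[OF assms] by simp
qed

definition lead :: "(ngraph \<Rightarrow> 'c set) \<Rightarrow> (nat \<Rightarrow> nat) \<Rightarrow> (ngraph \<times> 'c \<times> ncellmap) set" where
  "lead W m = leading K (obj P (\<Gamma> m)) (vec m) (key m) (base m) (W (\<Gamma> m))"

lemma lead_subset: "lead W m \<subseteq> base m"
  unfolding lead_def by (rule leading_subset)

definition pull :: "(nat \<Rightarrow> nat) \<Rightarrow> ncellmap \<Rightarrow> ngraph \<times> 'c \<times> ncellmap \<Rightarrow> ngraph \<times> 'c \<times> ncellmap" where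
  "pull m' e = (\<lambda>(H, v, \<phi>). (H, v, compose (cells (\<Gamma> m')) \<phi> e))"

section \<open>Stability of leading terms under pullback\<close>

context
  fixes m' m f e
  assumes comp: "compatible m' m f e" and pm': "pos m'" and pm: "pos m"
begin

lemma contraction_in_compatible: "contraction_in g (\<Gamma> m') (\<Gamma> m) e"
  using comp \<Gamma>_genus[OF pm] \<Gamma>_genus[OF pm'] by (simp add: contraction_in_def compatible_def)

lemma pull_base:
  assumes "b \<in> base m"
  shows "pull m' e b \<in> base m'" "type_of m' (pull m' e b) = type_of m b" "kept_of m' (pull m' e b) = f ` kept_of m b"
    "vec m' (pull m' e b) = act P (\<Gamma> m') (\<Gamma> m) e (vec m b)"
proof -
  obtain H v \<phi> where b: "b = (H, v, \<phi>)" by (cases b)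
  note b' = baseD[OF assms[unfolded b]]
  let ?\<chi> = "compose (cells (\<Gamma> m')) \<phi> e"
  have "contraction (\<Gamma> m') H ?\<chi>"
    by (rule contraction_compose[OF _ b'(6) wf_\<Gamma> wf_\<Gamma>]) (use comp in \<open>simp add: compatible_def\<close>)
  then show "pull m' e b \<in> base m'"
    using b' \<Gamma>_genus[OF pm'] by (simp add: pull_def b base_def contraction_in_def)
  show "type_of m' (pull m' e b) = type_of m b"
    using old_part_pullback[OF comp b'(7)] labels_pullback[OF comp b'(7)] by (simp add: type_of_def pull_def b)
  show "kept_of m' (pull m' e b) = f ` kept_of m b"
    using kept_pullback[OF comp b'(7)] by (simp add: kept_of_def pull_def b)
  show "vec m' (pull m' e b) = act P (\<Gamma> m') (\<Gamma> m) e (vec m b)"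
    using P contraction_in_compatible b'(2,5) unfolding is_rep_def by (simp add: vec_def pull_def b)
qed

text \<open>Types are unchanged, and the lists of kept edges are both mapped entrywise by the
  strictly increasing \<open>f\<close>, which keeps their lexicographic order.\<close>

lemma key_pull_less:
  assumes "b \<in> base m" "c \<in> base m" "key m c < key m b"
  shows "key m' (pull m' e c) < key m' (pull m' e b)"
proof -
  have f: "strict_mono f" using comp by (simp add: compatible_def)
  show ?thesis
    using assms(3) strict_mono_map_less[OF f]
    by (auto simp: key_def pull_base(2,3)[OF assms(1)] pull_base(2,3)[OF assms(2)]
        sorted_list_of_set_image[OF f finite_kept_of])
qed

text \<open>The induced map sends an element of \<open>W\<close> led by \<open>b\<close> to an
  element of \<open>W\<close>. It moves the vector of every smaller index to that of a smaller
  index, so the image is led by the pullback of \<open>b\<close>.\<close>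

lemma pull_lead:
  assumes W: "is_subrep K g P W" and b: "b \<in> lead W m"
  shows "pull m' e b \<in> lead W m'"
proof -
  let ?V = "obj P (\<Gamma> m)" and ?V' = "obj P (\<Gamma> m')" and ?a = "act P (\<Gamma> m') (\<Gamma> m) e"
  let ?C = "{c \<in> base m. key m c < key m b}"
  let ?C' = "{c \<in> base m'. key m' c < key m' (pull m' e b)}"
  have bb: "b \<in> base m" by (rule subsetD[OF lead_subset b])
  obtain u where u: "u \<in> LinearCombinations.module.span K ?V (vec m ` ?C)" "vec m b \<oplus>\<^bsub>?V\<^esub> u \<in> W (\<Gamma> m)"
    using b unfolding lead_def leading_def by blast
  note mV = obj_module[OF \<Gamma>_genus[OF pm]] and mV' = obj_module[OF \<Gamma>_genus[OF pm']]
  have hom: "?a \<in> LinearCombinations.module_hom K ?V ?V'" by (rule act_hom[OF contraction_in_compatible])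
  have C: "vec m ` ?C \<subseteq> carrier ?V" and C': "vec m' ` ?C' \<subseteq> carrier ?V'"
    using vec_in_carrier[of m] vec_in_carrier[of m'] by auto
  have "?a ` (vec m ` ?C) \<subseteq> vec m' ` ?C'"
  proof
    fix x assume "x \<in> ?a ` (vec m ` ?C)"
    then obtain c where c: "c \<in> base m" "key m c < key m b" "x = ?a (vec m c)" by blast
    then have "x = vec m' (pull m' e c)" "pull m' e c \<in> ?C'"
      using pull_base[OF c(1)] key_pull_less[OF bb c(1,2)] by auto
    then show "x \<in> vec m' ` ?C'" by blast
  qed
  then have img: "?a ` (vec m ` ?C) \<subseteq> LinearCombinations.module.span K ?V' (vec m' ` ?C')"
    using LinearCombinations.module.in_own_span[OF mV' C'] by blast
  have au: "?a u \<in> LinearCombinations.module.span K ?V' (vec m' ` ?C')"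
    using hom_span_subset[OF mV mV' hom C LinearCombinations.module.span_is_submodule[OF mV' C'] img] u(1) by blast
  have uc: "u \<in> carrier ?V" using LinearCombinations.module.span_is_subset2[OF mV C] u(1) by blast
  have vc: "vec m b \<in> carrier ?V" using vec_in_carrier bb by blast
  have "?a (vec m b \<oplus>\<^bsub>?V\<^esub> u) = vec m' (pull m' e b) \<oplus>\<^bsub>?V'\<^esub> ?a u"
    using LinearCombinations.module_hom_add[OF hom vc uc] pull_base(4)[OF bb] by simp
  moreover have "?a (vec m b \<oplus>\<^bsub>?V\<^esub> u) \<in> W (\<Gamma> m')"
    using W contraction_in_compatible u(2) unfolding is_subrep_def by blast
  ultimately have "vec m' (pull m' e b) \<oplus>\<^bsub>?V'\<^esub> ?a u \<in> W (\<Gamma> m')" by simp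
  then show ?thesis
    using au pull_base(1)[OF bb] unfolding lead_def leading_def by blast
qed

end

text \<open>Empty if some path would have no edges, so that membership always provides
  \<open>pos m\<close>.\<close>

definition kept_sets where
  "kept_sets W \<tau> m = (if pos m then {kept_of m b |b. b \<in> lead W m \<and> type_of m b = \<tau>} else {})"

lemma kept_setsE:
  assumes "J \<in> kept_sets W \<tau> m"
  obtains b where "pos m" "b \<in> lead W m" "b \<in> base m" "type_of m b = \<tau>" "J = kept_of m b"
proof -
  obtain b where "pos m" "b \<in> lead W m" "type_of m b = \<tau>" "J = kept_of m b"
    using assms by (auto simp: kept_sets_def split: if_splits)
  moreover from this(2) have "b \<in> base m" by (rule subsetD[OF lead_subset])
  ultimately show thesis using that by blast
qed

lemma kept_sets_pull:
  assumes "compatible m' m f e" "pos m'" "is_subrep K g P W" "J \<in> kept_sets W \<tau> m"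
  shows "f ` J \<in> kept_sets W \<tau> m'"
proof -
  obtain b where b: "pos m" "b \<in> lead W m" "b \<in> base m" "type_of m b = \<tau>" "J = kept_of m b"
    using assms(4) by (rule kept_setsE)
  have "pull m' e b \<in> lead W m'" by (rule pull_lead[OF assms(1,2) b(1) assms(3) b(2)])
  moreover have "type_of m' (pull m' e b) = \<tau>" "kept_of m' (pull m' e b) = f ` J"
    using pull_base[OF assms(1,2) b(1,3)] b by auto
  ultimately show ?thesis
    unfolding kept_sets_def if_P[OF assms(2)] by (intro CollectI exI[of _ "pull m' e b"] conjI) simp_all
qed

section \<open>The number of leading terms of each type\<close>

definition type_count :: "ngraph \<times> 'c \<times> ncellmap \<times> (nat \<times> (nat + nat)) list \<Rightarrow> nat \<Rightarrow> nat" where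
  "type_count = (\<lambda>(H, v, \<alpha>, xs) i. length (filter (\<lambda>x. fst x = i) xs))"

lemma card_kept_of_fiber: "card {j. (i, j) \<in> kept_of m b} = type_count (type_of m b) i"
proof -
  obtain H v \<phi> where b: "b = (H, v, \<phi>)" by (cases b)
  let ?l = "sorted_list_of_set (kept m \<phi>)"
  have "type_count (type_of m b) i = length (filter (\<lambda>x. fst x = i) ?l)"
    by (simp add: type_count_def type_of_def b labels_def filter_map comp_def)
  also have "\<dots> = card (set (filter (\<lambda>x. fst x = i) ?l))"
    by (rule distinct_card[symmetric]) simp
  also have "set (filter (\<lambda>x. fst x = i) ?l) = Pair i ` {j. (i, j) \<in> kept m \<phi>}"
    using finite_kept[of m \<phi>] by auto
  also have "card \<dots> = card {j. (i, j) \<in> kept m \<phi>}"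
    by (rule card_image) (simp add: inj_on_def)
  finally show ?thesis by (simp add: kept_of_def b)
qed

lemma kept_of_subset: "kept_of m b \<subseteq> {(i, j). i < length es \<and> j < m i}"
  by (cases b) (auto simp: kept_of_def kept_def path_edges_def)

text \<open>The origin of the degree bound: kept edges are at most as many as the edges of the
  target, which is one of the generating graphs.\<close>

lemma sum_type_count_le:
  assumes "\<tau> \<in> types"
  shows "(\<Sum>i<length es. type_count \<tau> i) \<le> d"
proof -
  obtain m b where b: "b \<in> base m" "\<tau> = type_of m b" using assms by (auto simp: types_def)
  obtain H v \<phi> where b': "b = (H, v, \<phi>)" by (cases b)
  have "kept_of m b = (SIGMA i:{..<length es}. {j. (i, j) \<in> kept_of m b})"
    using kept_of_subset[of m b] by auto
  moreover have "finite {j. (i, j) \<in> kept_of m b}" for i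
    by (rule finite_subset[OF _ finite_imageI[OF finite_kept_of[of m b], of snd]]) force
  ultimately have "card (kept_of m b) = (\<Sum>i<length es. card {j. (i, j) \<in> kept_of m b})"
    by (metis (no_types, lifting) card_SigmaI finite_lessThan sum.cong)
  also have "\<dots> = (\<Sum>i<length es. type_count \<tau> i)" by (simp only: card_kept_of_fiber b(2))
  finally show ?thesis
    using card_kept_le[OF baseD(6,8)[OF b(1)[unfolded b']]] baseD(4)[OF b(1)[unfolded b']]
    by (simp add: b' kept_of_def)
qed

lemma eventually_poly_kept_sets:
  assumes W: "is_subrep K g P W"
  shows "eventually_poly (length es) (\<Sum>i<length es. type_count \<tau> i) (\<lambda>m. of_nat (card (kept_sets W \<tau> m)))"
proof (rule eventually_poly_shift_closed)
  show "J \<subseteq> {(i, j). i < length es \<and> j < m i}" if "J \<in> kept_sets W \<tau> m" for m J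
    using that kept_of_subset by (blast elim: kept_setsE)
  show "card {j. (i, j) \<in> J} = type_count \<tau> i" if "J \<in> kept_sets W \<tau> m" for m J i
    using that by (rule kept_setsE) (simp add: card_kept_of_fiber)
next
  fix m J i p assume *: "J \<in> kept_sets W \<tau> m" "\<And>i. i < length es \<Longrightarrow> 0 < m i" "i < length es" "p \<le> m i"
  obtain e where "compatible (m(i := Suc (m i))) m (shift i p) e"
    using compatible_shift[of m i p] * by blast
  then show "shift i p ` J \<in> kept_sets W \<tau> (m(i := Suc (m i)))"
    by (rule kept_sets_pull[OF _ _ W *(1)]) (use * in \<open>auto simp: pos_def\<close>)
next
  fix m m' :: "nat \<Rightarrow> nat" assume *: "\<And>i. i < length es \<Longrightarrow> 0 < m i" "\<And>i. i < length es \<Longrightarrow> m i = m' i"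
  obtain e where e: "compatible m' m id e" using compatible_id[of m m'] * by fastforce
  have "pos m'" using * by (auto simp: pos_def)
  show "kept_sets W \<tau> m \<subseteq> kept_sets W \<tau> m'"
  proof
    fix J assume "J \<in> kept_sets W \<tau> m"
    from kept_sets_pull[OF e \<open>pos m'\<close> W this] show "J \<in> kept_sets W \<tau> m'" by simp
  qed
qed

lemma finite_lead: "finite (lead W m)"
  by (rule finite_subset[OF lead_subset finite_base])

text \<open>Type and kept set together determine a contraction, so leading terms are counted without
  repetition type by type.\<close>

lemma card_lead:
  assumes "pos m"
  shows "card (lead W m) = (\<Sum>\<tau>\<in>types. card (kept_sets W \<tau> m))"
proof -
  note sub = lead_subset[of W m]
  have "inj_on (\<lambda>b. (type_of m b, kept_of m b)) (lead W m)"
    by (rule inj_onI, rule type_of_kept_of_inj[of _ m]) (use sub in auto)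
  then have "card (lead W m) = card ((\<lambda>b. (type_of m b, kept_of m b)) ` lead W m)" by (simp add: card_image)
  also have "(\<lambda>b. (type_of m b, kept_of m b)) ` lead W m = (SIGMA \<tau>:types. kept_sets W \<tau> m)"
  proof (intro equalityI subsetI)
    fix x assume "x \<in> (\<lambda>b. (type_of m b, kept_of m b)) ` lead W m"
    then obtain b where b: "b \<in> lead W m" "x = (type_of m b, kept_of m b)" by blast
    then have "type_of m b \<in> types" using sub type_of_in_types[OF assms] by blast
    moreover have "kept_of m b \<in> kept_sets W (type_of m b) m" using b(1) unfolding kept_sets_def if_P[OF assms] by blast
    ultimately show "x \<in> (SIGMA \<tau>:types. kept_sets W \<tau> m)" using b(2) by blast
  next
    fix x assume "x \<in> (SIGMA \<tau>:types. kept_sets W \<tau> m)"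
    then obtain \<tau> J where x: "x = (\<tau>, J)" "J \<in> kept_sets W \<tau> m" by blast
    from x(2) obtain b where "b \<in> lead W m" "type_of m b = \<tau>" "J = kept_of m b" by (rule kept_setsE)
    then show "x \<in> (\<lambda>b. (type_of m b, kept_of m b)) ` lead W m" using x(1) by blast
  qed
  also have "card \<dots> = (\<Sum>\<tau>\<in>types. card (kept_sets W \<tau> m))"
  proof (rule card_SigmaI[OF finite_types], rule ballI)
    fix \<tau>
    show "finite (kept_sets W \<tau> m)"
      by (rule finite_subset[of _ "kept_of m ` lead W m"]) (auto simp: kept_sets_def finite_lead)
  qed
  finally show ?thesis .
qed

theorem eventually_poly_card_lead:
  assumes "is_subrep K g P W"
  shows "eventually_poly (length es) d (\<lambda>m. of_nat (card (lead W m)))"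
proof (rule eventually_poly_cong)
  show "eventually_poly (length es) d (\<lambda>m. \<Sum>\<tau>\<in>types. of_nat (card (kept_sets W \<tau> m)))"
    by (intro eventually_poly_sum)
      (use eventually_poly_mono[OF eventually_poly_kept_sets[OF assms]] sum_type_count_le in blast)
  show "(\<Sum>\<tau>\<in>types. of_nat (card (kept_sets W \<tau> m))) = (of_nat (card (lead W m)) :: rat)"
    if "\<And>i. i < length es \<Longrightarrow> 0 < m i" for m
    using card_lead[of m W] that by (simp add: pos_def)
qed

end

section \<open>Dimension growth\<close>

theorem corollary4p5:
  fixes K :: "('a, 'r) ring_scheme"
    and M :: "('a, 'b) rep"
    and g d r :: nat
    and G :: ngraph
    and es :: "nat list"
  assumes "field K"
    and "is_rep K g M"
    and "d_smallish TYPE('c) K g d M"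
    and "graph_of_genus g G"
    and "length es = r"
    and "set es \<subseteq> darts G"
    and "\<forall>e\<in>set es. tail G e \<noteq> head G e"
    and "distinct (map (edge_of G) es)"
  shows "\<exists>f :: (nat \<Rightarrow>\<^sub>0 nat) \<Rightarrow>\<^sub>0 rat. poly_vars_deg_le r d f \<and>
    (\<exists>N. \<forall>m :: nat \<Rightarrow> nat. (\<forall>i<r. 0 < m i \<and> N \<le> m i) \<longrightarrow>
       vectorspace.fin_dim K (obj M (to_ngraph (subdivide G es m))) \<and>
       of_nat (vectorspace.dim K (obj M (to_ngraph (subdivide G es m)))) =
         poly_eval f (\<lambda>i. of_nat (m i)))"
proof -
  obtain n F where F: "is_filtration K g M n F" and small: "d_small TYPE('c) K g d (gr_rep M n F)"
    using assms(3) unfolding d_smallish_def by blast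
  obtain P :: "('a, 'c) rep" and N N' where P: "is_rep K g P" "fin_gen_in_degrees_le K g d P"
    and N: "is_subrep K g P N" and N'_sub: "is_subrep K g (sub_rep P N) N'"
    and iso: "rep_iso K g (gr_rep M n F) (quot_rep (sub_rep P N) N')"
    using small unfolding d_small_def by blast
  obtain gens :: "(ngraph \<times> 'c) set" where gens: "finite gens"
    "\<forall>(H, v)\<in>gens. graph_of_genus g H \<and> card (edges H) \<le> d \<and> v \<in> carrier (obj P H)"
    "\<forall>G. graph_of_genus g G \<longrightarrow> carrier (obj P G) = LinearCombinations.module.span K (obj P G)
          {act P G H \<phi> v |H v \<phi>. (H, v) \<in> gens \<and> contraction_in g G H \<phi>}"
    using P(2) unfolding fin_gen_in_degrees_le_def by blast
  interpret generators G es K g d P gens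
    by unfold_locales (use assms(4,6,8) P(1) gens in \<open>auto simp: graph_of_genus_def\<close>)
  \<comment> \<open>\<open>N'\<close> is given as a subrepresentation of \<open>N\<close>; to count
    its leading terms it has to be one of \<open>P\<close>.\<close>
  have N'_mod: "submod K (N' X) (obj P X)" and N'_le: "N' X \<subseteq> N X"
    if X: "graph_of_genus g X" for X :: ngraph
  proof -
    have "submod K (N X) (obj P X)" using N X by (simp add: is_subrep_def)
    moreover have "submod K (N' X) ((obj P X)\<lparr>carrier := N X\<rparr>)"
      using N'_sub X by (simp add: is_subrep_def sub_rep_def)
    ultimately show "submod K (N' X) (obj P X)" "N' X \<subseteq> N X"
      using submodule_trans[OF obj_module[OF X]] by blast+
  qed
  have N': "is_subrep K g P N'"
    unfolding is_subrep_def
  proof (intro conjI allI impI)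
    fix X :: ngraph assume "graph_of_genus g X"
    then show "submod K (N' X) (obj P X)" by (rule N'_mod)
  next
    fix X Y \<phi> assume "contraction_in g X Y \<phi>"
    then show "act P X Y \<phi> ` N' Y \<subseteq> N' X" using N'_sub by (simp add: is_subrep_def sub_rep_def)
  qed
  obtain \<eta> where \<eta>: "\<And>X :: ngraph. graph_of_genus g X \<Longrightarrow>
      \<eta> X \<in> LinearCombinations.module_hom K (obj (gr_rep M n F) X) (obj (quot_rep (sub_rep P N) N') X)"
    "\<And>X :: ngraph. graph_of_genus g X \<Longrightarrow>
      bij_betw (\<eta> X) (carrier (obj (gr_rep M n F) X)) (carrier (obj (quot_rep (sub_rep P N) N') X))"
    using iso unfolding rep_iso_def by blast
  have dim: "vectorspace.fin_dim K (obj M (\<Gamma> m))"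
    "vectorspace.dim K (obj M (\<Gamma> m)) = card (lead N m) - card (lead N' m)" if "pos m" for m
  proof -
    have X: "graph_of_genus g (\<Gamma> m)" by (rule \<Gamma>_genus[OF that])
    interpret graded_subquotient K "obj M (\<Gamma> m)" "obj P (\<Gamma> m)" n "\<lambda>i. F i (\<Gamma> m)" "N (\<Gamma> m)" "N' (\<Gamma> m)" "\<eta> (\<Gamma> m)"
    proof (intro graded_subquotient.intro graded_subquotient_axioms.intro)
      show "vectorspace K (obj M (\<Gamma> m))" using assms(2) X by (simp add: is_rep_def)
      show "vectorspace K (obj P (\<Gamma> m))" by (rule obj_vectorspace[OF X])
      show "submod K (F i (\<Gamma> m)) (obj M (\<Gamma> m))" if "i \<le> n" for i
        using F that X by (simp add: is_filtration_def is_subrep_def)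
      show "F 0 (\<Gamma> m) = {\<zero>\<^bsub>obj M (\<Gamma> m)\<^esub>}" "F n (\<Gamma> m) = carrier (obj M (\<Gamma> m))"
        using F X by (auto simp: is_filtration_def)
      show "F i (\<Gamma> m) \<subseteq> F (Suc i) (\<Gamma> m)" if "i < n" for i
        using F X that by (simp add: is_filtration_def)
      show "submod K (N (\<Gamma> m)) (obj P (\<Gamma> m))" using N X by (simp add: is_subrep_def)
      show "submod K (N' (\<Gamma> m)) (obj P (\<Gamma> m))" "N' (\<Gamma> m) \<subseteq> N (\<Gamma> m)"
        by (rule N'_mod[OF X], rule N'_le[OF X])
    qed (use \<eta>[OF X] in \<open>simp_all add: gr_rep_def dsum_rep_def quot_rep_def sub_rep_def\<close>)
    show "vectorspace.fin_dim K (obj M (\<Gamma> m))"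
      by (rule dim_eq_leading(1)[OF finite_base vec_in_carrier inj_key[OF that] vec_span[OF that]])
    show "vectorspace.dim K (obj M (\<Gamma> m)) = card (lead N m) - card (lead N' m)"
      unfolding lead_def
      by (rule dim_eq_leading(2)[OF finite_base vec_in_carrier inj_key[OF that] vec_span[OF that]])
  qed
  \<comment> \<open>Shows that the difference of the two counts is not truncated and may be cast to
    the rationals.\<close>
  have "card (lead N' m) \<le> card (lead N m)" if "pos m" for m
  proof (rule card_mono[OF finite_lead])
    show "lead N' m \<subseteq> lead N m"
      unfolding lead_def by (rule leading_mono[OF N'_le[OF \<Gamma>_genus[OF that]]])
  qed
  then have rat_dim: "of_nat (vectorspace.dim K (obj M (\<Gamma> m))) =
      (of_nat (card (lead N m)) - of_nat (card (lead N' m)) :: rat)" if "pos m" for m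
    using dim(2)[OF that] that by (simp add: of_nat_diff)
  have "eventually_poly r d (\<lambda>m. of_nat (card (lead N m)) - of_nat (card (lead N' m)))"
    using eventually_poly_diff[OF eventually_poly_card_lead[OF N] eventually_poly_card_lead[OF N']]
    by (simp add: assms(5))
  then obtain F' N0 where F': "polyfun r d F'" and N0: "\<forall>m. (\<forall>i<r. 0 < m i \<and> N0 \<le> m i) \<longrightarrow>
      of_nat (card (lead N m)) - of_nat (card (lead N' m)) = F' (\<lambda>i. of_nat (m i))"
    unfolding eventually_poly_def by blast
  obtain f where f: "poly_vars_deg_le r d f" "\<And>x. poly_eval f x = F' x"
    using F' unfolding polyfun_def by blast
  have "vectorspace.fin_dim K (obj M (\<Gamma> m)) \<and>
      of_nat (vectorspace.dim K (obj M (\<Gamma> m))) = poly_eval f (\<lambda>i. of_nat (m i))"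
    if m: "\<forall>i<r. 0 < m i \<and> N0 \<le> m i" for m
  proof -
    have "pos m" using m assms(5) by (simp add: pos_def)
    then show ?thesis using dim(1) rat_dim N0[rule_format, of m] m f(2) by simp
  qed
  with f(1) show ?thesis by blast
qed

end
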